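(* Let $\mathcal{D}$ be an arbitrary o-minimal structure on $(\mathbf{R}, +, \cdot)$, and let $f : \mathbf{R}^n \to \mathbf{R}$ be a function of class $C^\infty$ definable in $\mathcal{D}$. Then the bifurcation set $\mathrm{B}_f$ is a finite set.
   Context: An o-minimal structure on the real field $(\mathbf{R}, +, \cdot)$ is a family $\mathcal{D} = (\mathcal{D}_n)_{n \in \mathbf{N}}$ such that for each $n \in \mathbf{N}$: - (D1) $\mathcal{D}_n$ is a boolean algebra of subsets of $\mathbf{R}^n$ (closed under complements and finite unions). - (D2) If $A \in \mathcal{D}_n$, then $A \times \mathbf{R} \in \mathcal{D}_{n+1}$ and $\mathbf{R} \times A \in \mathcal{D}_{n+1}$. - (D3) If $A \in \mathcal{D}_{n+1}$, then $\pi(A) \in \mathcal{D}_n$, where $\pi : \mathbf{R}^{n+1} \to \mathbf{R}^n$ is the projection on the first $n$ coordinates. - (D4) $\mathcal{D}_n$ contains $\{x \in \mathbf{R}^n \mid P(x) = 0\}$ for every polynomial $P \in \mathbf{R}[X_1, \ldots, X_n]$. - (D5) Each set belonging to $\mathcal{D}_1$ is a finite union of intervals (possibly unbounded) and points. A set $A \subseteq \mathbf{R}^n$ is definable (in $\mathcal{D}$) if $A \in \mathcal{D}_n$; a map is definable if its graph is a definable set. Let $g : X \to Y$ be a smooth ($C^\infty$) map between smooth manifolds. A point $y_0 \in Y$ is a typical value of $g$ if there exists an open neighbourhood $U$ of $y_0$ in $Y$ such that the restriction $g : g^{-1}(U) \to U$ is a $C^\infty$ trivial fibration, i.e. there are a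 smooth manifold $F$ (possibly empty) and a $C^\infty$ diffeomorphism $g^{-1}(U) \to F \times U$ whose composition with the projection to $U$ equals $g$. Otherwise $y_0$ is an atypical value of $g$. The bifurcation set $\mathrm{B}_g$ is the set of atypical values of $g$. *)

theory Defs
  imports "HOL-Analysis.Analysis"
begin

text \<open>
  Since all the spaces \<open>\<real>\<^sup>n\<close> occur simultaneously, \<open>\<real>\<^sup>n\<close> is the library space \<^const>\<open>Euclidean_space\<close> \<open>n\<close>:
  functions \<open>x :: nat \<Rightarrow> real\<close> with coordinates \<open>x 0, \<dots>, x (n - 1)\<close> and \<open>x i = 0\<close> for \<open>i \<ge> n\<close>.
\<close>

definition Rn :: "nat \<Rightarrow> (nat \<Rightarrow> real) set"
  where "Rn n = topspace (Euclidean_space n)"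

definition vec1 :: "real \<Rightarrow> nat \<Rightarrow> real"
  where "vec1 t = (\<lambda>i. if i = 0 then t else 0)"

text \<open>The identification \<open>\<real>\<^sup>m \<times> \<real>\<^sup>k = \<real>\<^sup>m\<^sup>+\<^sup>k\<close>.\<close>

definition join :: "nat \<Rightarrow> (nat \<Rightarrow> real) \<Rightarrow> (nat \<Rightarrow> real) \<Rightarrow> nat \<Rightarrow> real"
  where "join m x y = (\<lambda>i. if i < m then x i else y (i - m))"

definition joined_prod :: "nat \<Rightarrow> (nat \<Rightarrow> real) set \<Rightarrow> (nat \<Rightarrow> real) set \<Rightarrow> (nat \<Rightarrow> real) set"
  where "joined_prod m A B = {join m x y |x y. x \<in> A \<and> y \<in> B}"

text \<open>Projection to the first \<open>n\<close> coordinates.\<close>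

definition proj :: "nat \<Rightarrow> (nat \<Rightarrow> real) \<Rightarrow> nat \<Rightarrow> real"
  where "proj n x = (\<lambda>i. if i < n then x i else 0)"

text \<open>
  The polynomial with monomials \<open>c \<alpha> * X\<^sup>\<alpha>\<close>, \<open>\<alpha> \<in> E\<close>, evaluated at \<open>x\<close>; an exponent \<open>\<alpha>\<close> matters only
  through its values below \<open>n\<close>.
\<close>

definition poly_value ::
    "nat \<Rightarrow> (nat \<Rightarrow> nat) set \<Rightarrow> ((nat \<Rightarrow> nat) \<Rightarrow> real) \<Rightarrow> (nat \<Rightarrow> real) \<Rightarrow> real"
  where "poly_value n E c x = (\<Sum>\<alpha>\<in>E. c \<alpha> * (\<Prod>i<n. x i ^ \<alpha> i))"


section \<open>O-minimal structures on the real field\<close>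

locale o_minimal_structure =
  fixes D :: "nat \<Rightarrow> (nat \<Rightarrow> real) set set"
  assumes D1: "algebra (Rn n) (D n)"
    and D2_right: "A \<in> D n \<Longrightarrow> joined_prod n A (Rn 1) \<in> D (n + 1)"
    and D2_left: "A \<in> D n \<Longrightarrow> joined_prod 1 (Rn 1) A \<in> D (n + 1)"
    and D3: "A \<in> D (n + 1) \<Longrightarrow> proj n ` A \<in> D n"
    and D4: "finite E \<Longrightarrow> {x \<in> Rn n. poly_value n E c x = 0} \<in> D n"
    \<comment> \<open>points are degenerate intervals\<close>
    and D5: "A \<in> D 1 \<Longrightarrow>
      \<exists>I :: real set set. finite I \<and> (\<forall>S\<in>I. is_interval S) \<and> (\<lambda>x. x 0) ` A = \<Union>I"

definition definable_fun ::
    "(nat \<Rightarrow> (nat \<Rightarrow> real) set set) \<Rightarrow> nat \<Rightarrow> ((nat \<Rightarrow> real) \<Rightarrow> real) \<Rightarrow> bool"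
  where "definable_fun D n f \<longleftrightarrow> {join n x (vec1 (f x)) |x. x \<in> Rn n} \<in> D (n + 1)"


section \<open>Smooth functions on open subsets of \<open>\<real>\<^sup>n\<close>\<close>

definition partial_deriv :: "nat \<Rightarrow> ((nat \<Rightarrow> real) \<Rightarrow> real) \<Rightarrow> (nat \<Rightarrow> real) \<Rightarrow> real"
  where "partial_deriv i f x = deriv (\<lambda>t. f (x(i := t))) (x i)"

text \<open>Class \<open>C\<^sup>k\<close> on \<open>V\<close>, by existence and continuity of the iterated partial derivatives.\<close>

fun Ck_on :: "nat \<Rightarrow> nat \<Rightarrow> (nat \<Rightarrow> real) set \<Rightarrow> ((nat \<Rightarrow> real) \<Rightarrow> real) \<Rightarrow> bool" where
  "Ck_on 0 n V f \<longleftrightarrow> continuous_on V f"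
| "Ck_on (Suc k) n V f \<longleftrightarrow> continuous_on V f \<and>
     (\<forall>i<n. (\<forall>x\<in>V. (\<lambda>t. f (x(i := t))) differentiable (at (x i))) \<and>
            Ck_on k n V (partial_deriv i f))"

definition smooth_on :: "nat \<Rightarrow> (nat \<Rightarrow> real) set \<Rightarrow> ((nat \<Rightarrow> real) \<Rightarrow> real) \<Rightarrow> bool"
  where "smooth_on n V f \<longleftrightarrow> openin (Euclidean_space n) V \<and> (\<forall>k. Ck_on k n V f)"

definition smooth_vec_on ::
    "nat \<Rightarrow> nat \<Rightarrow> (nat \<Rightarrow> real) set \<Rightarrow> ((nat \<Rightarrow> real) \<Rightarrow> nat \<Rightarrow> real) \<Rightarrow> bool"
  where "smooth_vec_on n m V h \<longleftrightarrow> h ` V \<subseteq> Rn m \<and> (\<forall>j<m. smooth_on n V (\<lambda>z. h z j))"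


section \<open>Smooth manifolds\<close>

record 'a manifold =
  mtop :: "'a topology"
  mdim :: nat
  atlas :: "('a set \<times> ('a \<Rightarrow> nat \<Rightarrow> real)) set"

abbreviation mspace :: "'a manifold \<Rightarrow> 'a set"
  where "mspace M \<equiv> topspace (mtop M)"

definition second_countable_space :: "'a topology \<Rightarrow> bool"
  where "second_countable_space T \<longleftrightarrow>
    (\<exists>\<B>. countable \<B> \<and> (\<forall>B\<in>\<B>. openin T B) \<and>
         (\<forall>W x. openin T W \<and> x \<in> W \<longrightarrow> (\<exists>B\<in>\<B>. x \<in> B \<and> B \<subseteq> W)))"

definition is_chart :: "'a topology \<Rightarrow> nat \<Rightarrow> 'a set \<Rightarrow> ('a \<Rightarrow> nat \<Rightarrow> real) \<Rightarrow> bool"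
  where "is_chart T n V \<phi> \<longleftrightarrow> openin T V \<and> openin (Euclidean_space n) (\<phi> ` V) \<and>
    homeomorphic_map (subtopology T V) (subtopology (Euclidean_space n) (\<phi> ` V)) \<phi>"

definition smooth_manifold :: "'a manifold \<Rightarrow> bool"
  where "smooth_manifold M \<longleftrightarrow>
    Hausdorff_space (mtop M) \<and> second_countable_space (mtop M) \<and>
    (\<forall>(V, \<phi>)\<in>atlas M. is_chart (mtop M) (mdim M) V \<phi>) \<and>
    (\<Union>(V, \<phi>)\<in>atlas M. V) = mspace M \<and>
    (\<forall>(V, \<phi>)\<in>atlas M. \<forall>(W, \<psi>)\<in>atlas M.
       smooth_vec_on (mdim M) (mdim M) (\<phi> ` (V \<inter> W)) (\<lambda>z. \<psi> (inv_into V \<phi> z)))"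

definition smooth_map :: "'a manifold \<Rightarrow> 'b manifold \<Rightarrow> ('a \<Rightarrow> 'b) \<Rightarrow> bool"
  where "smooth_map M N g \<longleftrightarrow> continuous_map (mtop M) (mtop N) g \<and>
    (\<forall>(V, \<phi>)\<in>atlas M. \<forall>(W, \<psi>)\<in>atlas N.
       smooth_vec_on (mdim M) (mdim N) (\<phi> ` {x \<in> V. g x \<in> W}) (\<lambda>z. \<psi> (g (inv_into V \<phi> z))))"

definition diffeomorphism :: "'a manifold \<Rightarrow> 'b manifold \<Rightarrow> ('a \<Rightarrow> 'b) \<Rightarrow> bool"
  where "diffeomorphism M N \<Phi> \<longleftrightarrow> smooth_map M N \<Phi> \<and>
    (\<exists>\<Psi>. smooth_map N M \<Psi> \<and> (\<forall>x\<in>mspace M. \<Psi> (\<Phi> x) = x) \<and> (\<forall>y\<in>mspace N. \<Phi> (\<Psi> y) = y))"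

text \<open>Here \<open>W\<close> is meant to be open in \<open>M\<close>.\<close>

definition open_submanifold :: "'a manifold \<Rightarrow> 'a set \<Rightarrow> 'a manifold"
  where "open_submanifold M W =
    \<lparr>mtop = subtopology (mtop M) W, mdim = mdim M, atlas = {(V \<inter> W, \<phi>) |V \<phi>. (V, \<phi>) \<in> atlas M}\<rparr>"

definition prod_manifold :: "'a manifold \<Rightarrow> 'b manifold \<Rightarrow> ('a \<times> 'b) manifold"
  where "prod_manifold M N =
    \<lparr>mtop = prod_topology (mtop M) (mtop N), mdim = mdim M + mdim N,
     atlas = {(V \<times> W, \<lambda>(x, y). join (mdim M) (\<phi> x) (\<psi> y)) |V \<phi> W \<psi>.
                (V, \<phi>) \<in> atlas M \<and> (W, \<psi>) \<in> atlas N}\<rparr>"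

definition Rn_manifold :: "nat \<Rightarrow> (nat \<Rightarrow> real) manifold"
  where "Rn_manifold n = \<lparr>mtop = Euclidean_space n, mdim = n, atlas = {(Rn n, \<lambda>x. x)}\<rparr>"

definition real_manifold :: "real manifold"
  where "real_manifold = \<lparr>mtop = euclideanreal, mdim = 1, atlas = {(UNIV, vec1)}\<rparr>"


section \<open>Bifurcation set\<close>

text \<open>
  The points of the fibre manifold \<open>F\<close> are taken from the type of the points of \<open>X\<close>. This loses no
  generality: as \<open>U\<close> contains \<open>y0\<close>, any \<open>F\<close> as required injects into \<open>X\<close> through the slice
  \<open>F \<times> {y0}\<close>, and its manifold structure can be transported to the image. The manifold \<open>F\<close> may be empty.
\<close>

definition typical_value :: "'a manifold \<Rightarrow> 'b manifold \<Rightarrow> ('a \<Rightarrow> 'b) \<Rightarrow> 'b \<Rightarrow> bool"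
  where "typical_value X Y g y0 \<longleftrightarrow>
    (\<exists>U. openin (mtop Y) U \<and> y0 \<in> U \<and>
      (\<exists>(F :: 'a manifold) \<Phi>. smooth_manifold F \<and>
         diffeomorphism (open_submanifold X {x \<in> mspace X. g x \<in> U})
           (prod_manifold F (open_submanifold Y U)) \<Phi> \<and>
         (\<forall>x\<in>mspace X. g x \<in> U \<longrightarrow> snd (\<Phi> x) = g x)))"

definition bifurcation_set :: "'a manifold \<Rightarrow> 'b manifold \<Rightarrow> ('a \<Rightarrow> 'b) \<Rightarrow> 'b set"
  where "bifurcation_set X Y g = {y \<in> mspace Y. \<not> typical_value X Y g y}"

end

theory Submission
  imports Defs
begin

text \<open>
  Measure points by the l1 norm \<open>\<bar>x\<bar>\<close>, and let \<open>G x\<close> be the l1 norm of the gradient of \<open>f\<close> at \<open>x\<close>. Call \<open>c\<close> asymptotically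
  critical if there are points \<open>x\<close> with \<open>f x\<close> arbitrarily close to \<open>c\<close> and \<open>(1 + \<bar>x\<bar>) * G x\<close> arbitrarily
  small; critical values are a special case. The theorem follows from two facts: every other value is
  typical (\<open>typical_value_in_band\<close>), and there are only finitely many asymptotically critical values
  (\<open>finite_asymptotic_critical\<close>).

  \<^bold>\<open>Typical values.\<close> If \<open>(1 + \<bar>x\<bar>) * G x \<ge> \<delta> > 0\<close> wherever \<open>a < f x < b\<close>, let the points flow along the gradient, damped
  by the factor \<open>1 / (1 + \<Sum>i. (\<partial>\<^sub>i f)\<^sup>2)\<close>. The damped field is bounded, so its flow is complete. Along a
  trajectory the value of \<open>f\<close> increases, and the logarithm of \<open>1 + \<Sum>i. (x i)\<^sup>2\<close> grows at most
  linearly with that value. A trajectory that never got past a level in \<open>(a, b)\<close> would therefore be bounded,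
  \<open>f\<close> would increase along it at a rate bounded away from \<open>0\<close>, and this is absurd (\<open>reaches_level\<close>). So each trajectory meets each level
  in \<open>(a, b)\<close>, exactly once, at a time that is smooth in the starting point and the level by the implicit function
  theorem. Moving points along their trajectories from one level to another identifies the part of the space over
  \<open>(a, b)\<close> with \<open>f\<^sup>-\<^sup>1(c) \<times> (a, b)\<close>.

  The flow comes from Picard iteration. It is smooth because its partial derivatives in the starting point are
  components of the flow of the prolonged field \<open>(x, w) \<mapsto> (V x, DV(x) w)\<close>, so that one more degree of
  differentiability for all fields follows from the previous one (\<open>flow_smooth\<close>).

  \<^bold>\<open>Finiteness.\<close> The set of asymptotically critical values is definable. If it were infinite it would
  contain an interval, and by a countability argument also an interval in which each \<open>c\<close> is the value of \<open>f\<close> at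
  points with \<open>(1 + \<bar>x\<bar>) * G x\<close> arbitrarily small. Select definably, for each level \<open>c\<close> and each radius \<open>r\<close>, a point
  \<open>x(c, r)\<close> with \<open>\<bar>x\<bar> \<le> r\<close> and \<open>f x = c\<close> where \<open>G\<close> is smallest. Then \<open>r * G (x(c, r))\<close> tends to \<open>0\<close> as \<open>r\<close> grows, for each \<open>c\<close>.
  After shrinking the interval, this function and the coordinates of \<open>x(c, r)\<close> are continuous and monotone in \<open>c\<close>, for all large
  \<open>r\<close> at once (\<open>families_eventually_monotone\<close>); so \<open>r * G (x(c, r))\<close> is less than a given \<open>\<epsilon>\<close> on a whole segment \<open>[c1, c2]\<close>
  as soon as it is so at its end points. The curve \<open>c \<mapsto> x(c, r)\<close> has length at most \<open>2 * r\<close>, as its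
  coordinates are monotone, and \<open>f\<close> grows along it by less than \<open>\<epsilon> / r\<close> per unit of length.
  Hence \<open>c2 - c1 \<le> 2 * \<epsilon>\<close> for every \<open>\<epsilon> > 0\<close>, which is impossible (\<open>curve_estimate\<close>, \<open>no_interval\<close>).

  Definable families are controlled by one observation: an interval covered by countably many definable sets
  contains a subinterval that lies in one of them (\<open>countable_cover\<close>), because finite sets cannot cover it and
  infinite definable sets contain intervals.
\<close>

section \<open>Calculus on \<open>\<real>\<^sup>n\<close> in coordinates\<close>

lemma Rn_iff: "x \<in> Rn n \<longleftrightarrow> (\<forall>i\<ge>n. x i = 0)"
  by (auto simp: Rn_def topspace_Euclidean_space)

lemma Rn_eqI: "x \<in> Rn n \<Longrightarrow> y \<in> Rn n \<Longrightarrow> (\<And>i. i < n \<Longrightarrow> x i = y i) \<Longrightarrow> x = y"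
  by (metis Rn_iff ext linorder_not_le)

lemma Rn_upd: "x \<in> Rn n \<Longrightarrow> i < n \<Longrightarrow> x(i := t) \<in> Rn n"
  by (auto simp: Rn_iff)

lemma proj_in_Rn [simp]: "proj n x \<in> Rn n"
  by (auto simp: Rn_iff proj_def)

lemma proj_Rn: "x \<in> Rn n \<Longrightarrow> proj n x = x"
  by (rule ext) (auto simp: Rn_iff proj_def)

lemma open_coordinate_box: "open {y :: nat \<Rightarrow> real. \<forall>i<n. \<bar>y i - x i\<bar> < d}"
proof -
  have "{y :: nat \<Rightarrow> real. \<forall>i<n. \<bar>y i - x i\<bar> < d} = (\<Inter>i\<in>{..<n}. {y. \<bar>y i - x i\<bar> < d})" by auto
  moreover have "open \<dots>"
    by (intro open_INT ballI finite_lessThan open_Collect_less continuous_intros continuous_on_product_then_coordinatewise)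
  ultimately show ?thesis by simp
qed

lemma open_contains_box:
  assumes "open T" "x \<in> T" "x \<in> Rn n"
  shows "\<exists>d>0. \<forall>y\<in>Rn n. (\<forall>i<n. \<bar>y i - x i\<bar> < d) \<longrightarrow> y \<in> T"
proof -
  have "openin (product_topology (\<lambda>i::nat. euclidean) UNIV) T"
    using assms(1) by (simp add: open_fun_def)
  from product_topology_open_contains_basis[OF this assms(2)]
  obtain X where X: "x \<in> (\<Pi>\<^sub>E i\<in>UNIV. X i)" "\<And>i. open (X i)" "(\<Pi>\<^sub>E i\<in>UNIV. X i) \<subseteq> T"
    by (auto simp: )
  have xi: "x i \<in> X i" for i using X(1) by auto
  have "\<exists>d>0. \<forall>t. \<bar>t - x i\<bar> < d \<longrightarrow> t \<in> X i" for i
    using X(2)[of i] xi[of i] unfolding open_dist dist_real_def by blast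
  then obtain d where d: "\<And>i. d i > 0" "\<And>i t. \<bar>t - x i\<bar> < d i \<Longrightarrow> t \<in> X i" by metis
  define e where "e = Min (insert 1 (d ` {..<n}))"
  have e: "e > 0" "\<And>i. i < n \<Longrightarrow> e \<le> d i" using d(1) by (auto simp: e_def)
  have "y \<in> T" if y: "y \<in> Rn n" "\<forall>i<n. \<bar>y i - x i\<bar> < e" for y
  proof -
    have "y i \<in> X i" for i
    proof (cases "i < n")
      case True then show ?thesis using d(2) e(2) y(2) by fastforce
    next
      case False then show ?thesis using y(1) assms(3) xi[of i] by (simp add: Rn_iff)
    qed
    then show ?thesis using X(3) by (auto simp: PiE_def extensional_def)
  qed
  then show ?thesis using e(1) by blast
qed

lemma openin_Rn_iff:
  "openin (Euclidean_space n) V \<longleftrightarrow> (\<exists>T. open T \<and> V = T \<inter> Rn n)"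
  by (auto simp: Euclidean_space_def openin_subtopology Rn_iff euclidean_product_topology)

lemma openin_Rn_box:
  "openin (Euclidean_space n) V \<longleftrightarrow>
     V \<subseteq> Rn n \<and> (\<forall>x\<in>V. \<exists>d>0. \<forall>y\<in>Rn n. (\<forall>i<n. \<bar>y i - x i\<bar> < d) \<longrightarrow> y \<in> V)"
proof (safe, goal_cases)
  case (1 x) then show ?case by (auto simp: openin_Rn_iff)
next
  case (2 x)
  then obtain T where T: "open T" "V = T \<inter> Rn n" by (auto simp: openin_Rn_iff)
  then show ?case using open_contains_box[of T x n] 2 by auto
next
  case 3
  then obtain d where d: "\<And>x. x \<in> V \<Longrightarrow> d x > 0"
    "\<And>x y. x \<in> V \<Longrightarrow> y \<in> Rn n \<Longrightarrow> (\<forall>i<n. \<bar>y i - x i\<bar> < d x) \<Longrightarrow> y \<in> V" by metis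
  define T where "T = (\<Union>x\<in>V. {y. \<forall>i<n. \<bar>y i - x i\<bar> < d x})"
  have "open T" unfolding T_def using open_coordinate_box by blast
  moreover have "V = T \<inter> Rn n" using d 3 by (auto simp: T_def)
  ultimately show ?case by (auto simp: openin_Rn_iff)
qed

lemma openin_Rn_subset: "openin (Euclidean_space n) V \<Longrightarrow> V \<subseteq> Rn n"
  by (simp add: openin_Rn_box)

lemma openin_Rn_UNIV [simp]: "openin (Euclidean_space n) (Rn n)"
  by (simp add: Rn_def)

text \<open>Epsilon-delta with coordinatewise distances; the metric that the type \<open>nat \<Rightarrow> real\<close> carries
  is inconvenient because it weights the coordinates.\<close>

lemma continuous_on_Rn_box:
  fixes f :: "(nat \<Rightarrow> real) \<Rightarrow> real"
  assumes "V \<subseteq> Rn n"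
  shows "continuous_on V f \<longleftrightarrow>
    (\<forall>x\<in>V. \<forall>e>0. \<exists>d>0. \<forall>y\<in>V. (\<forall>i<n. \<bar>y i - x i\<bar> < d) \<longrightarrow> \<bar>f y - f x\<bar> < e)"
proof (safe, goal_cases)
  case (1 x e)
  have "open (ball (f x) e)" by simp
  with 1 obtain A where A: "open A" "x \<in> A" "\<forall>y\<in>V. y \<in> A \<longrightarrow> f y \<in> ball (f x) e"
    unfolding continuous_on_topological by (metis centre_in_ball)
  obtain d where "d > 0" "\<forall>y\<in>Rn n. (\<forall>i<n. \<bar>y i - x i\<bar> < d) \<longrightarrow> y \<in> A"
    using open_contains_box[OF A(1,2)] assms 1 by blast
  then show ?case using A(3) assms by (intro exI[of _ d]) (auto simp: dist_real_def abs_minus_commute)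
next
  case 2
  show ?case unfolding continuous_on_topological
  proof (intro ballI allI impI)
    fix x B assume x: "x \<in> V" and B: "open B" "f x \<in> B"
    then obtain e where e: "e > 0" "ball (f x) e \<subseteq> B" by (meson openE)
    obtain d where d: "d > 0" "\<forall>y\<in>V. (\<forall>i<n. \<bar>y i - x i\<bar> < d) \<longrightarrow> \<bar>f y - f x\<bar> < e"
      using 2 x e(1) by blast
    show "\<exists>A. open A \<and> x \<in> A \<and> (\<forall>y\<in>V. y \<in> A \<longrightarrow> f y \<in> B)"
      using d e(2) open_coordinate_box[of n x d]
      by (intro exI[of _ "{y. \<forall>i<n. \<bar>y i - x i\<bar> < d}"]) (auto simp: dist_real_def abs_minus_commute subset_iff)
  qed
qed

lemma continuous_on_locally_open:
  fixes f :: "(nat \<Rightarrow> real) \<Rightarrow> real"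
  assumes V: "V \<subseteq> Rn n"
    and loc: "\<And>x. x \<in> V \<Longrightarrow> \<exists>W. openin (Euclidean_space n) W \<and> x \<in> W \<and> continuous_on (W \<inter> V) f"
  shows "continuous_on V f"
  unfolding continuous_on_Rn_box[OF V]
proof (intro ballI allI impI)
  fix x e :: "_" assume x: "x \<in> V" and e: "(e::real) > 0"
  obtain W where W: "openin (Euclidean_space n) W" "x \<in> W" "continuous_on (W \<inter> V) f" using loc[OF x] by blast
  obtain d1 where d1: "d1 > 0" "\<forall>y\<in>Rn n. (\<forall>i<n. \<bar>y i - x i\<bar> < d1) \<longrightarrow> y \<in> W"
    using W(1,2) by (auto simp: openin_Rn_box)
  have "W \<inter> V \<subseteq> Rn n" using V by auto
  from W(3)[unfolded continuous_on_Rn_box[OF this]] x W(2) e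
  obtain d2 where d2: "d2 > 0" "\<forall>y\<in>W \<inter> V. (\<forall>i<n. \<bar>y i - x i\<bar> < d2) \<longrightarrow> \<bar>f y - f x\<bar> < e" by blast
  show "\<exists>d>0. \<forall>y\<in>V. (\<forall>i<n. \<bar>y i - x i\<bar> < d) \<longrightarrow> \<bar>f y - f x\<bar> < e"
    using d1 d2 V by (intro exI[of _ "min d1 d2"]) (auto simp: subset_iff)
qed

lemma eventually_line_in_open:
  assumes "openin (Euclidean_space n) V" "x \<in> V" "i < n"
  shows "\<forall>\<^sub>F t in nhds (x i). x(i := t) \<in> V"
proof -
  obtain d where d: "d > 0" "\<forall>y\<in>Rn n. (\<forall>i<n. \<bar>y i - x i\<bar> < d) \<longrightarrow> y \<in> V"
    using assms by (auto simp: openin_Rn_box)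
  have "x \<in> Rn n" using assms openin_Rn_subset by blast
  then have "x(i := t) \<in> V" if "dist t (x i) < d" for t
    using d that assms(3) by (auto simp: dist_real_def intro!: d(2)[rule_format] Rn_upd)
  then show ?thesis using d(1) unfolding eventually_nhds_metric by blast
qed

definition has_partial :: "((nat \<Rightarrow> real) \<Rightarrow> real) \<Rightarrow> nat \<Rightarrow> real \<Rightarrow> (nat \<Rightarrow> real) \<Rightarrow> bool"
  where "has_partial f i c x \<longleftrightarrow> ((\<lambda>t. f (x(i := t))) has_real_derivative c) (at (x i))"

lemma partial_deriv_eqI: "has_partial f i c x \<Longrightarrow> partial_deriv i f x = c"
  by (simp add: partial_deriv_def has_partial_def DERIV_imp_deriv)

lemma has_partial_const: "has_partial (\<lambda>x. c) i 0 x"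
  by (simp add: has_partial_def)

lemma has_partial_coord: "has_partial (\<lambda>x. x j) i (if i = j then 1 else 0) x"
  by (simp add: has_partial_def)

lemma has_partial_add:
  "has_partial f i a x \<Longrightarrow> has_partial g i b x \<Longrightarrow> has_partial (\<lambda>x. f x + g x) i (a + b) x"
  unfolding has_partial_def by (rule DERIV_add)

lemma has_partial_mult:
  "has_partial f i a x \<Longrightarrow> has_partial g i b x \<Longrightarrow> has_partial (\<lambda>x. f x * g x) i (f x * b + a * g x) x"
  unfolding has_partial_def by (drule (1) DERIV_mult) (simp add: mult.commute add.commute)

lemma has_partial_inverse:
  "has_partial f i a x \<Longrightarrow> f x \<noteq> 0 \<Longrightarrow>
    has_partial (\<lambda>x. inverse (f x)) i (- (inverse (f x) * a * inverse (f x))) x"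
  unfolding has_partial_def by (drule DERIV_inverse') simp_all

lemma Ck_on_Suc_iff:
  "Ck_on (Suc k) n V f \<longleftrightarrow> continuous_on V f \<and>
     (\<forall>i<n. (\<forall>x\<in>V. has_partial f i (partial_deriv i f x) x) \<and> Ck_on k n V (partial_deriv i f))"
  by (simp add: partial_deriv_def has_partial_def DERIV_deriv_iff_real_differentiable)

declare Ck_on.simps(2) [simp del]

lemma has_partial_cong:
  assumes "openin (Euclidean_space n) V" "x \<in> V" "i < n" "\<And>y. y \<in> V \<Longrightarrow> f y = g y"
  shows "has_partial f i c x \<longleftrightarrow> has_partial g i c x"
  unfolding has_partial_def
  by (rule DERIV_cong_ev) (auto intro: eventually_mono[OF eventually_line_in_open[OF assms(1-3)]] assms(4))

lemma partial_deriv_cong: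
  assumes "openin (Euclidean_space n) V" "x \<in> V" "i < n" "\<And>y. y \<in> V \<Longrightarrow> f y = g y"
  shows "partial_deriv i f x = partial_deriv i g x"
  unfolding partial_deriv_def
  by (rule deriv_cong_ev) (auto intro: eventually_mono[OF eventually_line_in_open[OF assms(1-3)]] assms(4))

lemma Ck_on_cong:
  assumes "openin (Euclidean_space n) V" "\<And>y. y \<in> V \<Longrightarrow> f y = g y"
  shows "Ck_on k n V f = Ck_on k n V g"
  using assms(2)
proof (induction k arbitrary: f g)
  case 0
  then show ?case using continuous_on_cong by fastforce
next
  case (Suc k)
  have "continuous_on V f \<longleftrightarrow> continuous_on V g" using Suc.prems continuous_on_cong by fastforce
  moreover have "partial_deriv i f x = partial_deriv i g x" if "x \<in> V" "i < n" for x i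
    using partial_deriv_cong[OF assms(1) that] Suc.prems by blast
  moreover from this have "Ck_on k n V (partial_deriv i f) = Ck_on k n V (partial_deriv i g)" if "i < n" for i
    using Suc.IH that by blast
  moreover have "has_partial f i c x \<longleftrightarrow> has_partial g i c x" if "x \<in> V" "i < n" for x i c
    using has_partial_cong[OF assms(1) that] Suc.prems by blast
  ultimately show ?case by (simp add: Ck_on_Suc_iff)
qed

text \<open>The candidate derivatives \<open>g i\<close> need to agree with \<^const>\<open>partial_deriv\<close> only on \<open>V\<close>, so \<open>g\<close> can be a formula.\<close>

lemma Ck_on_SucI:
  assumes "openin (Euclidean_space n) V" "continuous_on V f"
    "\<And>i x. i < n \<Longrightarrow> x \<in> V \<Longrightarrow> has_partial f i (g i x) x"
    "\<And>i. i < n \<Longrightarrow> Ck_on k n V (g i)"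
  shows "Ck_on (Suc k) n V f"
proof -
  have "partial_deriv i f x = g i x" if "i < n" "x \<in> V" for i x
    using assms(3)[OF that] partial_deriv_eqI by blast
  then show ?thesis using assms Ck_on_cong[OF assms(1), of "partial_deriv _ f" "g _"]
    by (simp add: Ck_on_Suc_iff)
qed

lemma Ck_on_continuous: "Ck_on k n V f \<Longrightarrow> continuous_on V f"
  by (cases k) (auto simp: Ck_on_Suc_iff)

lemma Ck_on_SucD: "Ck_on (Suc k) n V f \<Longrightarrow> Ck_on k n V f"
  by (induction k arbitrary: f) (auto simp: Ck_on_Suc_iff)

lemma Ck_on_mono: "Ck_on k n V f \<Longrightarrow> l \<le> k \<Longrightarrow> Ck_on l n V f"
  by (induction k) (auto simp: le_Suc_eq dest: Ck_on_SucD)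

lemma Ck_on_partial: "Ck_on (Suc k) n V f \<Longrightarrow> i < n \<Longrightarrow> Ck_on k n V (partial_deriv i f)"
  by (simp add: Ck_on_Suc_iff)

lemma Ck_on_has_partial:
  "Ck_on (Suc k) n V f \<Longrightarrow> i < n \<Longrightarrow> x \<in> V \<Longrightarrow> has_partial f i (partial_deriv i f x) x"
  by (simp add: Ck_on_Suc_iff)

lemma Ck_on_subset: "Ck_on k n V f \<Longrightarrow> W \<subseteq> V \<Longrightarrow> Ck_on k n W f"
  by (induction k arbitrary: f) (auto simp: Ck_on_Suc_iff intro: continuous_on_subset)

lemma Ck_on_local:
  assumes "openin (Euclidean_space n) V"
    "\<And>x. x \<in> V \<Longrightarrow> \<exists>W. openin (Euclidean_space n) W \<and> x \<in> W \<and> Ck_on k n W f"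
  shows "Ck_on k n V f"
  using assms(2)
proof (induction k arbitrary: f)
  case 0
  then show ?case using openin_Rn_subset[OF assms(1)]
    by simp (meson continuous_on_locally_open continuous_on_subset inf_le1)
next
  case (Suc k)
  have "continuous_on V f" using openin_Rn_subset[OF assms(1)] Suc.prems
    by (meson continuous_on_locally_open continuous_on_subset inf_le1 Ck_on_continuous)
  moreover have "has_partial f i (partial_deriv i f x) x" if "i < n" "x \<in> V" for i x
    using Suc.prems that Ck_on_has_partial by blast
  moreover have "Ck_on k n V (partial_deriv i f)" if "i < n" for i
    using Suc.IH Suc.prems that Ck_on_partial by meson
  ultimately show ?case by (simp add: Ck_on_Suc_iff)
qed

lemma Ck_on_const: "openin (Euclidean_space n) V \<Longrightarrow> Ck_on k n V (\<lambda>x. c)"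
proof (induction k arbitrary: c)
  case (Suc k) then show ?case by (intro Ck_on_SucI[where g = "\<lambda>i x. 0"] has_partial_const) auto
qed auto

lemma Ck_on_coord: "openin (Euclidean_space n) V \<Longrightarrow> Ck_on k n V (\<lambda>x. x j)"
proof (cases k)
  case (Suc l)
  assume V: "openin (Euclidean_space n) V"
  show ?thesis unfolding Suc
    by (intro Ck_on_SucI[where g = "\<lambda>i x. if i = j then 1 else 0"] V continuous_on_subset[OF continuous_on_product_coordinates])
       (simp_all only: has_partial_coord, auto intro: Ck_on_const V)
qed (auto intro: continuous_on_subset[OF continuous_on_product_coordinates])

lemma Ck_on_add:
  "openin (Euclidean_space n) V \<Longrightarrow> Ck_on k n V f \<Longrightarrow> Ck_on k n V g \<Longrightarrow> Ck_on k n V (\<lambda>x. f x + g x)"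
proof (induction k arbitrary: f g)
  case (Suc k)
  then show ?case
    by (intro Ck_on_SucI[where g = "\<lambda>i x. partial_deriv i f x + partial_deriv i g x"])
       (auto simp: Ck_on_Suc_iff intro!: continuous_intros has_partial_add)
qed (auto intro: continuous_intros)

lemma Ck_on_mult:
  "openin (Euclidean_space n) V \<Longrightarrow> Ck_on k n V f \<Longrightarrow> Ck_on k n V g \<Longrightarrow> Ck_on k n V (\<lambda>x. f x * g x)"
proof (induction k arbitrary: f g)
  case (Suc k)
  have 1: "Ck_on k n V f" "Ck_on k n V g" using Suc.prems Ck_on_SucD by blast+
  show ?case
  proof (intro Ck_on_SucI[where g = "\<lambda>i x. f x * partial_deriv i g x + partial_deriv i f x * g x"])
    fix i x assume "i < n" "x \<in> V"
    with Suc.prems show "has_partial (\<lambda>x. f x * g x) i (f x * partial_deriv i g x + partial_deriv i f x * g x) x"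
      by (intro has_partial_mult) (auto simp: Ck_on_Suc_iff)
  qed (use Suc 1 in \<open>auto simp: Ck_on_Suc_iff intro!: continuous_intros Ck_on_add\<close>)
qed (auto intro: continuous_intros)

lemma Ck_on_cmult: "openin (Euclidean_space n) V \<Longrightarrow> Ck_on k n V f \<Longrightarrow> Ck_on k n V (\<lambda>x. c * f x)"
  by (intro Ck_on_mult Ck_on_const)

lemma Ck_on_minus: "openin (Euclidean_space n) V \<Longrightarrow> Ck_on k n V f \<Longrightarrow> Ck_on k n V (\<lambda>x. - f x)"
  using Ck_on_cmult[of n V k f "-1"] by simp

lemma Ck_on_diff:
  "openin (Euclidean_space n) V \<Longrightarrow> Ck_on k n V f \<Longrightarrow> Ck_on k n V g \<Longrightarrow> Ck_on k n V (\<lambda>x. f x - g x)"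
  using Ck_on_add[of n V k f "\<lambda>x. - g x"] Ck_on_minus[of n V k g] by simp

lemma Ck_on_sum:
  "openin (Euclidean_space n) V \<Longrightarrow> (\<And>a. a \<in> A \<Longrightarrow> Ck_on k n V (f a)) \<Longrightarrow> Ck_on k n V (\<lambda>x. \<Sum>a\<in>A. f a x)"
  by (induction A rule: infinite_finite_induct) (auto intro: Ck_on_const Ck_on_add)

lemma Ck_on_inverse:
  "openin (Euclidean_space n) V \<Longrightarrow> Ck_on k n V f \<Longrightarrow> (\<And>x. x \<in> V \<Longrightarrow> f x \<noteq> 0) \<Longrightarrow> Ck_on k n V (\<lambda>x. inverse (f x))"
proof (induction k)
  case (Suc k)
  have 1: "Ck_on k n V (\<lambda>x. inverse (f x))" using Suc Ck_on_SucD by blast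
  show ?case
  proof (intro Ck_on_SucI[where g = "\<lambda>i x. - (inverse (f x) * partial_deriv i f x * inverse (f x))"])
    fix i x assume "i < n" "x \<in> V"
    with Suc.prems show "has_partial (\<lambda>x. inverse (f x)) i (- (inverse (f x) * partial_deriv i f x * inverse (f x))) x"
      by (intro has_partial_inverse) (auto simp: Ck_on_Suc_iff)
  qed (use Suc 1 in \<open>auto simp: Ck_on_Suc_iff intro!: continuous_intros Ck_on_minus Ck_on_mult\<close>)
qed (auto intro!: continuous_intros)

subsection \<open>Total differentiability and the chain rule\<close>

text \<open>Changing the coordinates one after the other reduces differentiability to the mean value
  theorem in one variable.\<close>

lemma total_differentiability:
  assumes W: "openin (Euclidean_space m) W" and h: "Ck_on (Suc 0) m W h" and x: "x \<in> W" and e: "e > 0"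
  shows "\<exists>d>0. \<forall>y\<in>Rn m. (\<forall>j<m. \<bar>y j - x j\<bar> < d) \<longrightarrow> y \<in> W \<and>
    \<bar>h y - h x - (\<Sum>j<m. partial_deriv j h x * (y j - x j))\<bar> \<le> e * (\<Sum>j<m. \<bar>y j - x j\<bar>)"
proof -
  have xR: "x \<in> Rn m" using W x openin_Rn_subset by blast
  obtain d0 where d0: "d0 > 0" "\<And>y. y \<in> Rn m \<Longrightarrow> (\<forall>i<m. \<bar>y i - x i\<bar> < d0) \<Longrightarrow> y \<in> W"
    using W x by (auto simp: openin_Rn_box)
  have "\<exists>d>0. \<forall>y\<in>W. (\<forall>i<m. \<bar>y i - x i\<bar> < d) \<longrightarrow> \<bar>partial_deriv j h y - partial_deriv j h x\<bar> < e" if "j < m" for j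
  proof -
    have "continuous_on W (partial_deriv j h)" using h that by (auto simp: Ck_on_Suc_iff)
    then show ?thesis using continuous_on_Rn_box[OF openin_Rn_subset[OF W]] x e by blast
  qed
  then obtain d1 where d1: "\<And>j. j < m \<Longrightarrow> d1 j > 0"
    "\<And>j y. j < m \<Longrightarrow> y \<in> W \<Longrightarrow> (\<forall>i<m. \<bar>y i - x i\<bar> < d1 j) \<Longrightarrow> \<bar>partial_deriv j h y - partial_deriv j h x\<bar> < e" by metis
  define d where "d = Min (insert d0 (d1 ` {..<m}))"
  have d: "d > 0" "d \<le> d0" "\<And>j. j < m \<Longrightarrow> d \<le> d1 j" using d0 d1(1) by (auto simp: d_def)
  have inW: "z \<in> W" if "z \<in> Rn m" "\<forall>i<m. \<bar>z i - x i\<bar> < d" for z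
    using d0(2)[OF that(1)] that(2) d(2) by fastforce
  have near: "\<bar>partial_deriv j h z - partial_deriv j h x\<bar> \<le> e" if "z \<in> Rn m" "\<forall>i<m. \<bar>z i - x i\<bar> < d" "j < m" for z j
    using d1(2)[OF that(3) inW[OF that(1,2)]] that(2) d(3)[OF that(3)] by fastforce
  have "\<bar>h y - h x - (\<Sum>j<m. partial_deriv j h x * (y j - x j))\<bar> \<le> e * (\<Sum>j<m. \<bar>y j - x j\<bar>)"
    if y: "y \<in> Rn m" "\<forall>j<m. \<bar>y j - x j\<bar> < d" for y
  proof -
    define Y where "Y k = (\<lambda>i. if i < k then y i else x i)" for k :: nat
    have "\<bar>h (Y k) - h x - (\<Sum>j<k. partial_deriv j h x * (y j - x j))\<bar> \<le> e * (\<Sum>j<k. \<bar>y j - x j\<bar>)" if "k \<le> m" for k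
      using that
    proof (induction k)
      case 0 then show ?case by (simp add: Y_def)
    next
      case (Suc k)
      let ?S = "closed_segment (x k) (y k)"
      have seg: "\<bar>t - x k\<bar> < d" if "t \<in> ?S" for t
        using that y(2) Suc.prems d(1) segment_bound(1)[OF that] by (smt (verit) Suc_le_lessD real_norm_def)
      have Yt: "(Y k)(k := t) \<in> Rn m" "\<forall>i<m. \<bar>((Y k)(k := t)) i - x i\<bar> < d" if "t \<in> ?S" for t
        using seg[OF that] y xR Suc.prems d(1) by (auto simp: Y_def Rn_iff)
      have "norm ((h ((Y k)(k := y k)) - partial_deriv k h x * y k) - (h ((Y k)(k := x k)) - partial_deriv k h x * x k)) \<le> e * norm (y k - x k)"
      proof (rule field_differentiable_bound[where S = ?S and f = "\<lambda>t. h ((Y k)(k := t)) - partial_deriv k h x * t"])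
        fix t assume t: "t \<in> ?S"
        have "has_partial h k (partial_deriv k h ((Y k)(k := t))) ((Y k)(k := t))"
          using Suc.prems by (intro Ck_on_has_partial[OF h _ inW[OF Yt[OF t]]]) simp
        then have "((\<lambda>s. h ((Y k)(k := s))) has_real_derivative (partial_deriv k h ((Y k)(k := t)))) (at t within ?S)"
          by (simp only: has_partial_def fun_upd_upd fun_upd_same has_field_derivative_at_within)
        then show "((\<lambda>t. h ((Y k)(k := t)) - partial_deriv k h x * t) has_real_derivative
            (partial_deriv k h ((Y k)(k := t)) - partial_deriv k h x)) (at t within ?S)"
          by (intro DERIV_diff DERIV_cmult_Id)
        show "norm (partial_deriv k h ((Y k)(k := t)) - partial_deriv k h x) \<le> e"
          unfolding real_norm_def by (rule near[OF Yt[OF t]]) (use Suc.prems in simp)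
      qed auto
      moreover have "(Y k)(k := y k) = Y (Suc k)" "(Y k)(k := x k) = Y k" by (auto simp: Y_def less_Suc_eq)
      ultimately have "\<bar>h (Y (Suc k)) - h (Y k) - partial_deriv k h x * (y k - x k)\<bar> \<le> e * \<bar>y k - x k\<bar>"
        by (simp add: algebra_simps)
      moreover have "\<bar>h (Y k) - h x - (\<Sum>j<k. partial_deriv j h x * (y j - x j))\<bar> \<le> e * (\<Sum>j<k. \<bar>y j - x j\<bar>)"
        using Suc by simp
      ultimately show ?case by (simp add: algebra_simps sum_distrib_left)
    qed
    moreover have "Y m = y" using y(1) xR by (auto simp: Y_def Rn_iff)
    ultimately show ?thesis by (metis le_refl)
  qed
  then show ?thesis using d(1) inW by blast
qed

text \<open>The remainder \<open>Q\<close> of the linear approximation of \<open>h\<close> has derivative \<open>0\<close> along the curve.\<close>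

lemma chain_rule_curve:
  assumes W: "openin (Euclidean_space m) W" and h: "Ck_on (Suc 0) m W h" and x: "\<gamma> t0 \<in> W"
    and \<gamma>: "\<And>j. j < m \<Longrightarrow> ((\<lambda>t. \<gamma> t j) has_real_derivative \<gamma>' j) (at t0)"
    and R: "\<forall>\<^sub>F t in nhds t0. \<gamma> t \<in> Rn m"
  shows "((\<lambda>t. h (\<gamma> t)) has_real_derivative (\<Sum>j<m. partial_deriv j h (\<gamma> t0) * \<gamma>' j)) (at t0)"
proof -
  let ?x = "\<gamma> t0"
  define Q where "Q t = h (\<gamma> t) - h ?x - (\<Sum>j<m. partial_deriv j h ?x * (\<gamma> t j - ?x j))" for t
  have "(Q has_real_derivative 0) (at t0)"
  proof -
    define C where "C = 1 + (\<Sum>j<m. \<bar>\<gamma>' j\<bar> + 1)"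
    have C: "C > 0" by (auto simp: C_def intro!: add_pos_nonneg sum_nonneg)
    have lim: "((\<lambda>t. (\<gamma> t j - ?x j) / (t - t0)) \<longlongrightarrow> \<gamma>' j) (at t0)" if "j < m" for j
      using \<gamma>[OF that] by (simp add: has_field_derivative_iff)
    have ev1: "\<forall>\<^sub>F t in at t0. \<forall>j\<in>{..<m}. \<bar>(\<gamma> t j - ?x j) / (t - t0)\<bar> < \<bar>\<gamma>' j\<bar> + 1"
    proof (subst eventually_ball_finite_distrib, simp, safe)
      fix j assume "j < m"
      then have "\<forall>\<^sub>F t in at t0. dist ((\<gamma> t j - ?x j) / (t - t0)) (\<gamma>' j) < 1" using lim tendstoD zero_less_one by blast
      then show "\<forall>\<^sub>F t in at t0. \<bar>(\<gamma> t j - ?x j) / (t - t0)\<bar> < \<bar>\<gamma>' j\<bar> + 1"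
        
        by eventually_elim (use abs_triangle_ineq2[of _ "\<gamma>' j"] in \<open>force simp only: dist_real_def\<close>)
    qed
    have "((\<lambda>t. (Q t - Q t0) / (t - t0)) \<longlongrightarrow> 0) (at t0)"
    proof (rule tendstoI)
      fix e :: real assume e: "e > 0"
      obtain d where d: "d > 0" "\<And>y. y\<in>Rn m \<Longrightarrow> (\<forall>j<m. \<bar>y j - ?x j\<bar> < d) \<Longrightarrow>
          \<bar>h y - h ?x - (\<Sum>j<m. partial_deriv j h ?x * (y j - ?x j))\<bar> \<le> e / (2*C) * (\<Sum>j<m. \<bar>y j - ?x j\<bar>)"
        using total_differentiability[OF W h x, of "e / (2*C)"] e C by auto
      have ev2: "\<forall>\<^sub>F t in at t0. \<forall>j\<in>{..<m}. \<bar>\<gamma> t j - ?x j\<bar> < d"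
      proof (subst eventually_ball_finite_distrib, simp, safe)
        fix j assume "j < m"
        then have "((\<lambda>t. \<gamma> t j) \<longlongrightarrow> ?x j) (at t0)" using \<gamma> DERIV_isCont isCont_def by blast
        from tendstoD[OF this d(1)] show "\<forall>\<^sub>F t in at t0. \<bar>\<gamma> t j - ?x j\<bar> < d" by (simp add: dist_real_def)
      qed
      have ev3: "\<forall>\<^sub>F t in at t0. \<gamma> t \<in> Rn m" using R by (simp add: eventually_nhds_conv_at)
      have ev4: "\<forall>\<^sub>F t in at t0. t \<noteq> t0" by (simp add: eventually_at_filter)
      show "\<forall>\<^sub>F t in at t0. dist ((Q t - Q t0) / (t - t0)) 0 < e"
        using ev1 ev2 ev3 ev4
      proof eventually_elim
        case (elim t)
        have "\<bar>Q t\<bar> \<le> e / (2*C) * (\<Sum>j<m. \<bar>\<gamma> t j - ?x j\<bar>)" unfolding Q_def using d(2) elim by auto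
        also have "(\<Sum>j<m. \<bar>\<gamma> t j - ?x j\<bar>) \<le> (\<Sum>j<m. (\<bar>\<gamma>' j\<bar> + 1) * \<bar>t - t0\<bar>)"
        proof (rule sum_mono)
          fix j assume "j \<in> {..<m}"
          then have "\<bar>(\<gamma> t j - ?x j) / (t - t0)\<bar> < \<bar>\<gamma>' j\<bar> + 1" using elim by blast
          then show "\<bar>\<gamma> t j - ?x j\<bar> \<le> (\<bar>\<gamma>' j\<bar> + 1) * \<bar>t - t0\<bar>" using elim by (simp add: abs_divide divide_simps)
        qed
        also have "\<dots> \<le> C * \<bar>t - t0\<bar>" unfolding C_def distrib_right[of 1] sum_distrib_right by simp
        finally have "\<bar>Q t\<bar> \<le> e / 2 * \<bar>t - t0\<bar>" using e C by (simp add: divide_simps mult.assoc mult_left_mono)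
        moreover have "Q t0 = 0" by (simp add: Q_def)
        moreover have "e / 2 * \<bar>t - t0\<bar> < e * \<bar>t - t0\<bar>" using e elim by auto
        ultimately show ?case using elim by (simp add: dist_real_def abs_divide divide_simps)
      qed
    qed
    then show ?thesis by (simp add: has_field_derivative_iff)
  qed
  then have "((\<lambda>t. Q t + h ?x + (\<Sum>j<m. partial_deriv j h ?x * (\<gamma> t j - ?x j))) has_real_derivative
      0 + 0 + (\<Sum>j<m. partial_deriv j h ?x * (\<gamma>' j - 0))) (at t0)"
    by (intro DERIV_add DERIV_const DERIV_sum DERIV_cmult DERIV_diff \<gamma>) auto
  then show ?thesis by (simp add: Q_def)
qed

lemma continuous_on_into_fun:
  fixes g :: "'a :: topological_space \<Rightarrow> nat \<Rightarrow> real"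
  assumes "\<And>j. j < m \<Longrightarrow> continuous_on V (\<lambda>x. g x j)" "g ` V \<subseteq> Rn m"
  shows "continuous_on V g"
proof (rule continuous_on_coordinatewise_then_product)
  fix j show "continuous_on V (\<lambda>x. g x j)"
  proof (cases "j < m")
    case False
    then have "g x j = 0" if "x \<in> V" for x using assms(2) that by (auto simp: Rn_iff image_subset_iff)
    then show ?thesis using continuous_on_cong[of V V "\<lambda>x. g x j" "\<lambda>x. 0"] by simp
  qed (use assms in auto)
qed

lemma has_partial_compose:
  assumes V: "openin (Euclidean_space n) V" and W: "openin (Euclidean_space m) W"
    and h: "Ck_on (Suc 0) m W h" and g: "\<And>j. j < m \<Longrightarrow> has_partial (\<lambda>x. g x j) i (g' j) x"
    and sub: "g ` V \<subseteq> W" and x: "x \<in> V" "i < n"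
  shows "has_partial (\<lambda>x. h (g x)) i (\<Sum>j<m. partial_deriv j h (g x) * g' j) x"
proof -
  have ev: "\<forall>\<^sub>F t in nhds (x i). g (x(i := t)) \<in> Rn m"
    using eventually_line_in_open[OF V x] by eventually_elim (use sub openin_Rn_subset[OF W] in auto)
  have gx: "g (x(i := x i)) \<in> W" using sub x(1) by auto
  have "((\<lambda>t. g (x(i := t)) j) has_real_derivative g' j) (at (x i))" if "j < m" for j
    using g[OF that] by (simp only: has_partial_def)
  from chain_rule_curve[OF W h, of "\<lambda>t. g (x(i := t))" "x i" g', OF gx this ev]
  show ?thesis by (simp only: has_partial_def fun_upd_triv)
qed

text \<open>By the chain rule the derivatives of the composition are sums of products in which the
  composition of a derivative of \<open>h\<close> with \<open>g\<close> occurs; hence the induction over all \<open>h\<close>.\<close>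

lemma Ck_on_compose:
  assumes V: "openin (Euclidean_space n) V" and W: "openin (Euclidean_space m) W" and sub: "g ` V \<subseteq> W"
  shows "Ck_on k m W h \<Longrightarrow> (\<And>j. j < m \<Longrightarrow> Ck_on k n V (\<lambda>x. g x j)) \<Longrightarrow> Ck_on k n V (\<lambda>x. h (g x))"
proof (induction k arbitrary: h)
  have gR: "g ` V \<subseteq> Rn m" using sub openin_Rn_subset[OF W] by blast
  { fix k h assume "Ck_on k m W h" "\<And>j. j < m \<Longrightarrow> Ck_on k n V (\<lambda>x. g x j)"
    then have "continuous_on W h" "continuous_on V g"
      using continuous_on_into_fun[OF _ gR] by (blast dest: Ck_on_continuous)+
    then have "continuous_on V (\<lambda>x. h (g x))" using sub by (rule continuous_on_compose2) }
  note cont = this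
  { case 0 then show ?case using cont[of 0] by simp
  next
    case (Suc k)
    have h1: "Ck_on (Suc 0) m W h" by (rule Ck_on_mono[OF Suc.prems(1)]) simp
    have c: "continuous_on V (\<lambda>x. h (g x))" by (rule cont) (use Suc.prems in blast)+
    show ?case
    proof (rule Ck_on_SucI[OF V c,
          where g = "\<lambda>i x. \<Sum>j<m. partial_deriv j h (g x) * partial_deriv i (\<lambda>x. g x j) x"])
      show "has_partial (\<lambda>x. h (g x)) i (\<Sum>j<m. partial_deriv j h (g x) * partial_deriv i (\<lambda>x. g x j) x) x"
        if "i < n" "x \<in> V" for i x
        by (rule has_partial_compose[OF V W h1 _ sub that(2,1)])
           (rule Ck_on_has_partial[OF Suc.prems(2) that])
      show "Ck_on k n V (\<lambda>x. \<Sum>j<m. partial_deriv j h (g x) * partial_deriv i (\<lambda>x. g x j) x)" if "i < n" for i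
      proof (intro Ck_on_sum Ck_on_mult V)
        fix j assume "j \<in> {..<m}"
        then have j: "j < m" by simp
        show "Ck_on k n V (\<lambda>x. partial_deriv j h (g x))"
          by (rule Suc.IH[OF Ck_on_partial[OF Suc.prems(1) j]]) (rule Ck_on_SucD[OF Suc.prems(2)])
        show "Ck_on k n V (partial_deriv i (\<lambda>x. g x j))"
          by (rule Ck_on_partial[OF Suc.prems(2)[OF j] that])
      qed
    qed }
qed

section \<open>Flows of vector fields\<close>

definition l1_norm :: "nat \<Rightarrow> (nat \<Rightarrow> real) \<Rightarrow> real"
  where "l1_norm m x = (\<Sum>i<m. \<bar>x i\<bar>)"

definition l1_ball :: "nat \<Rightarrow> real \<Rightarrow> (nat \<Rightarrow> real) set"
  where "l1_ball m R = {x \<in> Rn m. l1_norm m x \<le> R}"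

lemma l1_norm_nonneg [simp]: "0 \<le> l1_norm m x"
  by (simp add: l1_norm_def sum_nonneg)

lemma coord_le_l1_norm: "i < m \<Longrightarrow> \<bar>x i\<bar> \<le> l1_norm m x"
  unfolding l1_norm_def by (rule member_le_sum) auto

lemma l1_norm_diff_triangle: "l1_norm m x \<le> l1_norm m y + l1_norm m (\<lambda>i. x i - y i)"
  unfolding l1_norm_def sum.distrib[symmetric] by (rule sum_mono) simp

lemma l1_norm_proj [simp]: "l1_norm m (proj m x) = l1_norm m x"
  by (simp add: l1_norm_def proj_def)

lemma l1_norm_square_le: "(l1_norm m x)\<^sup>2 \<le> real m * (\<Sum>i<m. (x i)\<^sup>2)"
  using sum_squared_le_sum_of_squares[of "\<lambda>i. \<bar>x i\<bar>" "{..<m}"] by (simp add: l1_norm_def mult.commute)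

lemma continuous_on_l1_norm: "(\<And>i. i < m \<Longrightarrow> continuous_on S (\<lambda>x. g x i)) \<Longrightarrow> continuous_on S (\<lambda>x. l1_norm m (g x))"
  unfolding l1_norm_def by (intro continuous_intros) auto

lemma compact_coordinate_box: "compact {x \<in> Rn m. \<forall>i<m. \<bar>x i\<bar> \<le> R}"
proof -
  have "{x \<in> Rn m. \<forall>i<m. \<bar>x i\<bar> \<le> R} = (\<Pi>\<^sub>E i\<in>UNIV. if i < m then {-R..R} else {0})"
    by (auto simp: Rn_iff PiE_def Pi_iff abs_le_iff split: if_splits) (smt (verit) linorder_not_le)+
  moreover have "compactin (product_topology (\<lambda>i::nat. euclidean) UNIV) (\<Pi>\<^sub>E i\<in>UNIV. if i < m then {-R..R} else {0::real})"
    unfolding compactin_PiE by auto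
  ultimately show ?thesis by (simp add: euclidean_product_topology)
qed

lemma compact_l1_ball: "compact (l1_ball m R)"
proof -
  have "closed {x. l1_norm m x \<le> R}"
    by (intro closed_Collect_le continuous_on_l1_norm continuous_intros continuous_on_product_then_coordinatewise)
  from compact_Int_closed[OF compact_coordinate_box this]
  have "compact ({x \<in> Rn m. \<forall>i<m. \<bar>x i\<bar> \<le> R} \<inter> {x. l1_norm m x \<le> R})" .
  also have "{x \<in> Rn m. \<forall>i<m. \<bar>x i\<bar> \<le> R} \<inter> {x. l1_norm m x \<le> R} = l1_ball m R"
    using coord_le_l1_norm by (fastforce simp: l1_ball_def intro: order_trans)
  finally show ?thesis .
qed

lemma bounded_on_l1_ball:
  assumes "continuous_on (Rn m) (g :: _ \<Rightarrow> real)"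
  shows "\<exists>B\<ge>0. \<forall>x\<in>l1_ball m R. \<bar>g x\<bar> \<le> B"
proof -
  have "compact (g ` l1_ball m R)"
    using assms by (intro compact_continuous_image compact_l1_ball) (auto elim: continuous_on_subset simp: l1_ball_def)
  then obtain B where "\<forall>y\<in>g ` l1_ball m R. norm y \<le> B" using compact_imp_bounded bounded_iff by metis
  then show ?thesis by (intro exI[of _ "max B 0"]) auto
qed

lemma mean_value_on_segment:
  assumes h: "Ck_on (Suc 0) m (Rn m) h" and x: "x \<in> Rn m" "y \<in> Rn m"
  shows "\<exists>s. 0 < s \<and> s < 1 \<and> h y - h x = (\<Sum>j<m. partial_deriv j h (\<lambda>i. x i + s * (y i - x i)) * (y j - x j))"
proof -
  define z where "z s = (\<lambda>i. x i + s * (y i - x i))" for s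
  have zR: "z s \<in> Rn m" for s using x by (auto simp: z_def Rn_iff)
  have "((\<lambda>s. h (z s)) has_real_derivative (\<Sum>j<m. partial_deriv j h (z s) * (y j - x j))) (at s)" for s
    by (rule chain_rule_curve[OF openin_Rn_UNIV h]) (auto simp: zR, auto simp: z_def intro!: derivative_eq_intros)
  then obtain s where "0 < s" "s < 1" "h (z 1) - h (z 0) = (1 - 0) * (\<Sum>j<m. partial_deriv j h (z s) * (y j - x j))"
    using MVT2[of 0 1 "\<lambda>s. h (z s)" "\<lambda>s. (\<Sum>j<m. partial_deriv j h (z s) * (y j - x j))"] by auto
  then show ?thesis unfolding z_def by auto
qed

lemma segment_in_l1_ball:
  assumes "x \<in> l1_ball m R" "y \<in> l1_ball m R" "0 \<le> s" "s \<le> 1"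
  shows "(\<lambda>i. x i + s * (y i - x i)) \<in> l1_ball m R"
proof -
  have "l1_norm m (\<lambda>i. x i + s * (y i - x i)) \<le> (\<Sum>i<m. (1 - s) * \<bar>x i\<bar> + s * \<bar>y i\<bar>)"
    unfolding l1_norm_def
  proof (rule sum_mono)
    fix i
    have "x i + s * (y i - x i) = (1 - s) * x i + s * y i" by (simp add: algebra_simps)
    also have "\<bar>\<dots>\<bar> \<le> \<bar>(1 - s) * x i\<bar> + \<bar>s * y i\<bar>" by simp
    finally show "\<bar>x i + s * (y i - x i)\<bar> \<le> (1 - s) * \<bar>x i\<bar> + s * \<bar>y i\<bar>" using assms by (simp add: abs_mult)
  qed
  also have "\<dots> = (1 - s) * l1_norm m x + s * l1_norm m y" by (simp add: l1_norm_def sum.distrib sum_distrib_left)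
  also have "\<dots> \<le> (1 - s) * R + s * R" using assms by (intro add_mono mult_left_mono) (auto simp: l1_ball_def)
  finally show ?thesis using assms by (auto simp: l1_ball_def Rn_iff algebra_simps)
qed

lemma Lipschitz_on_l1_ball:
  assumes h: "Ck_on (Suc 0) m (Rn m) h"
  shows "\<exists>L\<ge>0. \<forall>x\<in>l1_ball m R. \<forall>y\<in>l1_ball m R. \<bar>h y - h x\<bar> \<le> L * l1_norm m (\<lambda>i. y i - x i)"
proof -
  have "\<exists>B\<ge>0. \<forall>x\<in>l1_ball m R. \<bar>partial_deriv j h x\<bar> \<le> B" if "j < m" for j
    using h that by (intro bounded_on_l1_ball) (auto simp: Ck_on_Suc_iff)
  then obtain B where B: "\<And>j. j < m \<Longrightarrow> B j \<ge> 0" "\<And>j x. j < m \<Longrightarrow> x \<in> l1_ball m R \<Longrightarrow> \<bar>partial_deriv j h x\<bar> \<le> B j" by metis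
  define L where "L = (\<Sum>j<m. B j)"
  have L: "L \<ge> 0" "\<And>j. j < m \<Longrightarrow> B j \<le> L" using B(1) by (auto simp: L_def intro!: member_le_sum sum_nonneg)
  have "\<bar>h y - h x\<bar> \<le> L * l1_norm m (\<lambda>i. y i - x i)" if xy: "x \<in> l1_ball m R" "y \<in> l1_ball m R" for x y
  proof -
    have "x \<in> Rn m" "y \<in> Rn m" using xy by (auto simp: l1_ball_def)
    from mean_value_on_segment[OF h this] obtain s where s: "0 < s" "s < 1"
      "h y - h x = (\<Sum>j<m. partial_deriv j h (\<lambda>i. x i + s * (y i - x i)) * (y j - x j))" by blast
    have "\<bar>h y - h x\<bar> \<le> (\<Sum>j<m. \<bar>partial_deriv j h (\<lambda>i. x i + s * (y i - x i)) * (y j - x j)\<bar>)" unfolding s(3) by (rule sum_abs)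
    also have "\<dots> \<le> (\<Sum>j<m. L * \<bar>y j - x j\<bar>)"
    proof (rule sum_mono)
      fix j assume "j \<in> {..<m}"
      then have "\<bar>partial_deriv j h (\<lambda>i. x i + s * (y i - x i))\<bar> \<le> L"
        using B(2)[OF _ segment_in_l1_ball[OF xy]] L(2) s by (meson lessThan_iff less_imp_le order_trans)
      then show "\<bar>partial_deriv j h (\<lambda>i. x i + s * (y i - x i)) * (y j - x j)\<bar> \<le> L * \<bar>y j - x j\<bar>"
        by (simp add: abs_mult mult_right_mono)
    qed
    finally show ?thesis by (simp add: l1_norm_def sum_distrib_left)
  qed
  then show ?thesis using L(1) by blast
qed

lemma Taylor_on_l1_ball:
  assumes h: "Ck_on (Suc (Suc 0)) m (Rn m) h"
  shows "\<exists>C\<ge>0. \<forall>x\<in>l1_ball m R. \<forall>y\<in>l1_ball m R.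
    \<bar>h y - h x - (\<Sum>l<m. partial_deriv l h x * (y l - x l))\<bar> \<le> C * (l1_norm m (\<lambda>i. y i - x i))\<^sup>2"
proof -
  have "\<exists>L\<ge>0. \<forall>x\<in>l1_ball m R. \<forall>y\<in>l1_ball m R. \<bar>partial_deriv l h y - partial_deriv l h x\<bar> \<le> L * l1_norm m (\<lambda>i. y i - x i)"
    if "l < m" for l using Lipschitz_on_l1_ball Ck_on_partial[OF h that] by blast
  then obtain L where L: "\<And>l. l < m \<Longrightarrow> L l \<ge> 0" "\<And>l x y. l < m \<Longrightarrow> x \<in> l1_ball m R \<Longrightarrow> y \<in> l1_ball m R \<Longrightarrow>
      \<bar>partial_deriv l h y - partial_deriv l h x\<bar> \<le> L l * l1_norm m (\<lambda>i. y i - x i)" by metis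
  define C where "C = (\<Sum>l<m. L l)"
  have C: "C \<ge> 0" "\<And>j. j < m \<Longrightarrow> L j \<le> C" using L(1) by (auto simp: C_def intro!: member_le_sum sum_nonneg)
  have "\<bar>h y - h x - (\<Sum>l<m. partial_deriv l h x * (y l - x l))\<bar> \<le> C * (l1_norm m (\<lambda>i. y i - x i))\<^sup>2"
    if xy: "x \<in> l1_ball m R" "y \<in> l1_ball m R" for x y
  proof -
    define d where "d = l1_norm m (\<lambda>i. y i - x i)"
    have "x \<in> Rn m" "y \<in> Rn m" using xy by (auto simp: l1_ball_def)
    from mean_value_on_segment[OF Ck_on_SucD[OF h] this] obtain s where s: "0 < s" "s < 1"
      "h y - h x = (\<Sum>j<m. partial_deriv j h (\<lambda>i. x i + s * (y i - x i)) * (y j - x j))" by blast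
    define z where "z = (\<lambda>i. x i + s * (y i - x i))"
    have z: "z \<in> l1_ball m R" unfolding z_def using segment_in_l1_ball[OF xy] s by simp
    have zd: "l1_norm m (\<lambda>i. z i - x i) \<le> d"
      unfolding l1_norm_def d_def z_def using s by (intro sum_mono) (auto simp: abs_mult mult_left_le_one_le)
    have step: "\<bar>(partial_deriv l h z - partial_deriv l h x) * (y l - x l)\<bar> \<le> (C * d) * \<bar>y l - x l\<bar>" if l: "l < m" for l
    proof -
      have "\<bar>partial_deriv l h z - partial_deriv l h x\<bar> \<le> L l * l1_norm m (\<lambda>i. z i - x i)" by (rule L(2)[OF l xy(1) z])
      also have "\<dots> \<le> C * d" by (rule mult_mono[OF C(2)[OF l] zd C(1) l1_norm_nonneg])
      finally show ?thesis unfolding abs_mult by (rule mult_right_mono) simp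
    qed
    have "\<bar>h y - h x - (\<Sum>l<m. partial_deriv l h x * (y l - x l))\<bar> = \<bar>\<Sum>l<m. (partial_deriv l h z - partial_deriv l h x) * (y l - x l)\<bar>"
      unfolding s(3) z_def left_diff_distrib sum_subtractf ..
    also have "\<dots> \<le> (\<Sum>l<m. (C * d) * \<bar>y l - x l\<bar>)"
      by (rule order_trans[OF sum_abs sum_mono]) (use step in blast)
    also have "\<dots> = C * d\<^sup>2"
      unfolding d_def power2_eq_square mult.assoc sum_distrib_left[symmetric] l1_norm_def[symmetric] ..
    finally show ?thesis unfolding d_def .
  qed
  then show ?thesis using C(1) by blast
qed

subsection \<open>Differential inequalities\<close>

text \<open>At a fixed time \<open>t\<close>, the signs of the coordinates of \<open>u t\<close> turn the norm into a linear function of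
  \<open>u\<close>, which can be differentiated.\<close>

lemma l1_norm_growth_bound:
  assumes T: "\<bar>t\<bar> \<le> T"
    and d: "\<And>j s. j < m \<Longrightarrow> \<bar>s\<bar> \<le> T \<Longrightarrow> ((\<lambda>s. u s j) has_real_derivative u' s j) (at s)"
    and H: "\<And>r. 0 \<le> r \<Longrightarrow> r \<le> T \<Longrightarrow> (H has_real_derivative h r) (at r)"
    and le: "\<And>s. \<bar>s\<bar> \<le> T \<Longrightarrow> l1_norm m (u' s) \<le> h \<bar>s\<bar>"
  shows "l1_norm m (u t) \<le> l1_norm m (u 0) + (H \<bar>t\<bar> - H 0)"
proof -
  define \<sigma> :: real where "\<sigma> = (if t \<ge> 0 then 1 else -1)"
  have \<sigma>: "\<bar>\<sigma>\<bar> = 1" "\<sigma> * \<bar>t\<bar> = t" by (auto simp: \<sigma>_def)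
  define c where "c j = sgn (u t j)" for j
  have c: "\<bar>c j\<bar> \<le> 1" "c j * u t j = \<bar>u t j\<bar>" for j by (auto simp: c_def sgn_if)
  define \<phi> where "\<phi> r = H r - (\<Sum>j<m. c j * u (\<sigma> * r) j)" for r
  have "\<phi> 0 \<le> \<phi> \<bar>t\<bar>"
  proof (rule DERIV_nonneg_imp_nondecreasing[where f = \<phi>])
    fix r assume r: "0 \<le> r" "r \<le> \<bar>t\<bar>"
    have sr: "\<bar>\<sigma> * r\<bar> \<le> T" "\<bar>\<sigma> * r\<bar> = r" using r T \<sigma> by (auto simp: abs_mult)
    have "((\<lambda>r. u (\<sigma> * r) j) has_real_derivative u' (\<sigma> * r) j * \<sigma>) (at r)" if "j < m" for j
      using sr that by (intro DERIV_chain2[of "\<lambda>s. u s j"] d) (auto intro!: derivative_eq_intros)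
    then have "((\<lambda>r. c j * u (\<sigma> * r) j) has_real_derivative c j * (u' (\<sigma> * r) j * \<sigma>)) (at r)" if "j < m" for j
      using that by (intro DERIV_cmult)
    then have "((\<lambda>r. \<Sum>j<m. c j * u (\<sigma> * r) j) has_real_derivative (\<Sum>j<m. c j * (u' (\<sigma> * r) j * \<sigma>))) (at r)"
      by (intro DERIV_sum) auto
    then have "(\<phi> has_real_derivative (h r - (\<Sum>j<m. c j * (u' (\<sigma> * r) j * \<sigma>)))) (at r)"
      unfolding \<phi>_def using r T by (intro DERIV_diff H) auto
    moreover have "(\<Sum>j<m. c j * (u' (\<sigma> * r) j * \<sigma>)) \<le> (\<Sum>j<m. \<bar>u' (\<sigma> * r) j\<bar>)"
    proof (rule sum_mono)
      fix j
      have "c j * (u' (\<sigma> * r) j * \<sigma>) \<le> \<bar>c j\<bar> * (\<bar>u' (\<sigma> * r) j\<bar> * \<bar>\<sigma>\<bar>)" by (metis abs_ge_self abs_mult)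
      also have "\<dots> \<le> \<bar>u' (\<sigma> * r) j\<bar>" using c(1)[of j] \<sigma> by (simp add: mult_left_le_one_le)
      finally show "c j * (u' (\<sigma> * r) j * \<sigma>) \<le> \<bar>u' (\<sigma> * r) j\<bar>" .
    qed
    moreover have "(\<Sum>j<m. \<bar>u' (\<sigma> * r) j\<bar>) \<le> h r" using le[OF sr(1)] sr(2) by (simp add: l1_norm_def)
    ultimately show "\<exists>y. (\<phi> has_real_derivative y) (at r) \<and> 0 \<le> y" by force
  qed simp
  moreover have "\<phi> \<bar>t\<bar> = H \<bar>t\<bar> - l1_norm m (u t)" using \<sigma> c by (simp add: \<phi>_def l1_norm_def)
  moreover have "(\<Sum>j<m. c j * u 0 j) \<le> l1_norm m (u 0)"
    unfolding l1_norm_def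
  proof (rule sum_mono)
    fix j
    have "c j * u 0 j \<le> \<bar>c j\<bar> * \<bar>u 0 j\<bar>" by (metis abs_ge_self abs_mult)
    then show "c j * u 0 j \<le> \<bar>u 0 j\<bar>" using c(1)[of j] mult_left_le_one_le[of "\<bar>u 0 j\<bar>" "\<bar>c j\<bar>"] by simp
  qed
  ultimately show ?thesis by (simp add: \<phi>_def)
qed

text \<open>The sum of squares is used because it is differentiable. With \<open>q\<close> that sum, \<open>c = m * e\<^sup>2\<close> and
  \<open>K = 2 * L * m + 1\<close>, the hypotheses give \<open>q' \<le> K * (q + c)\<close>, so \<open>(q + c) * exp (- K * t)\<close> decreases.\<close>

lemma Gronwall_squares:
  assumes T: "\<bar>t\<bar> \<le> T" and L: "L \<ge> 0" and e: "e \<ge> 0"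
    and d: "\<And>j s. j < m \<Longrightarrow> \<bar>s\<bar> \<le> T \<Longrightarrow> ((\<lambda>s. u s j) has_real_derivative u' s j) (at s)"
    and le: "\<And>j s. j < m \<Longrightarrow> \<bar>s\<bar> \<le> T \<Longrightarrow> \<bar>u' s j\<bar> \<le> L * l1_norm m (u s) + e"
  shows "(\<Sum>j<m. (u t j)\<^sup>2) \<le> ((\<Sum>j<m. (u 0 j)\<^sup>2) + real m * e\<^sup>2) * exp ((2 * L * m + 1) * T)"
proof -
  define \<sigma> :: real where "\<sigma> = (if t \<ge> 0 then 1 else -1)"
  have \<sigma>: "\<bar>\<sigma>\<bar> = 1" "\<sigma> * \<bar>t\<bar> = t" by (auto simp: \<sigma>_def)
  define K where "K = 2 * L * m + 1"
  have K: "K \<ge> 1" using L by (simp add: K_def)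
  define c where "c = real m * e\<^sup>2"
  have c: "c \<ge> 0" by (simp add: c_def)
  define q where "q r = (\<Sum>j<m. (u (\<sigma> * r) j)\<^sup>2)" for r
  define q' where "q' r = (\<Sum>j<m. 2 * u (\<sigma> * r) j * (u' (\<sigma> * r) j * \<sigma>))" for r
  define \<phi> where "\<phi> r = (q r + c) * exp (- K * r)" for r
  have "\<phi> \<bar>t\<bar> \<le> \<phi> 0"
  proof (rule DERIV_nonpos_imp_nonincreasing[where f = \<phi>])
    fix r assume r: "0 \<le> r" "r \<le> \<bar>t\<bar>"
    have sr: "\<bar>\<sigma> * r\<bar> \<le> T" using r T \<sigma> by (auto simp: abs_mult)
    have qd: "(q has_real_derivative q' r) (at r)"
      unfolding q_def q'_def
    proof (intro DERIV_sum)
      fix j assume "j \<in> {..<m}"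
      then have "((\<lambda>r. u (\<sigma> * r) j) has_real_derivative u' (\<sigma> * r) j * \<sigma>) (at r)"
        using sr by (intro DERIV_chain2[of "\<lambda>s. u s j"] d) (auto intro!: derivative_eq_intros)
      from DERIV_power[OF this, of 2]
      show "((\<lambda>r. (u (\<sigma> * r) j)\<^sup>2) has_real_derivative 2 * u (\<sigma> * r) j * (u' (\<sigma> * r) j * \<sigma>)) (at r)"
        by (simp add: mult_ac)
    qed
    let ?N = "l1_norm m (u (\<sigma> * r))"
    have "q' r \<le> (\<Sum>j<m. 2 * \<bar>u (\<sigma> * r) j\<bar> * (L * ?N + e))" unfolding q'_def
    proof (rule sum_mono)
      fix j assume j: "j \<in> {..<m}"
      have "2 * u (\<sigma> * r) j * (u' (\<sigma> * r) j * \<sigma>) \<le> \<bar>2 * u (\<sigma> * r) j * (u' (\<sigma> * r) j * \<sigma>)\<bar>" by (rule abs_ge_self)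
      also have "\<dots> = 2 * \<bar>u (\<sigma> * r) j\<bar> * \<bar>u' (\<sigma> * r) j\<bar>" using \<sigma> by (simp add: abs_mult)
      also have "\<dots> \<le> 2 * \<bar>u (\<sigma> * r) j\<bar> * (L * ?N + e)" using le[OF _ sr] j by (intro mult_left_mono) auto
      finally show "2 * u (\<sigma> * r) j * (u' (\<sigma> * r) j * \<sigma>) \<le> 2 * \<bar>u (\<sigma> * r) j\<bar> * (L * ?N + e)" .
    qed
    also have "\<dots> = 2 * L * ?N\<^sup>2 + (\<Sum>j<m. 2 * \<bar>u (\<sigma> * r) j\<bar> * e)"
      by (simp add: l1_norm_def distrib_left sum.distrib power2_eq_square sum_distrib_left sum_distrib_right mult_ac)
    also have "\<dots> \<le> 2 * L * (real m * q r) + (q r + c)"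
    proof (intro add_mono mult_left_mono)
      show "?N\<^sup>2 \<le> real m * q r" unfolding q_def by (rule l1_norm_square_le)
      have "(\<Sum>j<m. 2 * \<bar>u (\<sigma> * r) j\<bar> * e) \<le> (\<Sum>j<m. (u (\<sigma> * r) j)\<^sup>2 + e\<^sup>2)"
        by (rule sum_mono) (metis sum_squares_bound power2_abs)
      then show "(\<Sum>j<m. 2 * \<bar>u (\<sigma> * r) j\<bar> * e) \<le> q r + c" by (simp add: q_def c_def sum.distrib)
    qed (use L in auto)
    also have "\<dots> = K * q r + c" by (simp add: K_def algebra_simps)
    also have "\<dots> \<le> K * (q r + c)" using K c mult_right_mono[of 1 K c] by (simp add: algebra_simps)
    finally have "(q' r - K * (q r + c)) * exp (- K * r) \<le> 0" by (intro mult_nonpos_nonneg) auto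
    moreover have "(\<phi> has_real_derivative (q' r - K * (q r + c)) * exp (- K * r)) (at r)"
      unfolding \<phi>_def by (auto intro!: derivative_eq_intros qd simp: algebra_simps)
    ultimately show "\<exists>y. (\<phi> has_real_derivative y) (at r) \<and> y \<le> 0" by blast
  qed simp
  then have "(q \<bar>t\<bar> + c) * exp (- K * \<bar>t\<bar>) \<le> q 0 + c" by (simp add: \<phi>_def)
  then have "q \<bar>t\<bar> + c \<le> (q 0 + c) * exp (K * \<bar>t\<bar>)" by (simp add: exp_minus field_simps)
  also have "\<dots> \<le> (q 0 + c) * exp (K * T)"
    using K T c by (intro mult_left_mono) (auto simp: q_def sum_nonneg intro!: add_nonneg_nonneg)
  finally have "q \<bar>t\<bar> \<le> (q 0 + c) * exp (K * T)" using c by linarith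
  then show ?thesis using \<sigma> by (simp add: q_def c_def K_def)
qed

subsection \<open>Picard iteration\<close>

text \<open>The second integral makes this the signed integral from \<open>0\<close> to \<open>t\<close>, since an integral over an empty interval
  is \<open>0\<close>.\<close>

definition antider :: "(real \<Rightarrow> real) \<Rightarrow> real \<Rightarrow> real"
  where "antider g t = integral {0..t} g - integral {t..0} g"

lemma antider_0 [simp]: "antider g 0 = 0"
  by (simp add: antider_def)

lemma antider_has_derivative:
  assumes g: "continuous_on UNIV g"
  shows "(antider g has_real_derivative g t) (at t)"
proof -
  define N where "N = \<bar>t\<bar> + 1"
  have gi: "g integrable_on {a..b}" for a b
    by (intro integrable_continuous_interval continuous_on_subset[OF g]) auto
  have eq: "integral {-N..s} g - integral {-N..0} g = antider g s" if "s \<in> {-N<..<N}" for s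
  proof (cases "s \<ge> 0")
    case True
    have "integral {-N..0} g + integral {0..s} g = integral {-N..s} g"
      using True by (intro Henstock_Kurzweil_Integration.integral_combine gi) (auto simp: N_def)
    moreover have "integral {s..0} g = 0" using True by (cases "s = 0") auto
    ultimately show ?thesis by (simp add: antider_def)
  next
    case False
    have "integral {-N..s} g + integral {s..0} g = integral {-N..0} g"
      using False that by (intro Henstock_Kurzweil_Integration.integral_combine gi) auto
    then show ?thesis using False by (simp add: antider_def)
  qed
  have "((\<lambda>s. integral {-N..s} g) has_real_derivative g t) (at t within {-N..N})"
    by (rule integral_has_real_derivative) (auto simp: N_def intro: continuous_on_subset[OF g])
  then have "((\<lambda>s. integral {-N..s} g) has_real_derivative g t) (at t)"
    by (simp add: at_within_Icc_at N_def)
  then have "((\<lambda>s. integral {-N..s} g - integral {-N..0} g) has_real_derivative g t) (at t)"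
    by (auto intro!: derivative_eq_intros)
  then show ?thesis
    by (rule has_field_derivative_transform_within_open[where S = "{-N<..<N}"]) (use eq in \<open>auto simp: N_def\<close>)
qed

primrec picard :: "nat \<Rightarrow> ((nat \<Rightarrow> real) \<Rightarrow> nat \<Rightarrow> real) \<Rightarrow> (nat \<Rightarrow> real) \<Rightarrow> nat \<Rightarrow> real \<Rightarrow> nat \<Rightarrow> real" where
  "picard m V p 0 t = p"
| "picard m V p (Suc k) t = (\<lambda>j. if j < m then p j + antider (\<lambda>s. V (picard m V p k s) j) t else 0)"

definition smooth_field :: "nat \<Rightarrow> ((nat \<Rightarrow> real) \<Rightarrow> nat \<Rightarrow> real) \<Rightarrow> bool" where
  "smooth_field m V \<longleftrightarrow> (\<forall>j<m. \<forall>k. Ck_on k m (Rn m) (\<lambda>x. V x j))"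

text \<open>Boundedness of all Picard iterates is what the convergence proof needs, and unlike boundedness of the field
  itself it is inherited by the prolonged field below.\<close>

definition tame_field :: "nat \<Rightarrow> ((nat \<Rightarrow> real) \<Rightarrow> nat \<Rightarrow> real) \<Rightarrow> bool" where
  "tame_field m V \<longleftrightarrow> smooth_field m V \<and>
     (\<forall>R T. \<exists>B. \<forall>p\<in>l1_ball m R. \<forall>k t. \<bar>t\<bar> \<le> T \<longrightarrow> l1_norm m (picard m V p k t) \<le> B)"

lemma tame_field_smooth: "tame_field m V \<Longrightarrow> smooth_field m V"
  by (simp add: tame_field_def)

lemma smooth_field_Ck: "smooth_field m V \<Longrightarrow> j < m \<Longrightarrow> Ck_on k m (Rn m) (\<lambda>x. V x j)"
  by (simp add: smooth_field_def)

lemma picard_0 [simp]: "p \<in> Rn m \<Longrightarrow> picard m V p k 0 = p"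
  by (cases k) (auto simp: Rn_iff)

lemma picard_in_Rn: "p \<in> Rn m \<Longrightarrow> picard m V p k t \<in> Rn m"
  by (cases k) (auto simp: Rn_iff)

lemma continuous_field_along_curve:
  assumes V: "smooth_field m V" and j: "j < m" and x: "\<And>t. x t \<in> Rn m"
    and c: "\<And>j. j < m \<Longrightarrow> continuous_on S (\<lambda>t::real. x t j)"
  shows "continuous_on S (\<lambda>t. V (x t) j)"
proof (rule continuous_on_compose2[where f = x and g = "\<lambda>x. V x j"])
  show "continuous_on (Rn m) (\<lambda>x. V x j)" using smooth_field_Ck[OF V j, of 0] by simp
  show "continuous_on S x" using c x by (intro continuous_on_into_fun[where m = m]) auto
qed (use x in auto)

lemma picard_continuous:
  assumes V: "smooth_field m V" and p: "p \<in> Rn m"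
  shows "j < m \<Longrightarrow> continuous_on UNIV (\<lambda>t. picard m V p k t j)"
proof (induction k arbitrary: j)
  case (Suc k)
  have "continuous_on UNIV (\<lambda>t. V (picard m V p k t) j)"
    using Suc picard_in_Rn[OF p] by (intro continuous_field_along_curve[OF V]) auto
  from antider_has_derivative[OF this] have "continuous_on UNIV (antider (\<lambda>s. V (picard m V p k s) j))"
    by (rule DERIV_continuous_on)
  then show ?case using Suc.prems by (simp add: continuous_on_add)
qed simp

lemma picard_has_derivative:
  assumes V: "smooth_field m V" and p: "p \<in> Rn m" and j: "j < m"
  shows "((\<lambda>t. picard m V p (Suc k) t j) has_real_derivative V (picard m V p k t) j) (at t)"
proof -
  have "continuous_on UNIV (\<lambda>t. V (picard m V p k t) j)"
    using picard_in_Rn[OF p] picard_continuous[OF V p] j by (intro continuous_field_along_curve[OF V]) auto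
  from antider_has_derivative[OF this] show ?thesis using j by (auto intro!: derivative_eq_intros)
qed

lemma smooth_field_Lipschitz:
  assumes V: "smooth_field m V"
  shows "\<exists>L\<ge>0. \<forall>x\<in>l1_ball m R. \<forall>y\<in>l1_ball m R. (\<forall>j<m. \<bar>V y j - V x j\<bar> \<le> L * l1_norm m (\<lambda>i. y i - x i)) \<and>
    l1_norm m (\<lambda>j. V y j - V x j) \<le> L * l1_norm m (\<lambda>i. y i - x i)"
proof -
  have "\<exists>L\<ge>0. \<forall>x\<in>l1_ball m R. \<forall>y\<in>l1_ball m R. \<bar>V y j - V x j\<bar> \<le> L * l1_norm m (\<lambda>i. y i - x i)" if "j < m" for j
    using Lipschitz_on_l1_ball[of m "\<lambda>x. V x j"] smooth_field_Ck[OF V that] by blast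
  then obtain L where L: "\<And>j. j < m \<Longrightarrow> L j \<ge> 0" "\<And>j x y. j < m \<Longrightarrow> x \<in> l1_ball m R \<Longrightarrow> y \<in> l1_ball m R \<Longrightarrow>
      \<bar>V y j - V x j\<bar> \<le> L j * l1_norm m (\<lambda>i. y i - x i)" by metis
  have le: "L j \<le> (\<Sum>j<m. L j)" if "j < m" for j using L(1) that by (auto intro!: member_le_sum)
  show ?thesis
  proof (intro exI[of _ "\<Sum>j<m. L j"] conjI ballI allI impI)
    fix x y j assume *: "x \<in> l1_ball m R" "y \<in> l1_ball m R"
    show "j < m \<Longrightarrow> \<bar>V y j - V x j\<bar> \<le> (\<Sum>j<m. L j) * l1_norm m (\<lambda>i. y i - x i)"
      using L(2)[OF _ *, of j] le[of j] mult_right_mono[of "L j" "\<Sum>j<m. L j" "l1_norm m (\<lambda>i. y i - x i)"] by simp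
    show "l1_norm m (\<lambda>j. V y j - V x j) \<le> (\<Sum>j<m. L j) * l1_norm m (\<lambda>i. y i - x i)"
      unfolding l1_norm_def[of m "\<lambda>j. V y j - V x j"] sum_distrib_right using L(2)[OF _ *] by (intro sum_mono) auto
  qed (use L(1) in \<open>auto intro: sum_nonneg\<close>)
qed

definition flow :: "nat \<Rightarrow> ((nat \<Rightarrow> real) \<Rightarrow> nat \<Rightarrow> real) \<Rightarrow> real \<Rightarrow> (nat \<Rightarrow> real) \<Rightarrow> nat \<Rightarrow> real"
  where "flow m V t p = (\<lambda>j. if j < m then lim (\<lambda>k. picard m V p k t j) else 0)"

lemma flow_in_Rn [simp]: "flow m V t p \<in> Rn m"
  by (auto simp: flow_def Rn_iff)

lemma flow_0 [simp]: "p \<in> Rn m \<Longrightarrow> flow m V 0 p = p"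
  by (auto simp: flow_def Rn_iff)

text \<open>On the ball that contains all iterates the field is Lipschitz, and the usual estimate
  of consecutive iterates by \<open>M * L ^ k * \<bar>t\<bar> ^ (k + 1) / (k + 1)!\<close> gives uniform convergence.\<close>

lemma picard_uniform_limit:
  assumes V: "tame_field m V" and p: "p \<in> Rn m" and j: "j < m"
  shows "uniform_limit {-T..T} (\<lambda>k t. picard m V p k t j) (\<lambda>t. flow m V t p j) sequentially"
proof -
  let ?x = "picard m V p"
  have "p \<in> l1_ball m (l1_norm m p)" using p by (simp add: l1_ball_def)
  then obtain B where B: "\<And>k t. \<bar>t\<bar> \<le> T \<Longrightarrow> l1_norm m (?x k t) \<le> B" using V unfolding tame_field_def by blast
  then have xB: "?x k t \<in> l1_ball m B" if "\<bar>t\<bar> \<le> T" for k t using that picard_in_Rn[OF p] by (auto simp: l1_ball_def)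
  obtain L where L: "L \<ge> 0" "\<And>x y. x \<in> l1_ball m B \<Longrightarrow> y \<in> l1_ball m B \<Longrightarrow> l1_norm m (\<lambda>j. V y j - V x j) \<le> L * l1_norm m (\<lambda>i. y i - x i)"
    using smooth_field_Lipschitz[OF tame_field_smooth[OF V]] by meson
  define M where "M = l1_norm m (V p)"
  have step: "l1_norm m (\<lambda>i. ?x (Suc k) t i - ?x k t i) \<le> M * L ^ k * \<bar>t\<bar> ^ Suc k / fact (Suc k)" if "\<bar>t\<bar> \<le> T" for k t
    using that
  proof (induction k arbitrary: t)
    case 0
    have "l1_norm m (\<lambda>i. ?x (Suc 0) t i - p i) \<le> l1_norm m (\<lambda>i. ?x (Suc 0) 0 i - p i) + (M * \<bar>t\<bar> - M * 0)"
    proof (rule l1_norm_growth_bound[where u' = "\<lambda>s. V (?x 0 s)" and h = "\<lambda>r. M"])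
      fix j s assume "j < m"
      from picard_has_derivative[OF tame_field_smooth[OF V] p this, of 0 s]
      show "((\<lambda>s. ?x (Suc 0) s j - p j) has_real_derivative V (?x 0 s) j) (at s)" by (auto intro!: derivative_eq_intros simp del: picard.simps(2))
    qed (use 0 in \<open>auto simp: M_def intro!: derivative_eq_intros\<close>)
    then show ?case using p picard_0[OF p, of V "Suc 0"] by (simp add: l1_norm_def del: picard.simps(2))
  next
    case (Suc k)
    let ?H = "\<lambda>r. M * L ^ Suc k * r ^ Suc (Suc k) / fact (Suc (Suc k))"
    have "l1_norm m (\<lambda>i. ?x (Suc (Suc k)) t i - ?x (Suc k) t i) \<le> l1_norm m (\<lambda>i. ?x (Suc (Suc k)) 0 i - ?x (Suc k) 0 i) + (?H \<bar>t\<bar> - ?H 0)"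
    proof (rule l1_norm_growth_bound[where u' = "\<lambda>s i. V (?x (Suc k) s) i - V (?x k s) i" and h = "\<lambda>r. M * L ^ Suc k * r ^ Suc k / fact (Suc k)"])
      fix j s assume "j < m"
      from picard_has_derivative[OF tame_field_smooth[OF V] p this, of "Suc k" s] picard_has_derivative[OF tame_field_smooth[OF V] p this, of k s]
      show "((\<lambda>s. ?x (Suc (Suc k)) s j - ?x (Suc k) s j) has_real_derivative V (?x (Suc k) s) j - V (?x k s) j) (at s)"
        by (intro DERIV_diff)
    next
      fix s assume s: "\<bar>s\<bar> \<le> T"
      have "l1_norm m (\<lambda>i. V (?x (Suc k) s) i - V (?x k s) i) \<le> L * l1_norm m (\<lambda>i. ?x (Suc k) s i - ?x k s i)"
        by (rule L(2)[OF xB[OF s] xB[OF s]])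
      also have "\<dots> \<le> L * (M * L ^ k * \<bar>s\<bar> ^ Suc k / fact (Suc k))" by (rule mult_left_mono[OF Suc.IH[OF s] L(1)])
      finally show "l1_norm m (\<lambda>i. V (?x (Suc k) s) i - V (?x k s) i) \<le> M * L ^ Suc k * \<bar>s\<bar> ^ Suc k / fact (Suc k)"
        by (simp add: mult_ac)
    next
      fix r :: real
      have "((\<lambda>r. r ^ Suc (Suc k)) has_real_derivative real (Suc (Suc k)) * r ^ Suc k) (at r)"
        using DERIV_pow[of "Suc (Suc k)" r UNIV] by simp
      from DERIV_cmult[OF this, of "M * L ^ Suc k / fact (Suc (Suc k))"]
      have "((\<lambda>r. M * L ^ Suc k / fact (Suc (Suc k)) * r ^ Suc (Suc k)) has_real_derivative
        M * L ^ Suc k / fact (Suc (Suc k)) * (real (Suc (Suc k)) * r ^ Suc k)) (at r)" .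
      moreover have "M * L ^ Suc k / fact (Suc (Suc k)) * (real (Suc (Suc k)) * r ^ Suc k) = M * L ^ Suc k * r ^ Suc k / fact (Suc k)"
        unfolding fact_Suc[of "Suc k"] by (simp del: fact_Suc)
      ultimately show "(?H has_real_derivative M * L ^ Suc k * r ^ Suc k / fact (Suc k)) (at r)"
        by (simp only: times_divide_eq_left)
    qed (use Suc.prems in auto)
    moreover have "l1_norm m (\<lambda>i. ?x (Suc (Suc k)) 0 i - ?x (Suc k) 0 i) = 0" using picard_0[OF p] by (simp add: l1_norm_def del: picard.simps(2))
    ultimately show ?case by simp
  qed
  define a where "a k = M * T * ((L * T) ^ k / fact k)" for k
  have "M \<ge> 0" by (simp add: M_def)
  have bound: "norm (?x (Suc k) t j - ?x k t j) \<le> a k" if t: "t \<in> {-T..T}" for k t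
  proof -
    have tT: "\<bar>t\<bar> \<le> T" using t by auto
    have "\<bar>?x (Suc k) t j - ?x k t j\<bar> \<le> l1_norm m (\<lambda>i. ?x (Suc k) t i - ?x k t i)" by (rule coord_le_l1_norm[OF j])
    also have "\<dots> \<le> M * L ^ k * \<bar>t\<bar> ^ Suc k / fact (Suc k)" by (rule step[OF tT])
    also have "\<dots> \<le> M * L ^ k * T ^ Suc k / fact k"
      using \<open>M \<ge> 0\<close> L(1) tT by (intro frac_le mult_left_mono power_mono mult_nonneg_nonneg fact_mono) auto
    finally show ?thesis by (simp add: a_def power_mult_distrib mult_ac)
  qed
  have "summable a" unfolding a_def using summable_exp[of "L * T"] by (intro summable_mult) (simp add: divide_inverse mult.commute)
  from Weierstrass_m_test[OF bound this]
  have ul: "uniform_limit {-T..T} (\<lambda>n t. \<Sum>k<n. ?x (Suc k) t j - ?x k t j) (\<lambda>t. suminf (\<lambda>k. ?x (Suc k) t j - ?x k t j)) sequentially" .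
  have tele: "(\<Sum>k<n. ?x (Suc k) t j - ?x k t j) = ?x n t j - p j" for n t
    using sum_lessThan_telescope[of "\<lambda>k. ?x k t j" n] by simp
  have "uniform_limit {-T..T} (\<lambda>n t. p j + (?x n t j - p j)) (\<lambda>t. p j + suminf (\<lambda>k. ?x (Suc k) t j - ?x k t j)) sequentially"
    using ul unfolding tele by (intro uniform_limit_intros)
  then have ul2: "uniform_limit {-T..T} (\<lambda>n t. ?x n t j) (\<lambda>t. p j + suminf (\<lambda>k. ?x (Suc k) t j - ?x k t j)) sequentially" by simp
  have "flow m V t p j = p j + suminf (\<lambda>k. ?x (Suc k) t j - ?x k t j)" if "t \<in> {-T..T}" for t
    using tendsto_uniform_limitI[OF ul2 that] j by (simp add: flow_def limI)
  then show ?thesis using ul2 by (subst uniform_limit_cong'[of "{-T..T}" _ "\<lambda>n t. ?x n t j" _ "\<lambda>t. p j + suminf (\<lambda>k. ?x (Suc k) t j - ?x k t j)"]) auto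
qed

lemma flow_bounded:
  assumes V: "tame_field m V"
  shows "\<exists>B. \<forall>p\<in>l1_ball m R. \<forall>k t. \<bar>t\<bar> \<le> T \<longrightarrow> picard m V p k t \<in> l1_ball m B \<and> flow m V t p \<in> l1_ball m B"
proof -
  obtain B where B: "\<forall>p\<in>l1_ball m R. \<forall>k t. \<bar>t\<bar> \<le> T \<longrightarrow> l1_norm m (picard m V p k t) \<le> B"
    using V unfolding tame_field_def by blast
  show ?thesis
  proof (intro exI[of _ B] ballI allI impI)
    fix p k t assume p: "p \<in> l1_ball m R" and t: "\<bar>t\<bar> \<le> T"
    have pR: "p \<in> Rn m" using p by (simp add: l1_ball_def)
    have "(\<lambda>k. picard m V p k t j) \<longlonglongrightarrow> flow m V t p j" if "j < m" for j
      using t by (intro tendsto_uniform_limitI[OF picard_uniform_limit[OF V pR that, of T], of t]) auto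
    then have "(\<lambda>k. l1_norm m (picard m V p k t)) \<longlonglongrightarrow> l1_norm m (flow m V t p)"
      unfolding l1_norm_def by (intro tendsto_sum tendsto_rabs) auto
    then have "l1_norm m (flow m V t p) \<le> B" using B p t by (intro tendsto_upperbound) auto
    then show "picard m V p k t \<in> l1_ball m B \<and> flow m V t p \<in> l1_ball m B"
      using B p t picard_in_Rn[OF pR] by (auto simp: l1_ball_def)
  qed
qed

lemma flow_has_derivative:
  assumes V: "tame_field m V" and p: "p \<in> Rn m" and j: "j < m"
  shows "((\<lambda>t. flow m V t p j) has_real_derivative V (flow m V t p) j) (at t)"
proof -
  let ?x = "picard m V p"
  define T where "T = \<bar>t\<bar> + 1"
  obtain B where B: "\<And>k t. \<bar>t\<bar> \<le> T \<Longrightarrow> ?x k t \<in> l1_ball m B \<and> flow m V t p \<in> l1_ball m B"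
    using flow_bounded[OF V, of "l1_norm m p" T] p by (auto simp: l1_ball_def)
  obtain L where L: "L \<ge> 0" "\<And>x y. x \<in> l1_ball m B \<Longrightarrow> y \<in> l1_ball m B \<Longrightarrow> \<bar>V y j - V x j\<bar> \<le> L * l1_norm m (\<lambda>i. y i - x i)"
    using smooth_field_Lipschitz[OF tame_field_smooth[OF V]] j by meson
  let ?S = "{-T..T}"
  have "\<exists>g. \<forall>s\<in>?S. (\<lambda>n. ?x (Suc n) s j) \<longlonglongrightarrow> g s \<and> (g has_derivative (\<lambda>h. V (flow m V s p) j * h)) (at s within ?S)"
  proof (rule has_derivative_sequence[where f' = "\<lambda>n s h. V (?x n s) j * h" and ?x0.0 = 0])
    fix n s
    show "((\<lambda>s. ?x (Suc n) s j) has_derivative (\<lambda>h. V (?x n s) j * h)) (at s within ?S)"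
      using has_field_derivative_at_within[OF picard_has_derivative[OF tame_field_smooth[OF V] p j]] by (simp add: has_field_derivative_def del: picard.simps(2))
  next
    fix e :: real assume e: "e > 0"
    have "\<forall>\<^sub>F n in sequentially. \<forall>i\<in>{..<m}. \<forall>s\<in>?S. dist (?x n s i) (flow m V s p i) < e / ((L + 1) * (real m + 1))"
    proof (subst eventually_ball_finite_distrib, simp, safe)
      fix i assume "i < m"
      show "\<forall>\<^sub>F n in sequentially. \<forall>s\<in>?S. dist (?x n s i) (flow m V s p i) < e / ((L + 1) * (real m + 1))"
        using uniform_limitD[OF picard_uniform_limit[OF V p \<open>i < m\<close>], of "e / ((L + 1) * (real m + 1))" T] e L(1) by simp
    qed
    then show "\<forall>\<^sub>F n in sequentially. \<forall>s\<in>?S. \<forall>h. norm (V (?x n s) j * h - V (flow m V s p) j * h) \<le> e * norm h"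
    proof eventually_elim
      case (elim n)
      show ?case
      proof (intro ballI allI)
        fix s h assume s: "s \<in> ?S"
        have "\<bar>V (?x n s) j - V (flow m V s p) j\<bar> \<le> L * l1_norm m (\<lambda>i. ?x n s i - flow m V s p i)"
          using s B by (intro L(2)) (auto simp: abs_le_iff)
        also have "\<dots> \<le> L * (\<Sum>i<m. e / ((L + 1) * (real m + 1)))"
          unfolding l1_norm_def using elim s L(1) by (intro mult_left_mono sum_mono) (auto simp: dist_real_def less_imp_le)
        also have "\<dots> = (L / (L + 1)) * (real m / (real m + 1)) * e" by simp
        also have "\<dots> \<le> 1 * 1 * e" using L(1) e by (intro mult_mono) auto
        finally have "\<bar>V (?x n s) j - V (flow m V s p) j\<bar> \<le> e" by simp
        then show "norm (V (?x n s) j * h - V (flow m V s p) j * h) \<le> e * norm h"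
          unfolding left_diff_distrib[symmetric] norm_mult by (simp add: mult_right_mono)
      qed
    qed
  next
    show "(\<lambda>n. ?x (Suc n) 0 j) \<longlonglongrightarrow> p j" using p by (simp del: picard.simps(2))
  qed (auto simp: T_def)
  then obtain g where g: "\<And>s. s\<in>?S \<Longrightarrow> (\<lambda>n. ?x (Suc n) s j) \<longlonglongrightarrow> g s"
    "\<And>s. s\<in>?S \<Longrightarrow> (g has_derivative (\<lambda>h. V (flow m V s p) j * h)) (at s within ?S)" by blast
  have gf: "g s = flow m V s p j" if "s \<in> ?S" for s
    using LIMSEQ_unique[OF g(1)[OF that]] LIMSEQ_Suc[OF tendsto_uniform_limitI[OF picard_uniform_limit[OF V p j, of T] that]] by blast
  have tS: "t \<in> ?S" by (auto simp: T_def)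
  have "(g has_real_derivative V (flow m V t p) j) (at t within ?S)"
    unfolding has_field_derivative_def by (rule g(2)[OF tS])
  then have "(g has_real_derivative V (flow m V t p) j) (at t)" by (simp add: at_within_Icc_at T_def)
  then show ?thesis
    by (rule has_field_derivative_transform_within_open[where S = "{-T<..<T}"]) (auto simp: T_def gf)
qed

subsection \<open>Uniqueness and the group law\<close>

text \<open>The difference of two solutions satisfies the hypotheses of Gronwall's inequality with \<open>e = 0\<close>.\<close>

lemma flow_unique:
  assumes V: "tame_field m V" and x: "\<And>s. x s \<in> Rn m"
    and d: "\<And>j s. j < m \<Longrightarrow> ((\<lambda>s. x s j) has_real_derivative V (x s) j) (at s)"
  shows "x t = flow m V t (x 0)"
proof -
  define T where "T = \<bar>t\<bar>"
  define p where "p = x 0"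
  have p: "p \<in> Rn m" using x p_def by blast
  have "continuous_on {-T..T} (\<lambda>s. l1_norm m (x s))"
    using d by (intro continuous_on_l1_norm DERIV_atLeastAtMost_imp_continuous_on) blast
  then have "compact ((\<lambda>s. l1_norm m (x s)) ` {-T..T})" by (intro compact_continuous_image) auto
  then obtain B1 where B1: "\<And>s. s \<in> {-T..T} \<Longrightarrow> l1_norm m (x s) \<le> B1"
    using compact_imp_bounded bounded_iff by (metis imageI real_norm_def abs_le_D1)
  obtain B2 where B2: "\<And>s. \<bar>s\<bar> \<le> T \<Longrightarrow> flow m V s p \<in> l1_ball m B2"
    using flow_bounded[OF V, of "l1_norm m p" T] p by (auto simp: l1_ball_def)
  define B where "B = max B1 B2"
  have xB: "x s \<in> l1_ball m B" "flow m V s p \<in> l1_ball m B" if "\<bar>s\<bar> \<le> T" for s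
    using B1[of s] B2[of s] x that by (auto simp: l1_ball_def B_def abs_le_iff)
  obtain L where L: "L \<ge> 0" "\<And>x y j. x \<in> l1_ball m B \<Longrightarrow> y \<in> l1_ball m B \<Longrightarrow> j < m \<Longrightarrow>
      \<bar>V y j - V x j\<bar> \<le> L * l1_norm m (\<lambda>i. y i - x i)"
    using smooth_field_Lipschitz[OF tame_field_smooth[OF V], of B] by metis
  have "(\<Sum>j<m. (x t j - flow m V t p j)\<^sup>2) \<le> ((\<Sum>j<m. (x 0 j - flow m V 0 p j)\<^sup>2) + real m * 0\<^sup>2) * exp ((2 * L * m + 1) * T)"
  proof (rule Gronwall_squares[where u' = "\<lambda>s j. V (x s) j - V (flow m V s p) j"])
    show "((\<lambda>s. x s j - flow m V s p j) has_real_derivative V (x s) j - V (flow m V s p) j) (at s)" if "j < m" for j s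
      by (intro DERIV_diff d flow_has_derivative V p that)
    show "\<bar>V (x s) j - V (flow m V s p) j\<bar> \<le> L * l1_norm m (\<lambda>j. x s j - flow m V s p j) + 0" if "j < m" "\<bar>s\<bar> \<le> T" for j s
      using L(2)[OF xB(2,1)[OF that(2)] that(1)] by simp
  qed (auto simp: T_def L(1))
  also have "\<dots> = 0" using p by (simp add: p_def)
  finally have "(\<Sum>j<m. (x t j - flow m V t p j)\<^sup>2) = 0" using sum_nonneg[of "{..<m}" "\<lambda>j. (x t j - flow m V t p j)\<^sup>2"] by simp
  then have "x t j = flow m V t p j" if "j < m" for j using that by (simp add: sum_nonneg_eq_0_iff)
  then show ?thesis using x flow_in_Rn unfolding p_def by (intro Rn_eqI) auto
qed

lemma flow_add:
  assumes V: "tame_field m V" and p: "p \<in> Rn m"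
  shows "flow m V (s + t) p = flow m V s (flow m V t p)"
proof -
  have "((\<lambda>s. flow m V (s + t) p j) has_real_derivative V (flow m V (s + t) p) j) (at s)" if "j < m" for j s
    using flow_has_derivative[OF V p that, of "s + t"] by (simp only: DERIV_shift)
  from flow_unique[OF V flow_in_Rn this, of s] show ?thesis by simp
qed

lemma sum_squares_le_l1_norm: "(\<Sum>i<m. (a i)\<^sup>2) \<le> (l1_norm m a)\<^sup>2"
proof -
  have "(\<Sum>i<m. (a i)\<^sup>2) \<le> (\<Sum>i<m. \<bar>a i\<bar> * l1_norm m a)"
  proof (rule sum_mono)
    fix i assume "i \<in> {..<m}"
    then have "\<bar>a i\<bar> * \<bar>a i\<bar> \<le> \<bar>a i\<bar> * l1_norm m a" by (intro mult_left_mono coord_le_l1_norm) auto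
    then show "(a i)\<^sup>2 \<le> \<bar>a i\<bar> * l1_norm m a" by (simp add: power2_eq_square)
  qed
  also have "\<dots> = (l1_norm m a)\<^sup>2" by (simp add: l1_norm_def power2_eq_square sum_distrib_right)
  finally show ?thesis .
qed

lemma flow_Lipschitz:
  assumes V: "tame_field m V"
  shows "\<exists>K\<ge>0. \<forall>p\<in>l1_ball m R. \<forall>q\<in>l1_ball m R. \<forall>t j. \<bar>t\<bar> \<le> T \<longrightarrow> j < m \<longrightarrow>
    \<bar>flow m V t q j - flow m V t p j\<bar> \<le> K * l1_norm m (\<lambda>i. q i - p i)"
proof -
  obtain B where B: "\<And>p s. p \<in> l1_ball m R \<Longrightarrow> \<bar>s\<bar> \<le> T \<Longrightarrow> flow m V s p \<in> l1_ball m B"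
    using flow_bounded[OF V, of R T] by blast
  obtain L where L: "L \<ge> 0" "\<And>x y j. x \<in> l1_ball m B \<Longrightarrow> y \<in> l1_ball m B \<Longrightarrow> j < m \<Longrightarrow>
      \<bar>V y j - V x j\<bar> \<le> L * l1_norm m (\<lambda>i. y i - x i)"
    using smooth_field_Lipschitz[OF tame_field_smooth[OF V], of B] by metis
  define E where "E = exp ((2 * L * m + 1) * T)"
  show ?thesis
  proof (intro exI[of _ "sqrt E"] conjI ballI allI impI)
    fix p q t j assume pq: "p \<in> l1_ball m R" "q \<in> l1_ball m R" and t: "\<bar>t\<bar> \<le> T" and j: "j < m"
    have R: "p \<in> Rn m" "q \<in> Rn m" using pq by (auto simp: l1_ball_def)
    have "(\<Sum>j<m. (flow m V t q j - flow m V t p j)\<^sup>2) \<le> ((\<Sum>j<m. (flow m V 0 q j - flow m V 0 p j)\<^sup>2) + real m * 0\<^sup>2) * exp ((2 * L * m + 1) * T)"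
    proof (rule Gronwall_squares[where u' = "\<lambda>s j. V (flow m V s q) j - V (flow m V s p) j"])
      show "((\<lambda>s. flow m V s q j - flow m V s p j) has_real_derivative V (flow m V s q) j - V (flow m V s p) j) (at s)" if "j < m" for j s
        by (intro DERIV_diff flow_has_derivative V R that)
      show "\<bar>V (flow m V s q) j - V (flow m V s p) j\<bar> \<le> L * l1_norm m (\<lambda>j. flow m V s q j - flow m V s p j) + 0" if "j < m" "\<bar>s\<bar> \<le> T" for j s
        using L(2)[OF B[OF pq(1) that(2)] B[OF pq(2) that(2)] that(1)] by simp
    qed (auto simp: t L(1))
    also have "\<dots> = (\<Sum>j<m. (q j - p j)\<^sup>2) * E" using R by (simp add: E_def)
    also have "\<dots> \<le> (l1_norm m (\<lambda>i. q i - p i))\<^sup>2 * E" by (intro mult_right_mono sum_squares_le_l1_norm) (simp add: E_def)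
    finally have "(\<Sum>j<m. (flow m V t q j - flow m V t p j)\<^sup>2) \<le> (l1_norm m (\<lambda>i. q i - p i))\<^sup>2 * E" .
    moreover have "(flow m V t q j - flow m V t p j)\<^sup>2 \<le> (\<Sum>j<m. (flow m V t q j - flow m V t p j)\<^sup>2)"
      using j member_le_sum[of j "{..<m}" "\<lambda>j. (flow m V t q j - flow m V t p j)\<^sup>2"] by simp
    ultimately have "(flow m V t q j - flow m V t p j)\<^sup>2 \<le> (l1_norm m (\<lambda>i. q i - p i))\<^sup>2 * E" by linarith
    then have "sqrt ((flow m V t q j - flow m V t p j)\<^sup>2) \<le> sqrt ((l1_norm m (\<lambda>i. q i - p i))\<^sup>2 * E)" by (rule real_sqrt_le_mono)
    then show "\<bar>flow m V t q j - flow m V t p j\<bar> \<le> sqrt E * l1_norm m (\<lambda>i. q i - p i)" by (simp add: real_sqrt_mult mult.commute)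
  qed (simp add: E_def)
qed

lemma flow_jointly_continuous:
  assumes V: "tame_field m V" and j: "j < m"
  shows "continuous_on (Rn (Suc m)) (\<lambda>z. flow m V (z m) (proj m z) j)"
  unfolding continuous_on_Rn_box[OF order_refl]
proof (intro ballI allI impI)
  fix z e assume z: "z \<in> Rn (Suc m)" and e: "(e::real) > 0"
  define R where "R = l1_norm m z + real m"
  define T where "T = \<bar>z m\<bar> + 1"
  have pz: "proj m z \<in> l1_ball m R" by (simp add: l1_ball_def R_def)
  obtain K where K: "K \<ge> 0" "\<And>p q t. p\<in>l1_ball m R \<Longrightarrow> q\<in>l1_ball m R \<Longrightarrow> \<bar>t\<bar> \<le> T \<Longrightarrow>
    \<bar>flow m V t q j - flow m V t p j\<bar> \<le> K * l1_norm m (\<lambda>i. q i - p i)"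
    using flow_Lipschitz[OF V, of R T] j by metis
  have "isCont (\<lambda>t. flow m V t (proj m z) j) (z m)"
    using flow_has_derivative[OF V proj_in_Rn j] DERIV_isCont by blast
  then obtain d1 where d1: "d1 > 0" "\<And>t. \<bar>t - z m\<bar> < d1 \<Longrightarrow> \<bar>flow m V t (proj m z) j - flow m V (z m) (proj m z) j\<bar> < e / 2"
    unfolding continuous_at_eps_delta dist_real_def using e by (metis half_gt_zero)
  define d where "d = min (min 1 d1) (e / (2 * (K + 1) * (real m + 1)))"
  have d: "d > 0" "d \<le> 1" "d \<le> d1" "d \<le> e / (2 * (K + 1) * (real m + 1))"
    using d1(1) e K(1) by (auto simp: d_def)
  have "\<bar>flow m V (y m) (proj m y) j - flow m V (z m) (proj m z) j\<bar> < e"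
    if y: "\<forall>i<Suc m. \<bar>y i - z i\<bar> < d" for y
  proof -
    have nd: "l1_norm m (\<lambda>i. y i - z i) \<le> real m * d"
      unfolding l1_norm_def using y sum_bounded_above[of "{..<m}" "\<lambda>i. \<bar>y i - z i\<bar>" d] by (simp add: less_imp_le)
    also have "\<dots> \<le> real m" using d by (simp add: mult_left_le)
    finally have "l1_norm m y \<le> R" using l1_norm_diff_triangle[of m y z] by (simp add: R_def)
    then have "\<bar>flow m V (y m) (proj m y) j - flow m V (y m) (proj m z) j\<bar> \<le> K * l1_norm m (\<lambda>i. proj m y i - proj m z i)"
      using y d by (intro K(2) pz) (fastforce simp: l1_ball_def T_def)+
    also have "l1_norm m (\<lambda>i. proj m y i - proj m z i) = l1_norm m (\<lambda>i. y i - z i)" by (simp add: l1_norm_def proj_def)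
    also have "K * l1_norm m (\<lambda>i. y i - z i) \<le> K * (real m * (e / (2 * (K + 1) * (real m + 1))))"
      by (rule mult_left_mono[OF order_trans[OF nd mult_left_mono[OF d(4)]] K(1)]) simp
    also have "\<dots> = (K / (K + 1)) * (real m / (real m + 1)) * (e / 2)"
      by (simp add: mult_ac distrib_left)
    also have "\<dots> \<le> 1 * 1 * (e / 2)" using K(1) e by (intro mult_mono) auto
    finally have "\<bar>flow m V (y m) (proj m y) j - flow m V (y m) (proj m z) j\<bar> \<le> e / 2" by simp
    moreover have "\<bar>flow m V (y m) (proj m z) j - flow m V (z m) (proj m z) j\<bar> < e / 2" using d1(2)[of "y m"] y d by force
    ultimately show ?thesis by linarith
  qed
  then show "\<exists>d>0. \<forall>y\<in>Rn (Suc m). (\<forall>i<Suc m. \<bar>y i - z i\<bar> < d) \<longrightarrow>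
     \<bar>flow m V (y m) (proj m y) j - flow m V (z m) (proj m z) j\<bar> < e" using d(1) by blast
qed

subsection \<open>The variational equation\<close>

text \<open>The pairs \<open>(x, w)\<close> occupy the coordinates below \<open>m\<close> and from \<open>m\<close> to \<open>2 * m - 1\<close>; the field is \<open>(V x, DV(x) w)\<close>, which
  governs a point together with an infinitesimal displacement.\<close>

definition prolong :: "nat \<Rightarrow> ((nat \<Rightarrow> real) \<Rightarrow> nat \<Rightarrow> real) \<Rightarrow> (nat \<Rightarrow> real) \<Rightarrow> nat \<Rightarrow> real"
  where "prolong m V z j = (if j < m then V (proj m z) j
     else if j < 2 * m then \<Sum>l<m. partial_deriv l (\<lambda>x. V x (j - m)) (proj m z) * z (m + l) else 0)"

lemma sum_lessThan_add: "(\<Sum>i<a+b. f i) = (\<Sum>i<a. f i) + (\<Sum>i<b. f (a + i))" for f :: "nat \<Rightarrow> real"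
  by (induction b) auto

lemma l1_norm_double: "l1_norm (2 * m) z = l1_norm m z + l1_norm m (\<lambda>i. z (m + i))"
  using sum_lessThan_add[of "\<lambda>i. \<bar>z i\<bar>" m m] by (simp add: l1_norm_def mult_2)

lemma Ck_on_proj: "openin (Euclidean_space n) V \<Longrightarrow> Ck_on k n V (\<lambda>z. proj m z i)"
  by (cases "i < m") (simp_all add: proj_def Ck_on_coord Ck_on_const)

lemma smooth_prolong:
  assumes V: "smooth_field m V"
  shows "smooth_field (2 * m) (prolong m V)"
  unfolding smooth_field_def
proof (intro allI impI)
  fix j k assume j: "j < 2 * m"
  have proj: "Ck_on k (2*m) (Rn (2*m)) (\<lambda>z. h (proj m z))" if "Ck_on k m (Rn m) h" for h
    by (rule Ck_on_compose[where W = "Rn m" and m = m and g = "proj m" and h = h]) (use that in \<open>auto intro: Ck_on_proj\<close>)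
  show "Ck_on k (2*m) (Rn (2*m)) (\<lambda>z. prolong m V z j)"
  proof (cases "j < m")
    case True
    then show ?thesis using proj[OF smooth_field_Ck[OF V True]] by (simp add: prolong_def)
  next
    case False
    then have jm: "j - m < m" using j by simp
    have "Ck_on k m (Rn m) (partial_deriv l (\<lambda>x. V x (j - m)))" if "l < m" for l
      by (rule Ck_on_partial[OF smooth_field_Ck[OF V jm] that])
    then have "Ck_on k (2*m) (Rn (2*m)) (\<lambda>z. \<Sum>l<m. partial_deriv l (\<lambda>x. V x (j - m)) (proj m z) * z (m + l))"
      by (intro Ck_on_sum Ck_on_mult openin_Rn_UNIV Ck_on_coord proj) auto
    then show ?thesis using False j by (simp add: prolong_def)
  qed
qed

lemma proj_less: "j < m \<Longrightarrow> proj m z j = z j"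
  by (simp add: proj_def)

lemma prolong_less: "j < m \<Longrightarrow> prolong m V z j = V (proj m z) j"
  by (simp add: prolong_def)

lemma picard_prolong: "proj m (picard (2*m) (prolong m V) q k t) = picard m V (proj m q) k t"
proof (induction k arbitrary: t)
  case (Suc k)
  show ?case
  proof
    fix j
    show "proj m (picard (2*m) (prolong m V) q (Suc k) t) j = picard m V (proj m q) (Suc k) t j"
    proof (cases "j < m")
      case True
      then show ?thesis by (simp add: proj_less prolong_less Suc.IH)
    qed (simp add: proj_def)
  qed
qed simp

lemma partials_bounded:
  assumes V: "smooth_field m V"
  shows "\<exists>L\<ge>0. \<forall>x\<in>l1_ball m R. \<forall>w. l1_norm m (\<lambda>j. \<Sum>l<m. partial_deriv l (\<lambda>x. V x j) x * w l) \<le> L * l1_norm m w"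
proof -
  have "\<exists>B\<ge>0. \<forall>x\<in>l1_ball m R. \<bar>partial_deriv l (\<lambda>x. V x j) x\<bar> \<le> B" if "j < m" "l < m" for j l
    using Ck_on_partial[OF smooth_field_Ck[OF V that(1), of 1, unfolded One_nat_def] that(2)]
    by (intro bounded_on_l1_ball) (simp add: Ck_on_continuous)
  then obtain b where b: "\<And>j l. j < m \<Longrightarrow> l < m \<Longrightarrow> b j l \<ge> 0"
    "\<And>j l x. j < m \<Longrightarrow> l < m \<Longrightarrow> x \<in> l1_ball m R \<Longrightarrow> \<bar>partial_deriv l (\<lambda>x. V x j) x\<bar> \<le> b j l" by metis
  define c where "c j = (\<Sum>l<m. b j l)" for j
  have c: "c j \<ge> 0" "\<And>l. l < m \<Longrightarrow> b j l \<le> c j" if "j < m" for j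
    using b(1)[OF that] by (auto simp: c_def intro!: sum_nonneg member_le_sum)
  show ?thesis
  proof (intro exI[of _ "\<Sum>j<m. c j"] conjI ballI allI)
    show "0 \<le> (\<Sum>j<m. c j)" using c(1) by (auto intro!: sum_nonneg)
    fix x w assume x: "x \<in> l1_ball m R"
    have "\<bar>\<Sum>l<m. partial_deriv l (\<lambda>x. V x j) x * w l\<bar> \<le> c j * l1_norm m w" if j: "j < m" for j
    proof -
      have "\<bar>\<Sum>l<m. partial_deriv l (\<lambda>x. V x j) x * w l\<bar> \<le> (\<Sum>l<m. c j * \<bar>w l\<bar>)"
      proof (rule order_trans[OF sum_abs sum_mono])
        fix l assume "l \<in> {..<m}"
        then have "\<bar>partial_deriv l (\<lambda>x. V x j) x\<bar> \<le> c j" using b(2)[OF j _ x] c(2)[OF j] by (meson lessThan_iff order_trans)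
        then show "\<bar>partial_deriv l (\<lambda>x. V x j) x * w l\<bar> \<le> c j * \<bar>w l\<bar>" by (simp add: abs_mult mult_right_mono)
      qed
      then show ?thesis by (simp add: l1_norm_def sum_distrib_left)
    qed
    then show "l1_norm m (\<lambda>j. \<Sum>l<m. partial_deriv l (\<lambda>x. V x j) x * w l) \<le> (\<Sum>j<m. c j) * l1_norm m w"
      unfolding l1_norm_def[of m "\<lambda>j. \<Sum>l<m. partial_deriv l (\<lambda>x. V x j) x * w l"] sum_distrib_right by (intro sum_mono) auto
  qed
qed

text \<open>The first halves of the iterates are Picard iterates of \<open>V\<close> and stay in a ball on which \<open>DV\<close> has norm at most
  some \<open>L\<close>; by induction the second halves are bounded by \<open>R * exp (L * \<bar>t\<bar>)\<close>.\<close>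

lemma tame_prolong:
  assumes V: "tame_field m V"
  shows "tame_field (2 * m) (prolong m V)"
  unfolding tame_field_def
proof (intro conjI allI)
  note sm = tame_field_smooth[OF V]
  show "smooth_field (2 * m) (prolong m V)" using sm by (rule smooth_prolong)
  fix R T :: real
  let ?x = "\<lambda>q k t. picard (2*m) (prolong m V) q k t"
  obtain B where B: "\<And>p k t. p\<in>l1_ball m R \<Longrightarrow> \<bar>t\<bar> \<le> T \<Longrightarrow> picard m V p k t \<in> l1_ball m B"
    using flow_bounded[OF V, of R T] by blast
  obtain L where L: "L \<ge> 0" "\<And>x w. x\<in>l1_ball m B \<Longrightarrow> l1_norm m (\<lambda>j. \<Sum>l<m. partial_deriv l (\<lambda>x. V x j) x * w l) \<le> L * l1_norm m w"
    using partials_bounded[OF sm, of B] by blast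
  show "\<exists>B. \<forall>q\<in>l1_ball (2*m) R. \<forall>k t. \<bar>t\<bar> \<le> T \<longrightarrow> l1_norm (2*m) (?x q k t) \<le> B"
  proof (intro exI[of _ "B + R * exp (L * T)"] ballI allI impI)
    fix q k t assume q: "q \<in> l1_ball (2*m) R" and t: "\<bar>t\<bar> \<le> T"
    have qR: "q \<in> Rn (2*m)" and qn: "l1_norm m q \<le> R" "l1_norm m (\<lambda>i. q (m + i)) \<le> R" "R \<ge> 0"
      using q l1_norm_nonneg[of m q] l1_norm_nonneg[of m "\<lambda>i. q (m + i)"] unfolding l1_ball_def mem_Collect_eq l1_norm_double by linarith+
    have fst: "proj m (?x q k t) \<in> l1_ball m B" if "\<bar>t\<bar> \<le> T" for k t
      unfolding picard_prolong using qn that by (intro B) (auto simp: l1_ball_def)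
    have snd: "l1_norm m (\<lambda>i. ?x q k t (m + i)) \<le> R * exp (L * \<bar>t\<bar>)" if "\<bar>t\<bar> \<le> T" for k t
      using that
    proof (induction k arbitrary: t)
      case 0
      have "R * 1 \<le> R * exp (L * \<bar>t\<bar>)" using L(1) qn by (intro mult_left_mono) auto
      then show ?case using qn by simp
    next
      case (Suc k)
      have "l1_norm m (\<lambda>i. ?x q (Suc k) t (m + i)) \<le> l1_norm m (\<lambda>i. ?x q (Suc k) 0 (m + i)) + (R * exp (L * \<bar>t\<bar>) - R * exp (L * 0))"
      proof (rule l1_norm_growth_bound[where u' = "\<lambda>s i. prolong m V (?x q k s) (m + i)" and h = "\<lambda>r. L * (R * exp (L * r))"])
        show "((\<lambda>s. ?x q (Suc k) s (m + j)) has_real_derivative prolong m V (?x q k s) (m + j)) (at s)" if "j < m" for j s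
          using that by (intro picard_has_derivative smooth_prolong sm qR) auto
        show "((\<lambda>r. R * exp (L * r)) has_real_derivative L * (R * exp (L * r))) (at r)" for r
          by (auto intro!: derivative_eq_intros)
        show "l1_norm m (\<lambda>i. prolong m V (?x q k s) (m + i)) \<le> L * (R * exp (L * \<bar>s\<bar>))" if s: "\<bar>s\<bar> \<le> T" for s
        proof -
          have "l1_norm m (\<lambda>i. prolong m V (?x q k s) (m + i)) =
              l1_norm m (\<lambda>i. \<Sum>l<m. partial_deriv l (\<lambda>x. V x i) (proj m (?x q k s)) * ?x q k s (m + l))"
            unfolding l1_norm_def by (intro sum.cong) (auto simp: prolong_def)
          also have "\<dots> \<le> L * l1_norm m (\<lambda>l. ?x q k s (m + l))" by (rule L(2)[OF fst[OF s]])
          also have "\<dots> \<le> L * (R * exp (L * \<bar>s\<bar>))" by (rule mult_left_mono[OF Suc.IH[OF s] L(1)])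
          finally show ?thesis .
        qed
      qed (use Suc.prems in auto)
      then show ?case using qn picard_0[OF qR, of "prolong m V" "Suc k"] by (simp del: picard.simps(2))
    qed
    have "l1_norm m (?x q k t) \<le> B" using fst[OF t, of k] by (simp add: l1_ball_def)
    moreover have "R * exp (L * \<bar>t\<bar>) \<le> R * exp (L * T)" using qn L(1) t by (intro mult_left_mono) (auto intro: mult_left_mono)
    ultimately show "l1_norm (2*m) (?x q k t) \<le> B + R * exp (L * T)" unfolding l1_norm_double using snd[OF t, of k] by linarith
  qed
qed

lemma flow_prolong: "proj m (flow (2*m) (prolong m V) t q) = flow m V t (proj m q)"
proof (rule ext)
  fix j
  show "proj m (flow (2*m) (prolong m V) t q) j = flow m V t (proj m q) j"
  proof (cases "j < m")
    case True
    have "picard (2*m) (prolong m V) q k t j = picard m V (proj m q) k t j" for k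
      using fun_cong[OF picard_prolong[of m V q k t], of j] unfolding proj_less[OF True, of "picard (2*m) (prolong m V) q k t"] .
    then have "(\<lambda>k. picard (2*m) (prolong m V) q k t j) = (\<lambda>k. picard m V (proj m q) k t j)" by blast
    then show ?thesis using True unfolding proj_less[OF True] flow_def by simp
  qed (simp add: proj_def flow_def)
qed

definition unit_vec :: "nat \<Rightarrow> nat \<Rightarrow> real"
  where "unit_vec i = (\<lambda>l. if l = i then 1 else 0)"

lemma unit_vec_in_Rn: "i < m \<Longrightarrow> unit_vec i \<in> Rn m"
  by (auto simp: unit_vec_def Rn_iff)

lemma join_in_Rn: "y \<in> Rn k \<Longrightarrow> join m x y \<in> Rn (m + k)"
  by (auto simp: join_def Rn_iff)

lemma proj_join [simp]: "proj m (join m x y) = proj m x"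
  by (auto simp: join_def proj_def)

lemma quadratic_error_has_derivative:
  fixes f :: "real \<Rightarrow> real"
  assumes "\<And>h. \<bar>h\<bar> \<le> 1 \<Longrightarrow> \<bar>f (a + h) - f a - h * w\<bar> \<le> D * h\<^sup>2"
  shows "(f has_real_derivative w) (at a)"
proof -
  have "((\<lambda>h. (f (a + h) - f a) / h - w) \<longlongrightarrow> 0) (at 0)"
  proof (rule Lim_null_comparison[where g = "\<lambda>h. D * \<bar>h\<bar>"])
    have "norm ((f (a + h) - f a) / h - w) \<le> D * \<bar>h\<bar>" if "h \<noteq> 0" "dist h 0 < 1" for h
    proof -
      have "(f (a + h) - f a) / h - w = (f (a + h) - f a - h * w) / h" using that by (simp add: field_simps)
      then have "norm ((f (a + h) - f a) / h - w) \<le> D * h\<^sup>2 / \<bar>h\<bar>" using assms[of h] that by (simp add: divide_right_mono)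
      then show ?thesis using that by (simp add: power2_eq_square abs_if split: if_splits)
    qed
    then show "\<forall>\<^sub>F h in at 0. norm ((f (a + h) - f a) / h - w) \<le> D * \<bar>h\<bar>"
      unfolding eventually_at by (intro exI[of _ 1]) auto
    show "((\<lambda>h. D * \<bar>h\<bar>) \<longlongrightarrow> 0) (at 0)" by (auto intro!: tendsto_eq_intros)
  qed
  then show ?thesis by (simp add: DERIV_def LIM_zero_iff)
qed

text \<open>Let \<open>x\<close> be the trajectory of \<open>p\<close>, \<open>y h\<close> that of the displaced point, and \<open>w\<close> the second half of the prolonged trajectory.
  By Taylor's formula \<open>u = y h - x - h * w\<close> satisfies Gronwall's hypotheses with \<open>e\<close> of order \<open>h\<^sup>2\<close> and \<open>u 0 = 0\<close>.\<close>

lemma flow_has_partial: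
  assumes V: "tame_field m V" and p: "p \<in> Rn m" and i: "i < m" and j: "j < m"
  shows "has_partial (\<lambda>p. flow m V t p j) i (flow (2*m) (prolong m V) t (join m p (unit_vec i)) (m + j)) p"
proof -
  note sm = tame_field_smooth[OF V]
  define q where "q = join m p (unit_vec i)"
  have q: "q \<in> Rn (2*m)" unfolding q_def mult_2 by (intro join_in_Rn unit_vec_in_Rn i)
  define W where "W s = flow (2*m) (prolong m V) s q" for s
  define x where "x s = flow m V s p" for s
  have xW: "proj m (W s) = x s" for s using p by (simp add: W_def x_def flow_prolong q_def proj_Rn)
  have dW: "((\<lambda>s. W s (m + l)) has_real_derivative (\<Sum>r<m. partial_deriv r (\<lambda>x. V x l) (x s) * W s (m + r))) (at s)"
    if "l < m" for l s
    using flow_has_derivative[OF tame_prolong[OF V] q, of "m + l" s] that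
    by (simp add: W_def[symmetric] prolong_def xW)
  define R where "R = l1_norm m p + 1"
  define T where "T = \<bar>t\<bar>"
  define y where "y h s = flow m V s (p(i := p i + h))" for h s
  have ph: "l1_norm m (\<lambda>r. (p(i := p i + h)) r - p r) = \<bar>h\<bar>" for h
    unfolding l1_norm_def using i by (subst sum.remove[of _ i]) auto
  have phR: "p(i := p i + h) \<in> l1_ball m R" if "\<bar>h\<bar> \<le> 1" for h
    using l1_norm_diff_triangle[of m "p(i := p i + h)" p] that ph[of h] Rn_upd[OF p i] by (simp add: l1_ball_def R_def del: fun_upd_apply)
  have pR: "p \<in> l1_ball m R" using p by (simp add: l1_ball_def R_def)
  obtain B where B: "\<And>p s. p\<in>l1_ball m R \<Longrightarrow> \<bar>s\<bar> \<le> T \<Longrightarrow> flow m V s p \<in> l1_ball m B"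
    using flow_bounded[OF V, of R T] by blast
  obtain K where K: "K \<ge> 0" "\<And>p q t j. p\<in>l1_ball m R \<Longrightarrow> q\<in>l1_ball m R \<Longrightarrow> \<bar>t\<bar> \<le> T \<Longrightarrow> j < m \<Longrightarrow>
    \<bar>flow m V t q j - flow m V t p j\<bar> \<le> K * l1_norm m (\<lambda>i. q i - p i)"
    using flow_Lipschitz[OF V, of R T] by metis
  obtain L where L: "L \<ge> 0" "\<And>x w. x\<in>l1_ball m B \<Longrightarrow> l1_norm m (\<lambda>j. \<Sum>l<m. partial_deriv l (\<lambda>x. V x j) x * w l) \<le> L * l1_norm m w"
    using partials_bounded[OF sm, of B] by blast
  define Q where "Q j c \<longleftrightarrow> c \<ge> 0 \<and> (\<forall>x\<in>l1_ball m B. \<forall>y\<in>l1_ball m B.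
    \<bar>V y j - V x j - (\<Sum>l<m. partial_deriv l (\<lambda>x. V x j) x * (y l - x l))\<bar> \<le> c * (l1_norm m (\<lambda>i. y i - x i))\<^sup>2)" for j c
  have "\<exists>c. Q j c" if "j < m" for j
    using Taylor_on_l1_ball[OF smooth_field_Ck[OF sm that], of B] unfolding Q_def by blast
  then obtain C where CQ: "\<And>j. j < m \<Longrightarrow> Q j (C j)" by metis
  have C: "\<And>j. j < m \<Longrightarrow> C j \<ge> 0" "\<And>x y j. j < m \<Longrightarrow> x\<in>l1_ball m B \<Longrightarrow> y\<in>l1_ball m B \<Longrightarrow>
    \<bar>V y j - V x j - (\<Sum>l<m. partial_deriv l (\<lambda>x. V x j) x * (y l - x l))\<bar> \<le> C j * (l1_norm m (\<lambda>i. y i - x i))\<^sup>2"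
    using CQ unfolding Q_def by blast+
  define M where "M = (\<Sum>j<m. C j) * (real m * K)\<^sup>2"
  have M: "M \<ge> 0" using C(1) by (auto simp: M_def intro!: mult_nonneg_nonneg sum_nonneg)
  define E where "E = exp ((2 * L * m + 1) * T)"
  have main: "\<bar>y h t j - x t j - h * W t (m + j)\<bar> \<le> sqrt (real m * E) * M * h\<^sup>2" if h: "\<bar>h\<bar> \<le> 1" for h
  proof -
    have xB: "x s \<in> l1_ball m B" "y h s \<in> l1_ball m B" if "\<bar>s\<bar> \<le> T" for s
      unfolding x_def y_def using that by (auto intro!: B pR phR h simp del: fun_upd_apply)
    have yx: "l1_norm m (\<lambda>r. y h s r - x s r) \<le> real m * K * \<bar>h\<bar>" if "\<bar>s\<bar> \<le> T" for s
    proof -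
      have "\<bar>y h s r - x s r\<bar> \<le> K * \<bar>h\<bar>" if "r < m" for r
        using K(2)[OF pR phR[OF h] \<open>\<bar>s\<bar> \<le> T\<close> that] unfolding ph x_def y_def .
      then show ?thesis unfolding l1_norm_def using sum_bounded_above[of "{..<m}" "\<lambda>r. \<bar>y h s r - x s r\<bar>" "K * \<bar>h\<bar>"] by simp
    qed
    define u where "u s l = y h s l - x s l - h * W s (m + l)" for s l
    define u' where "u' s l = V (y h s) l - V (x s) l - h * (\<Sum>r<m. partial_deriv r (\<lambda>x. V x l) (x s) * W s (m + r))" for s l
    have "(\<Sum>l<m. (u t l)\<^sup>2) \<le> ((\<Sum>l<m. (u 0 l)\<^sup>2) + real m * (M * h\<^sup>2)\<^sup>2) * exp ((2 * L * m + 1) * T)"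
    proof (rule Gronwall_squares[where u' = u'])
      show "((\<lambda>s. u s l) has_real_derivative u' s l) (at s)" if "l < m" for l s
        unfolding u_def u'_def y_def x_def
        by (intro DERIV_diff DERIV_cmult flow_has_derivative V p Rn_upd i that dW[OF that, unfolded x_def])
      fix l s assume l: "l < m" and s: "\<bar>s\<bar> \<le> T"
      let ?D = "\<lambda>r. partial_deriv r (\<lambda>x. V x l) (x s)"
      have "u' s l = (V (y h s) l - V (x s) l - (\<Sum>r<m. ?D r * (y h s r - x s r))) + (\<Sum>r<m. ?D r * u s r)"
        unfolding u'_def u_def by (simp add: right_diff_distrib sum_subtractf sum_distrib_left mult_ac)
      moreover have "\<bar>V (y h s) l - V (x s) l - (\<Sum>r<m. ?D r * (y h s r - x s r))\<bar> \<le> M * h\<^sup>2"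
      proof -
        have "\<bar>V (y h s) l - V (x s) l - (\<Sum>r<m. ?D r * (y h s r - x s r))\<bar> \<le> C l * (l1_norm m (\<lambda>r. y h s r - x s r))\<^sup>2"
          by (rule C(2)[OF l xB[OF s]])
        also have "\<dots> \<le> (\<Sum>j<m. C j) * (real m * K * \<bar>h\<bar>)\<^sup>2"
          using C(1) l by (intro mult_mono power_mono yx s) (auto intro!: member_le_sum sum_nonneg)
        finally show ?thesis by (simp add: M_def power_mult_distrib mult_ac)
      qed
      moreover have "\<bar>\<Sum>r<m. ?D r * u s r\<bar> \<le> L * l1_norm m (u s)"
        using order_trans[OF coord_le_l1_norm[OF l, of "\<lambda>j. \<Sum>r<m. partial_deriv r (\<lambda>x. V x j) (x s) * u s r"] L(2)[OF xB(1)[OF s]]] .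
      ultimately show "\<bar>u' s l\<bar> \<le> L * l1_norm m (u s) + M * h\<^sup>2" by linarith
    qed (auto simp: T_def L(1) M)
    moreover have "u 0 l = 0" if "l < m" for l
      using that p q Rn_upd[OF p i, of "p i + h"] by (simp add: u_def y_def x_def W_def q_def join_def unit_vec_def)
    ultimately have "(\<Sum>l<m. (u t l)\<^sup>2) \<le> real m * (M * h\<^sup>2)\<^sup>2 * E" by (simp add: E_def)
    moreover have "(u t j)\<^sup>2 \<le> (\<Sum>l<m. (u t l)\<^sup>2)" using j by (intro member_le_sum) auto
    ultimately have "(u t j)\<^sup>2 \<le> real m * (M * h\<^sup>2)\<^sup>2 * E" by linarith
    then have "sqrt ((u t j)\<^sup>2) \<le> sqrt (real m * (M * h\<^sup>2)\<^sup>2 * E)" by (rule real_sqrt_le_mono)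
    then have "\<bar>u t j\<bar> \<le> sqrt (real m * E) * (M * h\<^sup>2)" using M by (simp add: real_sqrt_mult abs_mult mult_ac)
    then show ?thesis by (simp add: u_def mult_ac)
  qed
  have "((\<lambda>s. flow m V t (p(i := s)) j) has_real_derivative W t (m + j)) (at (p i))"
    by (rule quadratic_error_has_derivative[of _ _ _ "sqrt (real m * E) * M"])
       (use main in \<open>simp add: y_def x_def fun_upd_triv\<close>)
  then show ?thesis by (simp only: has_partial_def W_def q_def)
qed

text \<open>The time derivative of the flow is the field at the flow, and its space derivatives are components of the prolonged flow.
  So if the flows of all tame fields are \<open>C\<^sup>k\<close>, they are \<open>C\<^sup>k\<^sup>+\<^sup>1\<close>.
  The time is the last coordinate of the argument.\<close>

theorem flow_smooth:
  "tame_field m V \<Longrightarrow> j < m \<Longrightarrow> Ck_on k (Suc m) (Rn (Suc m)) (\<lambda>z. flow m V (z m) (proj m z) j)"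
proof (induction k arbitrary: m V j)
  case 0
  then show ?case using flow_jointly_continuous by simp
next
  case (Suc k)
  note V = Suc.prems(1) and j = Suc.prems(2)
  define g where "g i z = (if i < m then flow (2*m) (prolong m V) (z m) (join m (proj m z) (unit_vec i)) (m + j)
    else V (flow m V (z m) (proj m z)) j)" for i z
  show ?case
  proof (rule Ck_on_SucI[where g = g])
    show "continuous_on (Rn (Suc m)) (\<lambda>z. flow m V (z m) (proj m z) j)" by (rule flow_jointly_continuous[OF V j])
    fix i assume i: "i < Suc m"
    show "has_partial (\<lambda>z. flow m V (z m) (proj m z) j) i (g i z) z" if "z \<in> Rn (Suc m)" for z
    proof (cases "i < m")
      case True
      have "proj m (z(i := s)) = (proj m z)(i := s)" "(z(i := s)) m = z m" for s
        using True by (auto simp: proj_def)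
      moreover have "z i = proj m z i" using True by (simp add: proj_def)
      ultimately show ?thesis using flow_has_partial[OF V proj_in_Rn True j, of "z m" z] True
        by (simp only: has_partial_def g_def if_True)
    next
      case False
      then have "i = m" using i by simp
      moreover have "proj m (z(m := s)) = proj m z" for s by (auto simp: proj_def)
      ultimately show ?thesis using flow_has_derivative[OF V proj_in_Rn j, of z "z m"]
        by (simp only: has_partial_def g_def fun_upd_same if_False less_irrefl)
    qed
    show "Ck_on k (Suc m) (Rn (Suc m)) (g i)"
    proof (cases "i < m")
      case True
      define G where "G z = (\<lambda>l. if l < m then z l else if l < 2*m then unit_vec i (l - m) else if l = 2*m then z m else 0)"
        for z :: "nat \<Rightarrow> real"
      have G: "proj (2*m) (G z) = join m (proj m z) (unit_vec i)" "G z (2*m) = z m" for z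
        using True by (auto simp: G_def proj_def join_def unit_vec_def fun_eq_iff)
      have "Ck_on k (Suc m) (Rn (Suc m)) (\<lambda>z. flow (2*m) (prolong m V) (G z (2*m)) (proj (2*m) (G z)) (m + j))"
      proof (rule Ck_on_compose[where W = "Rn (Suc (2*m))" and m = "Suc (2*m)" and g = G
            and h = "\<lambda>y. flow (2*m) (prolong m V) (y (2*m)) (proj (2*m) y) (m + j)"])
        show "Ck_on k (Suc (2*m)) (Rn (Suc (2*m))) (\<lambda>y. flow (2*m) (prolong m V) (y (2*m)) (proj (2*m) y) (m + j))"
          using j by (intro Suc.IH tame_prolong V) auto
        show "Ck_on k (Suc m) (Rn (Suc m)) (\<lambda>z. G z l)" for l
          by (cases "l < m"; cases "l < 2*m"; cases "l = 2*m") (simp_all add: G_def Ck_on_coord Ck_on_const)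
      qed (auto simp: G_def Rn_iff)
      then show ?thesis using True unfolding G g_def by simp
    next
      case False
      have "Ck_on k (Suc m) (Rn (Suc m)) (\<lambda>z. V (flow m V (z m) (proj m z)) j)"
        by (rule Ck_on_compose[where W = "Rn m" and m = m and h = "\<lambda>x. V x j"])
           (auto intro: Suc.IH[OF V] smooth_field_Ck[OF tame_field_smooth[OF V] j])
      then show ?thesis using False unfolding g_def by simp
    qed
  qed simp
qed

section \<open>The implicit function theorem\<close>

definition ins :: "nat \<Rightarrow> (nat \<Rightarrow> real) \<Rightarrow> real \<Rightarrow> nat \<Rightarrow> real"
  where "ins i y t = (\<lambda>j. if j < i then y j else if j = i then t else y (j - 1))"

lemma ins_in_Rn: "y \<in> Rn m \<Longrightarrow> i \<le> m \<Longrightarrow> ins i y t \<in> Rn (Suc m)"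
  by (auto simp: ins_def Rn_iff)

lemma ins_upd [simp]: "(ins i y t)(i := s) = ins i y s"
  by (auto simp: ins_def fun_eq_iff)

lemma ins_same [simp]: "ins i y t i = t"
  by (simp add: ins_def)

lemma Ck_on_ins:
  "openin (Euclidean_space m) Y \<Longrightarrow> Ck_on k m Y g \<Longrightarrow> Ck_on k m Y (\<lambda>y. ins i y (g y) j)"
  by (cases "j < i"; cases "j = i") (simp_all add: ins_def Ck_on_coord)

lemma continuous_on_RnD:
  fixes f :: "(nat \<Rightarrow> real) \<Rightarrow> real"
  assumes "continuous_on V f" "V \<subseteq> Rn n" "x \<in> V" "e > 0"
  obtains d where "d > 0" "\<And>y. y \<in> V \<Longrightarrow> (\<forall>i<n. \<bar>y i - x i\<bar> < d) \<Longrightarrow> \<bar>f y - f x\<bar> < e"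
  using assms continuous_on_Rn_box[OF assms(2), of f] by blast

text \<open>Along a line in direction \<open>l\<close> let \<open>\<Delta>\<close> be the increment of \<open>g\<close>. As \<open>G\<close> vanishes on the graph, its linear approximation gives
  \<open>\<bar>a * (s - y l) + b * \<Delta>\<bar> \<le> e * (\<bar>s - y l\<bar> + \<bar>\<Delta>\<bar>)\<close> for every \<open>e > 0\<close>. For small \<open>e\<close> this first bounds \<open>\<Delta>\<close> by a multiple of
  \<open>s - y l\<close>, and then shows that the quotient tends to \<open>- a / b\<close>.\<close>

lemma implicit_has_partial:
  assumes \<Omega>: "openin (Euclidean_space (Suc m)) \<Omega>" and G: "Ck_on (Suc 0) (Suc m) \<Omega> G" and i: "i \<le> m"
    and Y: "openin (Euclidean_space m) Y" and g: "continuous_on Y g"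
    and on: "\<And>y. y \<in> Y \<Longrightarrow> ins i y (g y) \<in> \<Omega> \<and> G (ins i y (g y)) = 0"
    and nz: "partial_deriv i G (ins i y (g y)) \<noteq> 0" and y: "y \<in> Y" and l: "l < m"
  shows "has_partial g l (- (partial_deriv (if l < i then l else Suc l) G (ins i y (g y))
            * inverse (partial_deriv i G (ins i y (g y))))) y"
proof -
  define x where "x = ins i y (g y)"
  define l' where "l' = (if l < i then l else Suc l)"
  have l': "l' < Suc m" "l' \<noteq> i" using l i by (auto simp: l'_def)
  define a where "a = partial_deriv l' G x"
  define b where "b = partial_deriv i G x"
  have b: "b \<noteq> 0" using nz by (simp add: b_def x_def)
  define C where "C = (2 * \<bar>a\<bar> + \<bar>b\<bar>) / \<bar>b\<bar>"
  have C: "C \<ge> 0" by (simp add: C_def)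
  have yR: "y \<in> Rn m" using Y y openin_Rn_subset by blast
  define \<Delta> where "\<Delta> s = g (y(l := s)) - g y" for s
  have evY: "\<forall>\<^sub>F s in at (y l). y(l := s) \<in> Y"
    using eventually_line_in_open[OF Y y l] by (simp add: eventually_nhds_conv_at)
  have cont: "(\<Delta> \<longlongrightarrow> 0) (at (y l))"
  proof (rule tendstoI)
    fix e :: real assume "e > 0"
    then obtain d where d: "d > 0" "\<And>z. z\<in>Y \<Longrightarrow> (\<forall>i<m. \<bar>z i - y i\<bar> < d) \<Longrightarrow> \<bar>g z - g y\<bar> < e"
      using g y unfolding continuous_on_Rn_box[OF openin_Rn_subset[OF Y]] by blast
    have "\<forall>\<^sub>F s in at (y l). dist s (y l) < d" unfolding eventually_at using d(1) by blast
    with evY show "\<forall>\<^sub>F s in at (y l). dist (\<Delta> s) 0 < e"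
    proof eventually_elim
      case (elim s)
      then have "\<bar>g (y(l := s)) - g y\<bar> < e" using d(1) by (intro d(2)) (auto simp: dist_real_def)
      then show ?case by (simp add: \<Delta>_def)
    qed
  qed
  have key: "\<forall>\<^sub>F s in at (y l). \<bar>a * (s - y l) + b * \<Delta> s\<bar> \<le> e * (\<bar>s - y l\<bar> + \<bar>\<Delta> s\<bar>)" if e: "e > 0" for e
  proof -
    have "x \<in> \<Omega>" using on[OF y] by (simp add: x_def)
    from total_differentiability[OF \<Omega> G this e] obtain d where d: "d > 0"
      "\<And>z. z \<in> Rn (Suc m) \<Longrightarrow> (\<forall>j<Suc m. \<bar>z j - x j\<bar> < d) \<Longrightarrow>
         \<bar>G z - G x - (\<Sum>j<Suc m. partial_deriv j G x * (z j - x j))\<bar> \<le> e * (\<Sum>j<Suc m. \<bar>z j - x j\<bar>)" by blast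
    have "\<forall>\<^sub>F s in at (y l). dist s (y l) < d" unfolding eventually_at using d(1) by blast
    with evY tendstoD[OF cont d(1)] show ?thesis
    proof eventually_elim
      case (elim s)
      define z where "z = ins i (y(l := s)) (g (y(l := s)))"
      have diff: "z j - x j = (if j = l' then s - y l else 0) + (if j = i then \<Delta> s else 0)" for j
        using l i by (auto simp: z_def x_def ins_def l'_def \<Delta>_def)
      have zR: "z \<in> Rn (Suc m)" unfolding z_def by (intro ins_in_Rn Rn_upd yR l i)
      have "\<bar>z j - x j\<bar> < d" for j unfolding diff using l' d(1) elim by (auto simp: dist_real_def)
      with d(2)[OF zR] have "\<bar>G z - G x - (\<Sum>j<Suc m. partial_deriv j G x * (z j - x j))\<bar> \<le> e * (\<Sum>j<Suc m. \<bar>z j - x j\<bar>)" by blast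
      moreover have "G z = 0" "G x = 0" using on elim(1) on[OF y] by (auto simp: z_def x_def)
      moreover have "(\<Sum>j<Suc m. partial_deriv j G x * (z j - x j)) = a * (s - y l) + b * \<Delta> s"
        unfolding diff distrib_left sum.distrib a_def b_def using l' i by (simp del: sum.lessThan_Suc add: if_distrib[of "\<lambda>t. _ * t"] cong: if_cong)
      moreover have "(\<Sum>j<Suc m. \<bar>z j - x j\<bar>) = \<bar>s - y l\<bar> + \<bar>\<Delta> s\<bar>"
      proof -
        have "\<bar>z j - x j\<bar> = (if j = l' then \<bar>s - y l\<bar> else 0) + (if j = i then \<bar>\<Delta> s\<bar> else 0)" for j
          unfolding diff using l' by auto
        then show ?thesis using l' i by (simp del: sum.lessThan_Suc add: sum.distrib)
      qed
      ultimately show ?case by simp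
    qed
  qed
  have "((\<lambda>s. (g (y(l := s)) - g (y(l := y l))) / (s - y l)) \<longlongrightarrow> - (a * inverse b)) (at (y l))"
  proof (rule tendstoI)
    fix e :: real assume e: "e > 0"
    \<comment> \<open>The first bound absorbs the term \<open>e1 * \<bar>\<Delta> s\<bar>\<close> into \<open>\<bar>b * \<Delta> s\<bar>\<close>; the second makes the final error less than \<open>e\<close>.\<close>
    define e1 where "e1 = min (\<bar>b\<bar> / 2) (e * \<bar>b\<bar> / (2 * (1 + C)))"
    have e1: "e1 \<le> \<bar>b\<bar> / 2" "e1 \<le> e * \<bar>b\<bar> / (2 * (1 + C))"
      unfolding e1_def by (rule min.cobounded1, rule min.cobounded2)
    have e1p: "e1 > 0" using e b C by (auto simp: e1_def)
    have "\<forall>\<^sub>F s in at (y l). s \<noteq> y l" by (simp add: eventually_at_filter)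
    with key[OF e1p] show "\<forall>\<^sub>F s in at (y l). dist ((g (y(l := s)) - g (y(l := y l))) / (s - y l)) (- (a * inverse b)) < e"
    proof eventually_elim
      case (elim s)
      let ?h = "\<bar>s - y l\<bar>"
      have h: "?h > 0" using elim by simp
      have "\<bar>b\<bar> * \<bar>\<Delta> s\<bar> \<le> \<bar>a * (s - y l) + b * \<Delta> s\<bar> + \<bar>a\<bar> * ?h"
        unfolding abs_mult[symmetric] by linarith
      also have "\<dots> \<le> e1 * (?h + \<bar>\<Delta> s\<bar>) + \<bar>a\<bar> * ?h" using elim(1) by simp
      also have "\<dots> \<le> \<bar>b\<bar> / 2 * (?h + \<bar>\<Delta> s\<bar>) + \<bar>a\<bar> * ?h" using e1(1) by (intro add_right_mono mult_right_mono) auto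
      finally have "\<bar>b\<bar> * \<bar>\<Delta> s\<bar> \<le> (2 * \<bar>a\<bar> + \<bar>b\<bar>) * ?h" by (simp add: algebra_simps)
      then have D: "\<bar>\<Delta> s\<bar> \<le> C * ?h" using b by (simp add: C_def field_simps)
      have "\<bar>b\<bar> * \<bar>\<Delta> s / (s - y l) + a * inverse b\<bar> * ?h = \<bar>a * (s - y l) + b * \<Delta> s\<bar>"
      proof -
        have "s - y l \<noteq> 0" using h by simp
        then have "b * (\<Delta> s / (s - y l) + a * inverse b) * (s - y l) = a * (s - y l) + b * \<Delta> s"
          using b by (simp add: distrib_left distrib_right)
        then show ?thesis unfolding abs_mult[symmetric] by (rule arg_cong)
      qed
      also have "\<dots> \<le> e1 * (?h + \<bar>\<Delta> s\<bar>)" by (rule elim(1))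
      also have "\<dots> \<le> e1 * ((1 + C) * ?h)" using D e1p by (intro mult_left_mono) (auto simp: algebra_simps)
      also have "\<dots> \<le> e * \<bar>b\<bar> / (2 * (1 + C)) * ((1 + C) * ?h)" using e1(2) C by (intro mult_right_mono) auto
      also have "\<dots> = e * \<bar>b\<bar> / 2 * ?h" using C by (simp add: field_simps)
      also have "\<dots> < e * \<bar>b\<bar> * ?h" using e b h by simp
      finally have "\<bar>b\<bar> * \<bar>\<Delta> s / (s - y l) + a * inverse b\<bar> * ?h < \<bar>b\<bar> * e * ?h" by (simp add: mult_ac)
      then have "\<bar>\<Delta> s / (s - y l) + a * inverse b\<bar> < e" using h b by simp
      then show ?case by (simp add: dist_real_def \<Delta>_def)
    qed
  qed
  then have "has_partial g l (- (a * inverse b)) y" unfolding has_partial_def has_field_derivative_iff .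
  then show ?thesis unfolding a_def b_def x_def l'_def .
qed

text \<open>The formula for the derivatives of \<open>g\<close> involves \<open>g\<close> only inside smooth functions, so each degree of differentiability
  yields the next.\<close>

lemma implicit_smooth:
  assumes \<Omega>: "openin (Euclidean_space (Suc m)) \<Omega>" and G: "\<And>k. Ck_on k (Suc m) \<Omega> G" and i: "i \<le> m"
    and Y: "openin (Euclidean_space m) Y" and g: "continuous_on Y g"
    and on: "\<And>y. y \<in> Y \<Longrightarrow> ins i y (g y) \<in> \<Omega> \<and> G (ins i y (g y)) = 0 \<and> partial_deriv i G (ins i y (g y)) \<noteq> 0"
  shows "Ck_on k m Y g"
proof (induction k)
  case 0 then show ?case using g by simp
next
  case (Suc k)
  have pd: "Ck_on k m Y (\<lambda>y. partial_deriv j G (ins i y (g y)))" if "j < Suc m" for j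
  proof (rule Ck_on_compose[where W = \<Omega> and m = "Suc m" and h = "partial_deriv j G" and g = "\<lambda>y. ins i y (g y)"])
    show "Ck_on k (Suc m) \<Omega> (partial_deriv j G)" by (rule Ck_on_partial[OF G that])
    show "Ck_on k m Y (\<lambda>y. ins i y (g y) j)" for j by (rule Ck_on_ins[OF Y Suc.IH])
  qed (use on \<Omega> Y in auto)
  show ?case
  proof (rule Ck_on_SucI[OF Y g])
    fix l x assume "l < m" "x \<in> Y"
    then show "has_partial g l (- (partial_deriv (if l < i then l else Suc l) G (ins i x (g x))
            * inverse (partial_deriv i G (ins i x (g x))))) x"
      using on by (intro implicit_has_partial[OF \<Omega> G i Y g]) auto
  next
    fix l assume "l < m"
    then show "Ck_on k m Y (\<lambda>x. - (partial_deriv (if l < i then l else Suc l) G (ins i x (g x))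
            * inverse (partial_deriv i G (ins i x (g x)))))"
      using on i by (intro Ck_on_minus Ck_on_mult Ck_on_inverse Y pd) auto
  qed
qed

text \<open>Near the given point \<open>G\<close> is strictly increasing in the coordinate \<open>i\<close>. The intermediate value theorem gives the
  zero, monotonicity its uniqueness, and persistence of the signs on both sides its continuity.\<close>

lemma implicit_function_pos:
  assumes \<Omega>: "openin (Euclidean_space (Suc m)) \<Omega>" and G: "\<And>k. Ck_on k (Suc m) \<Omega> G" and i: "i \<le> m"
    and y0: "y0 \<in> Rn m" "ins i y0 t0 \<in> \<Omega>" "G (ins i y0 t0) = 0" "partial_deriv i G (ins i y0 t0) > 0"
  shows "\<exists>Y e g. openin (Euclidean_space m) Y \<and> y0 \<in> Y \<and> e > 0 \<and> (\<forall>k. Ck_on k m Y g) \<and>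
    (\<forall>y\<in>Y. \<bar>g y - t0\<bar> < e \<and> (\<forall>t. \<bar>t - t0\<bar> < e \<longrightarrow> ins i y t \<in> \<Omega> \<and> (G (ins i y t) = 0 \<longleftrightarrow> t = g y)))"
proof -
  let ?x0 = "ins i y0 t0"
  have G1: "Ck_on (Suc 0) (Suc m) \<Omega> G" by (rule G)
  have iS: "i < Suc m" using i by simp
  obtain d1 where d1: "d1 > 0" "\<And>x. x \<in> Rn (Suc m) \<Longrightarrow> (\<forall>j<Suc m. \<bar>x j - ?x0 j\<bar> < d1) \<Longrightarrow> x \<in> \<Omega>"
    using \<Omega> y0(2) unfolding openin_Rn_box by blast
  have "continuous_on \<Omega> (partial_deriv i G)" using Ck_on_continuous[OF Ck_on_partial[OF G1 iS]] .
  then obtain d2 where d2: "d2 > 0" "\<And>x. x \<in> \<Omega> \<Longrightarrow> (\<forall>j<Suc m. \<bar>x j - ?x0 j\<bar> < d2) \<Longrightarrow>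
      \<bar>partial_deriv i G x - partial_deriv i G ?x0\<bar> < partial_deriv i G ?x0"
    by (rule continuous_on_RnD[OF _ openin_Rn_subset[OF \<Omega>] y0(2,4)]) blast
  define d where "d = min d1 d2"
  have d: "d > 0" "d \<le> d1" "d \<le> d2" using d1 d2 by (auto simp: d_def)
  have near: "ins i y t \<in> \<Omega>" "partial_deriv i G (ins i y t) > 0"
    if "y \<in> Rn m" "\<forall>j<m. \<bar>y j - y0 j\<bar> < d" "\<bar>t - t0\<bar> < d" for y t
  proof -
    have "\<forall>j<Suc m. \<bar>ins i y t j - ?x0 j\<bar> < d" using that i by (auto simp: ins_def)
    then have *: "\<forall>j<Suc m. \<bar>ins i y t j - ?x0 j\<bar> < d1" "\<forall>j<Suc m. \<bar>ins i y t j - ?x0 j\<bar> < d2"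
      using d by fastforce+
    show o: "ins i y t \<in> \<Omega>" by (rule d1(2)[OF ins_in_Rn[OF that(1) i] *(1)])
    show "partial_deriv i G (ins i y t) > 0" using d2(2)[OF o *(2)] by linarith
  qed
  define e where "e = d / 2"
  have e: "e > 0" "e < d" using d by (auto simp: e_def)
  have dG: "((\<lambda>t. G (ins i y t)) has_real_derivative partial_deriv i G (ins i y t)) (at t)"
    if "y \<in> Rn m" "\<forall>j<m. \<bar>y j - y0 j\<bar> < d" "\<bar>t - t0\<bar> < d" for y t
    using Ck_on_has_partial[OF G1 iS near(1)[OF that]] by (simp add: has_partial_def)
  have incr: "G (ins i y s) < G (ins i y t)"
    if "y \<in> Rn m" "\<forall>j<m. \<bar>y j - y0 j\<bar> < d" "s < t" "\<bar>s - t0\<bar> < d" "\<bar>t - t0\<bar> < d" for y s t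
  proof (rule DERIV_pos_imp_increasing[OF that(3), of "\<lambda>t. G (ins i y t)"])
    fix r assume "s \<le> r" "r \<le> t"
    then have "\<bar>r - t0\<bar> < d" using that by auto
    then show "\<exists>D. ((\<lambda>t. G (ins i y t)) has_real_derivative D) (at r) \<and> 0 < D" using dG near(2) that(1,2) by blast
  qed
  define Y0 where "Y0 = {y \<in> Rn m. \<forall>j<m. \<bar>y j - y0 j\<bar> < d}"
  have Y0: "openin (Euclidean_space m) Y0"
    using open_coordinate_box[of m y0 d] unfolding Y0_def openin_Rn_iff by (intro exI[of _ "{y. \<forall>j<m. \<bar>y j - y0 j\<bar> < d}"]) auto
  have contG: "continuous_on Y0 (\<lambda>y. G (ins i y t))" if "\<bar>t - t0\<bar> < d" for t
  proof (rule continuous_on_compose2[where f = "\<lambda>y. ins i y t" and g = G])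
    show "continuous_on \<Omega> G" using Ck_on_continuous[OF G1] .
    show "(\<lambda>y. ins i y t) ` Y0 \<subseteq> \<Omega>" using near(1) that by (auto simp: Y0_def)
    have "continuous_on Y0 (\<lambda>y. ins i y t j)" for j
      by (rule Ck_on_continuous[OF Ck_on_ins[OF Y0 Ck_on_const[OF Y0]]])
    then show "continuous_on Y0 (\<lambda>y. ins i y t)"
      using i by (intro continuous_on_into_fun[where m = "Suc m"]) (auto simp: Y0_def intro!: ins_in_Rn)
  qed
  have persist: "\<exists>d'>0. \<forall>y\<in>Y0. (\<forall>j<m. \<bar>y j - y1 j\<bar> < d') \<longrightarrow> G (ins i y r) < 0 \<and> 0 < G (ins i y s)"
    if H: "y1 \<in> Y0" "\<bar>r - t0\<bar> < d" "\<bar>s - t0\<bar> < d" "G (ins i y1 r) < 0" "0 < G (ins i y1 s)" for y1 r s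
  proof -
    have sub: "Y0 \<subseteq> Rn m" by (auto simp: Y0_def)
    obtain a where a: "a > 0" "\<And>y. y\<in>Y0 \<Longrightarrow> (\<forall>j<m. \<bar>y j - y1 j\<bar> < a) \<Longrightarrow> \<bar>G (ins i y r) - G (ins i y1 r)\<bar> < - G (ins i y1 r)"
      by (rule continuous_on_RnD[OF contG[OF H(2)] sub H(1), of "- G (ins i y1 r)"]) (use H(4) in \<open>simp, blast\<close>)
    obtain b where b: "b > 0" "\<And>y. y\<in>Y0 \<Longrightarrow> (\<forall>j<m. \<bar>y j - y1 j\<bar> < b) \<Longrightarrow> \<bar>G (ins i y s) - G (ins i y1 s)\<bar> < G (ins i y1 s)"
      by (rule continuous_on_RnD[OF contG[OF H(3)] sub H(1,5)]) blast
    show ?thesis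
    proof (intro exI[of _ "min a b"] conjI ballI impI)
      fix y assume y: "y \<in> Y0" "\<forall>j<m. \<bar>y j - y1 j\<bar> < min a b"
      show "G (ins i y r) < 0" using a(2)[OF y(1)] y(2) by fastforce
      show "0 < G (ins i y s)" using b(2)[OF y(1)] y(2) by fastforce
    qed (use a b in auto)
  qed
  have y0Y: "y0 \<in> Y0" using y0 d by (auto simp: Y0_def)
  have "G (ins i y0 (t0 - e)) < 0" "0 < G (ins i y0 (t0 + e))"
    using incr[of y0 "t0 - e" t0] incr[of y0 t0 "t0 + e"] y0 d e by auto
  with persist[OF y0Y, of "t0 - e" "t0 + e"] e obtain d' where d': "d' > 0"
    "\<And>y. y\<in>Y0 \<Longrightarrow> (\<forall>j<m. \<bar>y j - y0 j\<bar> < d') \<Longrightarrow> G (ins i y (t0 - e)) < 0 \<and> 0 < G (ins i y (t0 + e))" by auto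
  define Y where "Y = {y \<in> Rn m. \<forall>j<m. \<bar>y j - y0 j\<bar> < min d d'}"
  have Y: "openin (Euclidean_space m) Y"
    using open_coordinate_box[of m y0 "min d d'"] unfolding Y_def openin_Rn_iff by (intro exI[of _ "{y. \<forall>j<m. \<bar>y j - y0 j\<bar> < min d d'}"]) auto
  have YY0: "y \<in> Y0" "y \<in> Rn m" "\<forall>j<m. \<bar>y j - y0 j\<bar> < d" "G (ins i y (t0 - e)) < 0" "0 < G (ins i y (t0 + e))" if "y \<in> Y" for y
    using that d'(2)[of y] by (auto simp: Y_def Y0_def)
  have "\<exists>t. \<bar>t - t0\<bar> < e \<and> G (ins i y t) = 0" if y: "y \<in> Y" for y
  proof -
    have "\<exists>t\<ge>t0 - e. t \<le> t0 + e \<and> G (ins i y t) = 0"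
    proof (rule IVT')
      show "continuous_on {t0 - e..t0 + e} (\<lambda>t. G (ins i y t))"
      proof (rule DERIV_atLeastAtMost_imp_continuous_on)
        fix t assume "t0 - e \<le> t" "t \<le> t0 + e"
        then have "\<bar>t - t0\<bar> < d" using e by auto
        then show "\<exists>D. ((\<lambda>t. G (ins i y t)) has_real_derivative D) (at t)" using dG YY0[OF y] by blast
      qed
    qed (use YY0[OF y] e in auto)
    then obtain t where t: "t0 - e \<le> t" "t \<le> t0 + e" "G (ins i y t) = 0" by blast
    moreover have "t \<noteq> t0 - e" "t \<noteq> t0 + e" using t(3) YY0[OF y] by auto
    ultimately show ?thesis by (intro exI[of _ t]) auto
  qed
  then obtain g where g: "\<And>y. y \<in> Y \<Longrightarrow> \<bar>g y - t0\<bar> < e" "\<And>y. y \<in> Y \<Longrightarrow> G (ins i y (g y)) = 0" by metis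
  have lt: "\<bar>t - t0\<bar> < d" if "\<bar>t - t0\<bar> < e" for t using that e by simp
  have uniq: "t = g y" if "y \<in> Y" "\<bar>t - t0\<bar> < e" "G (ins i y t) = 0" for y t
    using incr[OF YY0(2,3)[OF that(1)], of t "g y"] incr[OF YY0(2,3)[OF that(1)], of "g y" t] lt[OF that(2)] lt[OF g(1)[OF that(1)]] g(2)[OF that(1)] that(3)
    by (cases t "g y" rule: linorder_cases) auto
  have contg: "continuous_on Y g"
    unfolding continuous_on_Rn_box[OF openin_Rn_subset[OF Y]]
  proof (intro ballI allI impI)
    fix y1 \<epsilon> assume y1: "y1 \<in> Y" and eps: "(\<epsilon>::real) > 0"
    define r where "r = max (g y1 - \<epsilon>) (t0 - e)"
    define s where "s = min (g y1 + \<epsilon>) (t0 + e)"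
    have rs: "r < g y1" "g y1 < s" "\<bar>r - t0\<bar> < d" "\<bar>s - t0\<bar> < d" "t0 - e \<le> r" "s \<le> t0 + e"
      using eps g(1)[OF y1] e by (auto simp: r_def s_def)
    have "G (ins i y1 r) < 0" "0 < G (ins i y1 s)"
      using incr[OF YY0(2,3)[OF y1] rs(1) rs(3)] incr[OF YY0(2,3)[OF y1] rs(2) _ rs(4)] lt[OF g(1)[OF y1]] g(2)[OF y1] by auto
    from persist[OF YY0(1)[OF y1] rs(3,4) this] obtain a where a: "a > 0"
      "\<And>y. y\<in>Y0 \<Longrightarrow> (\<forall>j<m. \<bar>y j - y1 j\<bar> < a) \<Longrightarrow> G (ins i y r) < 0 \<and> 0 < G (ins i y s)" by blast
    show "\<exists>d>0. \<forall>y\<in>Y. (\<forall>i<m. \<bar>y i - y1 i\<bar> < d) \<longrightarrow> \<bar>g y - g y1\<bar> < \<epsilon>"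
    proof (intro exI[of _ a] conjI ballI impI a(1))
      fix y assume y: "y \<in> Y" "\<forall>i<m. \<bar>y i - y1 i\<bar> < a"
      have gd: "\<bar>g y - t0\<bar> < d" by (rule lt[OF g(1)[OF y(1)]])
      have "r < g y"
      proof (rule ccontr)
        assume "\<not> r < g y"
        then have "G (ins i y (g y)) \<le> G (ins i y r)" using incr[OF YY0(2,3)[OF y(1)] _ gd rs(3)] by (cases "g y = r") auto
        then show False using a(2)[OF YY0(1)[OF y(1)] y(2)] g(2)[OF y(1)] by simp
      qed
      moreover have "g y < s"
      proof (rule ccontr)
        assume "\<not> g y < s"
        then have "G (ins i y s) \<le> G (ins i y (g y))" using incr[OF YY0(2,3)[OF y(1)] _ rs(4) gd] by (cases "g y = s") auto
        then show False using a(2)[OF YY0(1)[OF y(1)] y(2)] g(2)[OF y(1)] by simp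
      qed
      ultimately show "\<bar>g y - g y1\<bar> < \<epsilon>" by (auto simp: r_def s_def)
    qed
  qed
  have "Ck_on k m Y g" for k
    using near YY0 g lt by (intro implicit_smooth[OF \<Omega> G i Y contg]) (auto simp: less_imp_neq[symmetric])
  moreover have "y0 \<in> Y" using y0 d d' by (auto simp: Y_def)
  moreover have "ins i y t \<in> \<Omega> \<and> (G (ins i y t) = 0 \<longleftrightarrow> t = g y)" if "y \<in> Y" "\<bar>t - t0\<bar> < e" for y t
    using near(1)[OF YY0(2,3)[OF that(1)] lt[OF that(2)]] uniq[OF that] g(2)[OF that(1)] by blast
  ultimately show ?thesis
    using Y e(1) g(1) by (intro exI[of _ Y] exI[of _ e] exI[of _ g] conjI ballI allI impI) simp_all
qed

lemma implicit_function:
  assumes \<Omega>: "openin (Euclidean_space (Suc m)) \<Omega>" and G: "\<And>k. Ck_on k (Suc m) \<Omega> G" and i: "i \<le> m"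
    and y0: "y0 \<in> Rn m" "ins i y0 t0 \<in> \<Omega>" "G (ins i y0 t0) = 0" "partial_deriv i G (ins i y0 t0) \<noteq> 0"
  shows "\<exists>Y e g. openin (Euclidean_space m) Y \<and> y0 \<in> Y \<and> e > 0 \<and> (\<forall>k. Ck_on k m Y g) \<and>
    (\<forall>y\<in>Y. \<bar>g y - t0\<bar> < e \<and> (\<forall>t. \<bar>t - t0\<bar> < e \<longrightarrow> ins i y t \<in> \<Omega> \<and> (G (ins i y t) = 0 \<longleftrightarrow> t = g y)))"
proof (cases "partial_deriv i G (ins i y0 t0) > 0")
  case True
  show ?thesis by (rule implicit_function_pos[OF \<Omega> G i y0(1,2,3) True])
next
  case False
  have "has_partial G i (partial_deriv i G (ins i y0 t0)) (ins i y0 t0)"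
    using Ck_on_has_partial[OF G _ y0(2)] i by simp
  then have "has_partial (\<lambda>x. - G x) i (- partial_deriv i G (ins i y0 t0)) (ins i y0 t0)"
    unfolding has_partial_def by (rule DERIV_minus)
  then have "partial_deriv i (\<lambda>x. - G x) (ins i y0 t0) = - partial_deriv i G (ins i y0 t0)" by (rule partial_deriv_eqI)
  then have "partial_deriv i (\<lambda>x. - G x) (ins i y0 t0) > 0" using False y0(4) by simp
  from implicit_function_pos[OF \<Omega> Ck_on_minus[OF \<Omega> G] i y0(1,2) _ this] y0(3)
  show ?thesis by simp
qed

section \<open>Transport between the levels of a function\<close>

lemma Ck_on_compose_proj: "Ck_on k m (Rn m) h \<Longrightarrow> Ck_on k n (Rn n) (\<lambda>z. h (proj m z))"
  by (rule Ck_on_compose[where W = "Rn m" and m = m and g = "proj m" and h = h]) (auto intro: Ck_on_proj)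

lemma Euclidean_space_eq: "Euclidean_space n = top_of_set (Rn n)"
  by (metis Euclidean_space_def Rn_def euclidean_product_topology subtopology_topspace subtopology_subtopology topspace_Euclidean_space Rn_iff Collect_cong mem_Collect_eq)

definition grad_sq :: "nat \<Rightarrow> ((nat \<Rightarrow> real) \<Rightarrow> real) \<Rightarrow> (nat \<Rightarrow> real) \<Rightarrow> real"
  where "grad_sq n f x = (\<Sum>i<n. (partial_deriv i f x)\<^sup>2)"

definition grad_l1 :: "nat \<Rightarrow> ((nat \<Rightarrow> real) \<Rightarrow> real) \<Rightarrow> (nat \<Rightarrow> real) \<Rightarrow> real"
  where "grad_l1 n f x = (\<Sum>i<n. \<bar>partial_deriv i f x\<bar>)"

text \<open>The damping makes the field bounded on the whole space, also where \<open>f\<close> is not in the range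
  of interest, without changing its direction.\<close>

definition damped_gradient :: "nat \<Rightarrow> ((nat \<Rightarrow> real) \<Rightarrow> real) \<Rightarrow> (nat \<Rightarrow> real) \<Rightarrow> nat \<Rightarrow> real"
  where "damped_gradient n f x i = partial_deriv i f x * inverse (1 + grad_sq n f x)"

lemma grad_sq_nonneg [simp]: "0 \<le> grad_sq n f x"
  by (simp add: grad_sq_def sum_nonneg)

lemma grad_l1_nonneg [simp]: "0 \<le> grad_l1 n f x"
  by (simp add: grad_l1_def sum_nonneg)

lemma grad_l1_square_le: "(grad_l1 n f x)\<^sup>2 \<le> real n * grad_sq n f x"
  using l1_norm_square_le[of n "\<lambda>i. partial_deriv i f x"] by (simp add: l1_norm_def grad_l1_def grad_sq_def)

lemma abs_partial_le_grad_l1: "i < n \<Longrightarrow> \<bar>partial_deriv i f x\<bar> \<le> grad_l1 n f x"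
  unfolding grad_l1_def by (rule member_le_sum) auto

lemma abs_damped_gradient_le: "i < n \<Longrightarrow> \<bar>damped_gradient n f x i\<bar> \<le> 1"
proof -
  assume "i < n"
  then have "(partial_deriv i f x)\<^sup>2 \<le> grad_sq n f x" unfolding grad_sq_def by (intro member_le_sum) auto
  moreover have "2 * \<bar>partial_deriv i f x\<bar> \<le> 1 + (partial_deriv i f x)\<^sup>2"
    using sum_squares_bound[of 1 "\<bar>partial_deriv i f x\<bar>"] by simp
  ultimately have "\<bar>partial_deriv i f x\<bar> \<le> 1 + grad_sq n f x" by linarith
  moreover have "1 + grad_sq n f x > 0" by (simp add: add_pos_nonneg)
  ultimately show ?thesis by (simp add: damped_gradient_def abs_mult inverse_eq_divide)
qed

lemma bounded_field_tame:
  assumes V: "smooth_field m V" and b: "\<And>x j. j < m \<Longrightarrow> \<bar>V x j\<bar> \<le> 1"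
  shows "tame_field m V"
  unfolding tame_field_def
proof (intro conjI V allI)
  fix R T :: real
  show "\<exists>B. \<forall>p\<in>l1_ball m R. \<forall>k t. \<bar>t\<bar> \<le> T \<longrightarrow> l1_norm m (picard m V p k t) \<le> B"
  proof (intro exI[of _ "R + real m * T"] ballI allI impI)
    fix p k t assume p: "p \<in> l1_ball m R" and t: "\<bar>t\<bar> \<le> T"
    then have pR: "p \<in> Rn m" "l1_norm m p \<le> R" by (auto simp: l1_ball_def)
    show "l1_norm m (picard m V p k t) \<le> R + real m * T"
    proof (cases k)
      case 0
      have "0 \<le> real m * T" using t by (intro mult_nonneg_nonneg) auto
      then show ?thesis using 0 pR by simp
    next
      case (Suc l)
      have "l1_norm m (picard m V p (Suc l) t) \<le> l1_norm m (picard m V p (Suc l) 0) + (real m * \<bar>t\<bar> - real m * 0)"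
      proof (rule l1_norm_growth_bound[OF t, where u' = "\<lambda>s. V (picard m V p l s)" and h = "\<lambda>r. real m"])
        show "((\<lambda>s. picard m V p (Suc l) s j) has_real_derivative V (picard m V p l s) j) (at s)" if "j < m" for j s
          by (rule picard_has_derivative[OF V pR(1) that])
        show "l1_norm m (V (picard m V p l s)) \<le> real m" for s
          unfolding l1_norm_def using sum_bounded_above[of "{..<m}" "\<lambda>j. \<bar>V (picard m V p l s) j\<bar>" 1] b by simp
      qed (auto intro!: derivative_eq_intros)
      also have "\<dots> \<le> R + real m * T" using pR t picard_0[OF pR(1), of V "Suc l"] by (simp del: picard.simps(2) add: add_mono mult_left_mono)
      finally show ?thesis unfolding Suc .
    qed
  qed
qed

lemma tame_damped_gradient:
  assumes f: "\<And>k. Ck_on k n (Rn n) f"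
  shows "tame_field n (damped_gradient n f)"
proof (rule bounded_field_tame)
  have pd: "Ck_on k n (Rn n) (partial_deriv i f)" if "i < n" for i k by (rule Ck_on_partial[OF f that])
  show "smooth_field n (damped_gradient n f)"
    unfolding smooth_field_def
  proof (intro allI impI)
    fix j k assume "j < n"
    have "Ck_on k n (Rn n) (\<lambda>x. grad_sq n f x)"
      unfolding grad_sq_def power2_eq_square by (intro Ck_on_sum Ck_on_mult openin_Rn_UNIV pd) auto
    then have "Ck_on k n (Rn n) (\<lambda>x. inverse (1 + grad_sq n f x))"
      by (intro Ck_on_inverse Ck_on_add Ck_on_const openin_Rn_UNIV) (auto simp: add_pos_nonneg pos_add_strict intro!: less_imp_neq[THEN not_sym])
    then show "Ck_on k n (Rn n) (\<lambda>x. damped_gradient n f x j)"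
      unfolding damped_gradient_def using \<open>j < n\<close> by (intro Ck_on_mult openin_Rn_UNIV pd)
  qed
qed (rule abs_damped_gradient_le)

abbreviation climb :: "nat \<Rightarrow> ((nat \<Rightarrow> real) \<Rightarrow> real) \<Rightarrow> real \<Rightarrow> (nat \<Rightarrow> real) \<Rightarrow> nat \<Rightarrow> real"
  where "climb n f \<equiv> flow n (damped_gradient n f)"

definition speed :: "nat \<Rightarrow> ((nat \<Rightarrow> real) \<Rightarrow> real) \<Rightarrow> (nat \<Rightarrow> real) \<Rightarrow> real"
  where "speed n f x = grad_sq n f x * inverse (1 + grad_sq n f x)"

lemma speed_nonneg [simp]: "0 \<le> speed n f x"
  by (simp add: speed_def)

lemma climb_level_derivative:
  assumes f: "\<And>k. Ck_on k n (Rn n) f" and p: "p \<in> Rn n"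
  shows "((\<lambda>t. f (climb n f t p)) has_real_derivative speed n f (climb n f t p)) (at t)"
proof -
  have "((\<lambda>t. f (climb n f t p)) has_real_derivative
      (\<Sum>j<n. partial_deriv j f (climb n f t p) * damped_gradient n f (climb n f t p) j)) (at t)"
    using flow_has_derivative[OF tame_damped_gradient[OF f] p]
    by (intro chain_rule_curve[OF openin_Rn_UNIV f]) auto
  also have "(\<Sum>j<n. partial_deriv j f (climb n f t p) * damped_gradient n f (climb n f t p) j) = speed n f (climb n f t p)"
    by (simp add: damped_gradient_def speed_def grad_sq_def[of n f "climb n f t p"] sum_distrib_right power2_eq_square mult_ac
        del: grad_sq_nonneg)
  finally show ?thesis .
qed

text \<open>The logarithm of \<open>Q\<close> grows at most as fast as \<open>C * u\<close>; so if \<open>u\<close> stayed below the level \<open>v\<close>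
  forever, then \<open>Q\<close> would be bounded, and \<open>u\<close> would grow at a rate bounded away from \<open>0\<close>.\<close>

lemma reaches_level:
  fixes u Q :: "real \<Rightarrow> real"
  assumes u: "\<And>t. t \<ge> 0 \<Longrightarrow> (u has_real_derivative u' t) (at t)" "\<And>t. t \<ge> 0 \<Longrightarrow> u' t \<ge> 0"
    and Q: "\<And>t. t \<ge> 0 \<Longrightarrow> (Q has_real_derivative Q' t) (at t)" "\<And>t. Q t \<ge> 1"
    and QC: "\<And>t. t \<ge> 0 \<Longrightarrow> u 0 \<le> u t \<Longrightarrow> u t \<le> v \<Longrightarrow> Q' t \<le> C * Q t * u' t" and C: "C \<ge> 0"
    and fast: "\<And>M. \<exists>l>0. \<forall>t\<ge>0. u 0 \<le> u t \<longrightarrow> u t \<le> v \<longrightarrow> Q t \<le> M \<longrightarrow> l \<le> u' t"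
  shows "\<exists>t\<ge>0. u t \<ge> v"
proof (rule ccontr)
  assume "\<not> ?thesis"
  then have below: "u t < v" if "t \<ge> 0" for t using that by force
  have mono: "u 0 \<le> u t" if "t \<ge> 0" for t
    using u by (intro DERIV_nonneg_imp_nondecreasing[OF that, of u]) blast
  define M where "M = Q 0 * exp (C * (v - u 0))"
  have "Q t \<le> M" if t: "t \<ge> 0" for t
  proof -
    have "C * u 0 - ln (Q 0) \<le> C * u t - ln (Q t)"
    proof (rule DERIV_nonneg_imp_nondecreasing[OF t, of "\<lambda>t. C * u t - ln (Q t)"])
      fix s assume "0 \<le> s" "s \<le> t"
      have Qp: "Q s > 0" using Q(2)[of s] by simp
      have "((\<lambda>t. C * u t - ln (Q t)) has_real_derivative C * u' s - inverse (Q s) * Q' s) (at s)"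
        using u(1)[OF \<open>0 \<le> s\<close>] Q(1)[OF \<open>0 \<le> s\<close>] Qp
        by (intro DERIV_diff DERIV_cmult DERIV_chain2[OF DERIV_ln]) auto
      moreover have "inverse (Q s) * Q' s \<le> C * u' s"
        using QC[OF \<open>0 \<le> s\<close> mono[OF \<open>0 \<le> s\<close>] less_imp_le[OF below[OF \<open>0 \<le> s\<close>]]] Qp by (simp add: field_simps)
      ultimately show "\<exists>y. ((\<lambda>t. C * u t - ln (Q t)) has_real_derivative y) (at s) \<and> 0 \<le> y" by force
    qed
    then have "ln (Q t) \<le> ln (Q 0) + C * (u t - u 0)" by (simp add: right_diff_distrib)
    also have "\<dots> \<le> ln (Q 0) + C * (v - u 0)" using below[OF t] C by (intro add_left_mono mult_left_mono) auto
    finally have "exp (ln (Q t)) \<le> exp (ln (Q 0) + C * (v - u 0))" by simp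
    then show ?thesis using Q(2)[of t] Q(2)[of 0] by (simp add: exp_add M_def)
  qed
  with fast[of M] mono below obtain l where l: "l > 0" "\<And>t. t \<ge> 0 \<Longrightarrow> l \<le> u' t" by (meson less_imp_le)
  define t where "t = (v - u 0) / l"
  have t: "t \<ge> 0" using l(1) below[of 0] by (simp add: t_def)
  have "u 0 - l * 0 \<le> u t - l * t"
  proof (rule DERIV_nonneg_imp_nondecreasing[OF t, of "\<lambda>t. u t - l * t"])
    fix s assume "0 \<le> s" "s \<le> t"
    have "((\<lambda>t. u t - l * t) has_real_derivative u' s - l) (at s)"
      by (intro DERIV_diff DERIV_cmult_Id u(1)[OF \<open>0 \<le> s\<close>])
    then show "\<exists>y. ((\<lambda>t. u t - l * t) has_real_derivative y) (at s) \<and> 0 \<le> y" using l(2)[OF \<open>0 \<le> s\<close>] by force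
  qed
  then show False using below[OF t] l(1) by (simp add: t_def)
qed

text \<open>The hypothesis \<open>steep\<close> is the condition of Malgrange. It also excludes critical points over \<open>(a, b)\<close>.\<close>

locale regular_levels =
  fixes n :: nat and f :: "(nat \<Rightarrow> real) \<Rightarrow> real" and a b \<delta> :: real
  assumes f: "\<And>k. Ck_on k n (Rn n) f" and pos: "\<delta> > 0"
    and steep: "\<And>x. x \<in> Rn n \<Longrightarrow> a < f x \<Longrightarrow> f x < b \<Longrightarrow> \<delta> \<le> (1 + l1_norm n x) * grad_l1 n f x"
begin

lemma speed_lower_bound:
  "\<exists>l>0. \<forall>x\<in>Rn n. a < f x \<longrightarrow> f x < b \<longrightarrow> 1 + (\<Sum>i<n. (x i)\<^sup>2) \<le> M \<longrightarrow> l \<le> speed n f x"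
proof -
  define N where "N = 1 + sqrt (real n * \<bar>M\<bar>)"
  have N: "N \<ge> 1" by (simp add: N_def)
  define k where "k = (\<delta> / N)\<^sup>2 / (real n + 1)"
  have k: "k > 0" using pos N by (simp add: k_def)
  have "k / (1 + k) \<le> speed n f x"
    if x: "x \<in> Rn n" "a < f x" "f x < b" "1 + (\<Sum>i<n. (x i)\<^sup>2) \<le> M" for x
  proof -
    have "(l1_norm n x)\<^sup>2 \<le> real n * (\<Sum>i<n. (x i)\<^sup>2)" by (rule l1_norm_square_le)
    also have "\<dots> \<le> real n * \<bar>M\<bar>" using x by (intro mult_left_mono) auto
    finally have "1 + l1_norm n x \<le> N" by (simp add: N_def real_le_rsqrt)
    then have "\<delta> \<le> N * grad_l1 n f x"
      using steep[OF x(1,2,3)] by (meson grad_l1_nonneg mult_right_mono order_trans)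
    then have "\<delta> / N \<le> grad_l1 n f x" using N by (simp add: field_simps)
    then have "(\<delta> / N)\<^sup>2 \<le> (grad_l1 n f x)\<^sup>2" using pos N by (intro power_mono) auto
    also have "\<dots> \<le> (real n + 1) * grad_sq n f x" using grad_l1_square_le[of n f x] by (simp add: distrib_right add_increasing2)
    finally have "k \<le> grad_sq n f x" unfolding k_def by (subst pos_divide_le_eq) (simp_all add: mult.commute)
    then have "k * (1 + grad_sq n f x) \<le> grad_sq n f x * (1 + k)" by (simp add: algebra_simps)
    then have "k * (1 + grad_sq n f x) / (1 + k) \<le> grad_sq n f x" using k by (simp add: pos_divide_le_eq)
    moreover have "1 + grad_sq n f x > 0" by (simp add: add_pos_nonneg)
    ultimately show ?thesis unfolding speed_def inverse_eq_divide by (simp add: pos_le_divide_eq)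
  qed
  then show ?thesis using k by (intro exI[of _ "k / (1 + k)"]) auto
qed

text \<open>The sum on the left is the derivative of \<open>\<Sum>i. (x i)\<^sup>2\<close> along the flow. With \<open>S\<close> the sum of the squared partial derivatives
  and \<open>N = 1 + \<bar>x\<bar>\<close>, it is at most \<open>2 * N * G / (1 + S)\<close>, hence at most \<open>2 * (N * G)\<^sup>2 / (\<delta> * (1 + S))\<close> because \<open>\<delta> \<le> N * G\<close>;
  the constant comes from comparing \<open>N\<^sup>2\<close> and \<open>G\<^sup>2\<close> with sums of squares.\<close>

lemma radial_growth:
  assumes x: "x \<in> Rn n" "a < f x" "f x < b"
  shows "\<bar>\<Sum>i<n. 2 * x i * damped_gradient n f x i\<bar>
    \<le> (4 * real n * (real n + 1) / \<delta>) * (1 + (\<Sum>i<n. (x i)\<^sup>2)) * speed n f x"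
proof -
  define S where "S = grad_sq n f x"
  define G where "G = grad_l1 n f x"
  define N where "N = 1 + l1_norm n x"
  define q where "q = (\<Sum>i<n. (x i)\<^sup>2)"
  have S: "S \<ge> 0" and G: "G \<ge> 0" and N: "N \<ge> 1" and q: "q \<ge> 0" by (auto simp: S_def G_def N_def q_def sum_nonneg)
  have d: "\<delta> \<le> N * G" using steep[OF x] by (simp add: N_def G_def)
  have G2: "G\<^sup>2 \<le> real n * S" unfolding G_def S_def by (rule grad_l1_square_le)
  have "N\<^sup>2 \<le> 2 * (1 + (l1_norm n x)\<^sup>2)" using sum_squares_bound[of 1 "l1_norm n x"] by (simp add: N_def power2_eq_square algebra_simps)
  also have "\<dots> \<le> 2 * (1 + real n * q)" using l1_norm_square_le[of n x] by (simp add: q_def)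
  also have "\<dots> \<le> 2 * ((real n + 1) * (1 + q))" using q by (simp add: algebra_simps)
  finally have N2: "N\<^sup>2 \<le> 2 * ((real n + 1) * (1 + q))" .
  have "\<bar>\<Sum>i<n. 2 * x i * damped_gradient n f x i\<bar> \<le> (\<Sum>i<n. 2 * \<bar>x i\<bar> * (G * inverse (1 + S)))"
  proof (rule order_trans[OF sum_abs sum_mono])
    fix i assume "i \<in> {..<n}"
    then have "\<bar>partial_deriv i f x\<bar> \<le> G" unfolding G_def by (intro abs_partial_le_grad_l1) auto
    then have "\<bar>damped_gradient n f x i\<bar> \<le> G * inverse (1 + S)"
      using S unfolding damped_gradient_def S_def by (simp add: abs_mult mult_right_mono)
    then show "\<bar>2 * x i * damped_gradient n f x i\<bar> \<le> 2 * \<bar>x i\<bar> * (G * inverse (1 + S))"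
      by (simp add: abs_mult mult_left_mono)
  qed
  also have "\<dots> = 2 * l1_norm n x * (G * inverse (1 + S))" by (simp add: l1_norm_def sum_distrib_left sum_distrib_right)
  also have "\<dots> \<le> 2 * N * (G * inverse (1 + S))" using G S by (intro mult_right_mono) (auto simp: N_def)
  also have "\<dots> = 2 * (N * G) * inverse (1 + S)" by simp
  also have "\<dots> \<le> 2 * ((N * G) * ((N * G) / \<delta>)) * inverse (1 + S)"
  proof (intro mult_right_mono mult_left_mono)
    have "1 \<le> N * G / \<delta>" using d pos by simp
    then show "N * G \<le> N * G * (N * G / \<delta>)" using N G mult_left_mono[of 1 "N * G / \<delta>" "N * G"] by simp
  qed (use S in auto)
  also have "\<dots> = 2 / \<delta> * (N\<^sup>2 * G\<^sup>2) * inverse (1 + S)" by (simp add: power2_eq_square)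
  also have "\<dots> \<le> 2 / \<delta> * ((2 * ((real n + 1) * (1 + q))) * (real n * S)) * inverse (1 + S)"
    using pos S q by (intro mult_right_mono mult_left_mono mult_mono N2 G2) auto
  also have "\<dots> = (4 * real n * (real n + 1) / \<delta>) * (1 + q) * (S * inverse (1 + S))" by simp
  finally show ?thesis unfolding q_def S_def speed_def .
qed

lemma reach:
  assumes p: "p \<in> Rn n" "a < f p" "f p < b" and v: "a < v" "v < b" and s: "s = 1 \<or> s = (-1 :: real)"
  shows "\<exists>t\<ge>0. s * f (climb n f (s * t) p) \<ge> s * v"
proof -
  let ?x = "\<lambda>t. climb n f (s * t) p"
  have s2: "s * s = 1" using s by auto
  have ds: "((\<lambda>t. s * t) has_real_derivative s) (at t)" for t by (rule DERIV_cmult_Id)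
  have dx: "((\<lambda>t. ?x t j) has_real_derivative damped_gradient n f (?x t) j * s) (at t)" if "j < n" for j t
    by (rule DERIV_chain2[OF flow_has_derivative[OF tame_damped_gradient[OF f] p(1) that] ds])
  have band: "a < f (?x t)" "f (?x t) < b" if "s * f (?x 0) \<le> s * f (?x t)" "s * f (?x t) \<le> s * v" for t
    using that p v s by auto
  show ?thesis
  proof (rule reaches_level[where u = "\<lambda>t. s * f (?x t)" and u' = "\<lambda>t. speed n f (?x t)" and Q = "\<lambda>t. 1 + (\<Sum>i<n. (?x t i)\<^sup>2)"
        and Q' = "\<lambda>t. \<Sum>i<n. 2 * ?x t i * damped_gradient n f (?x t) i * s" and C = "4 * real n * (real n + 1) / \<delta>"])
    fix t :: real
    have "((\<lambda>t. s * f (?x t)) has_real_derivative s * (speed n f (?x t) * s)) (at t)"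
      by (intro DERIV_cmult DERIV_chain2[OF climb_level_derivative[OF f p(1)] ds])
    then show "((\<lambda>t. s * f (?x t)) has_real_derivative speed n f (?x t)) (at t)" using s by auto
    have "((\<lambda>t. (?x t i)\<^sup>2) has_real_derivative 2 * ?x t i * damped_gradient n f (?x t) i * s) (at t)" if "i < n" for i
      by (rule DERIV_cong[OF DERIV_power[OF dx[OF that], of 2]]) (simp add: mult_ac)
    then have "((\<lambda>t. \<Sum>i<n. (?x t i)\<^sup>2) has_real_derivative (\<Sum>i<n. 2 * ?x t i * damped_gradient n f (?x t) i * s)) (at t)"
      by (intro DERIV_sum) auto
    from DERIV_add[OF DERIV_const[of 1] this]
    show "((\<lambda>t. 1 + (\<Sum>i<n. (?x t i)\<^sup>2)) has_real_derivative (\<Sum>i<n. 2 * ?x t i * damped_gradient n f (?x t) i * s)) (at t)" by simp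
    show "1 \<le> 1 + (\<Sum>i<n. (?x t i)\<^sup>2)" by (simp add: sum_nonneg)
    assume "s * f (?x 0) \<le> s * f (?x t)" "s * f (?x t) \<le> s * v"
    from radial_growth[OF flow_in_Rn band[OF this]]
    show "(\<Sum>i<n. 2 * ?x t i * damped_gradient n f (?x t) i * s) \<le>
       4 * real n * (real n + 1) / \<delta> * (1 + (\<Sum>i<n. (?x t i)\<^sup>2)) * speed n f (?x t)"
      using s by (auto simp: abs_le_iff sum_negf)
  next
    fix M :: real
    obtain l where "l > 0" "\<And>x. x\<in>Rn n \<Longrightarrow> a < f x \<Longrightarrow> f x < b \<Longrightarrow> 1 + (\<Sum>i<n. (x i)\<^sup>2) \<le> M \<Longrightarrow> l \<le> speed n f x"
      using speed_lower_bound[of M] by blast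
    then show "\<exists>l>0. \<forall>t\<ge>0. s * f (?x 0) \<le> s * f (?x t) \<longrightarrow> s * f (?x t) \<le> s * v \<longrightarrow> 1 + (\<Sum>i<n. (?x t i)\<^sup>2) \<le> M \<longrightarrow> l \<le> speed n f (?x t)"
      using band by (intro exI[of _ l]) simp
  qed (use pos in auto)
qed

lemma speed_pos:
  assumes "x \<in> Rn n" "a < f x" "f x < b"
  shows "speed n f x > 0"
  using speed_lower_bound[of "1 + (\<Sum>i<n. (x i)\<^sup>2)"] assms by force

lemma nonzero_partial:
  assumes "x \<in> Rn n" "a < f x" "f x < b"
  shows "\<exists>i<n. partial_deriv i f x \<noteq> 0"
proof (rule ccontr)
  assume "\<not> ?thesis"
  then have "grad_sq n f x = 0" by (simp add: grad_sq_def)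
  then show False using speed_pos[OF assms] by (simp add: speed_def)
qed

lemma hitting_time_exists:
  assumes p: "p \<in> Rn n" "a < f p" "f p < b" and v: "a < v" "v < b"
  shows "\<exists>t. f (climb n f t p) = v"
proof -
  have cont: "continuous_on S (\<lambda>t. f (climb n f t p))" for S
    by (rule DERIV_continuous_on[OF has_field_derivative_at_within[OF climb_level_derivative[OF f p(1)]]])
  obtain s t where st: "s \<ge> 0" "f (climb n f (- s) p) \<le> v" "t \<ge> 0" "f (climb n f t p) \<ge> v"
    using reach[OF p v, of "-1"] reach[OF p v, of 1] by auto
  then show ?thesis using IVT'[of "\<lambda>t. f (climb n f t p)" "- s" v t] cont by force
qed

text \<open>The value of \<open>f\<close> never decreases along a trajectory, and increases strictly where it lies in \<open>(a, b)\<close>.\<close>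

lemma hitting_time_unique:
  assumes p: "p \<in> Rn n" and v: "a < v" "v < b" and "f (climb n f s p) = v" "f (climb n f t p) = v"
  shows "s = t"
proof -
  have False if st: "s < t" "f (climb n f s p) = v" "f (climb n f t p) = v" for s t
  proof -
    have "speed n f (climb n f s p) > 0" using st v by (intro speed_pos) auto
    from DERIV_pos_inc_right[OF climb_level_derivative[OF f p] this]
    obtain d where d: "d > 0" "\<forall>h>0. h < d \<longrightarrow> f (climb n f s p) < f (climb n f (s + h) p)" by blast
    define h where "h = min (d / 2) (t - s)"
    have h: "h > 0" "h < d" "s + h \<le> t" using d(1) st(1) by (auto simp: h_def)
    have "f (climb n f (s + h) p) \<le> f (climb n f t p)"
      using climb_level_derivative[OF f p] speed_nonneg
      by (intro DERIV_nonneg_imp_nondecreasing[OF h(3), of "\<lambda>t. f (climb n f t p)"]) blast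
    then show False using d(2) h st by auto
  qed
  then show ?thesis using assms(4,5) by (metis linorder_less_linear)
qed

definition hit :: "(nat \<Rightarrow> real) \<Rightarrow> real \<Rightarrow> real"
  where "hit p v = (THE t. f (climb n f t p) = v)"

definition transport :: "(nat \<Rightarrow> real) \<Rightarrow> real \<Rightarrow> nat \<Rightarrow> real"
  where "transport p v = climb n f (hit p v) p"

lemma hit_eqI:
  assumes "p \<in> Rn n" "a < v" "v < b" "f (climb n f t p) = v"
  shows "hit p v = t"
  unfolding hit_def
proof (rule the_equality)
  show "s = t" if "f (climb n f s p) = v" for s by (rule hitting_time_unique[OF assms(1-3) that assms(4)])
qed (rule assms(4))

lemma level_hit:
  assumes p: "p \<in> Rn n" "a < f p" "f p < b" and v: "a < v" "v < b"
  shows "f (climb n f (hit p v) p) = v"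
  using hitting_time_exists[OF assms] hit_eqI[OF p(1) v] by metis

lemma transport_in_Rn [simp]: "transport p v \<in> Rn n"
  by (simp add: transport_def)

lemma level_transport:
  assumes "p \<in> Rn n" "a < f p" "f p < b" "a < v" "v < b"
  shows "f (transport p v) = v"
  unfolding transport_def by (rule level_hit[OF assms])

lemma transport_self:
  assumes "p \<in> Rn n" "a < f p" "f p < b"
  shows "transport p (f p) = p"
  using hit_eqI[of p "f p" 0] assms by (simp add: transport_def)

lemma transport_transport:
  assumes p: "p \<in> Rn n" "a < f p" "f p < b" and v: "a < v" "v < b" and w: "a < w" "w < b"
  shows "transport (transport p v) w = transport p w"
proof -
  let ?q = "transport p v"
  have "f (transport ?q w) = w" using level_transport[OF p v] v w by (intro level_transport) auto
  then have "f (climb n f (hit ?q w + hit p v) p) = w"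
    using flow_add[OF tame_damped_gradient[OF f] p(1)] by (simp add: transport_def)
  then have "hit p w = hit ?q w + hit p v" by (rule hit_eqI[OF p(1) w])
  then show ?thesis using flow_add[OF tame_damped_gradient[OF f] p(1)] by (simp add: transport_def)
qed

definition transport_domain :: "(nat \<Rightarrow> real) set"
  where "transport_domain = {z \<in> Rn (Suc n). a < f (proj n z) \<and> f (proj n z) < b \<and> a < z n \<and> z n < b}"

lemma open_transport_domain: "openin (Euclidean_space (Suc n)) transport_domain"
proof -
  have c: "continuous_on (Rn (Suc n)) (\<lambda>z. f (proj n z))"
    by (rule Ck_on_continuous[OF Ck_on_compose_proj[OF f[of 0]]])
  have z: "continuous_on (Rn (Suc n)) (\<lambda>z. z n)" by (rule continuous_on_subset[OF continuous_on_product_coordinates]) simp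
  have "transport_domain = (Rn (Suc n) \<inter> (\<lambda>z. f (proj n z)) -` {a<..<b}) \<inter> (Rn (Suc n) \<inter> (\<lambda>z. z n) -` {a<..<b})"
    by (auto simp: transport_domain_def)
  then show ?thesis
    unfolding Euclidean_space_eq using continuous_openin_preimage_gen[OF c, of "{a<..<b}"] continuous_openin_preimage_gen[OF z, of "{a<..<b}"]
    by (simp add: openin_Int)
qed

text \<open>The hitting time is the zero \<open>t\<close> of \<open>f (climb n f t p) - v\<close>, whose derivative in \<open>t\<close> is the speed, which is positive. A zero
  supplied by the implicit function theorem is the hitting time because that is unique. The coordinates of the arguments are \<open>p\<close>, then \<open>v\<close>, then \<open>t\<close>.\<close>

lemma smooth_hit: "Ck_on k (Suc n) transport_domain (\<lambda>z. hit (proj n z) (z n))"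
proof (rule Ck_on_local[OF open_transport_domain])
  fix z0 assume z0: "z0 \<in> transport_domain"
  define G where "G Z = f (climb n f (Z (Suc n)) (proj n Z)) - Z n" for Z
  let ?R = "Rn (Suc (Suc n))"
  have flowC: "Ck_on k (Suc (Suc n)) ?R (\<lambda>Z. climb n f (Z (Suc n)) (proj n Z) j)" if "j < n" for k j
  proof -
    define g where "g Z = (\<lambda>l. if l < n then Z l else if l = n then Z (Suc n) else 0)" for Z :: "nat \<Rightarrow> real"
    have g: "proj n (g Z) = proj n Z" "g Z n = Z (Suc n)" for Z by (auto simp: g_def proj_def)
    have "Ck_on k (Suc (Suc n)) ?R (\<lambda>Z. climb n f (g Z n) (proj n (g Z)) j)"
    proof (rule Ck_on_compose[where W = "Rn (Suc n)" and m = "Suc n" and g = g and h = "\<lambda>z. climb n f (z n) (proj n z) j"])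
      show "Ck_on k (Suc n) (Rn (Suc n)) (\<lambda>z. climb n f (z n) (proj n z) j)"
        by (rule flow_smooth[OF tame_damped_gradient[OF f] that])
      show "Ck_on k (Suc (Suc n)) ?R (\<lambda>Z. g Z l)" for l
        by (cases "l < n"; cases "l = n") (simp_all add: g_def Ck_on_coord Ck_on_const)
    qed (auto simp: g_def Rn_iff)
    then show ?thesis by (simp add: g)
  qed
  have GC: "Ck_on k (Suc (Suc n)) ?R G" for k
    unfolding G_def
  proof (intro Ck_on_diff Ck_on_coord openin_Rn_UNIV)
    show "Ck_on k (Suc (Suc n)) ?R (\<lambda>Z. f (climb n f (Z (Suc n)) (proj n Z)))"
      by (rule Ck_on_compose[where W = "Rn n" and m = n and h = f]) (use f flowC in auto)
  qed
  have insz: "ins (Suc n) z t n = z n" "proj n (ins (Suc n) z t) = proj n z" for z t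
    by (auto simp: ins_def proj_def)
  have Gins: "G (ins (Suc n) z t) = f (climb n f t (proj n z)) - z n" for z t
    by (simp add: G_def insz)
  have "has_partial G (Suc n) (speed n f (climb n f t (proj n z))) (ins (Suc n) z t)" for z t
    unfolding has_partial_def ins_upd ins_same Gins
    using DERIV_diff[OF climb_level_derivative[OF f proj_in_Rn, of z t] DERIV_const[of "z n"]] by simp
  then have pG: "partial_deriv (Suc n) G (ins (Suc n) z t) = speed n f (climb n f t (proj n z))" for z t
    by (rule partial_deriv_eqI)
  have dom: "proj n z \<in> Rn n" "a < f (proj n z)" "f (proj n z) < b" "a < z n" "z n < b" if "z \<in> transport_domain" for z
    using that by (auto simp: transport_domain_def)
  let ?t0 = "hit (proj n z0) (z0 n)"
  have z0R: "z0 \<in> Rn (Suc n)" using z0 by (simp add: transport_domain_def)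
  have A: "G (ins (Suc n) z0 ?t0) = 0" unfolding Gins level_hit[OF dom[OF z0]] by simp
  have B: "partial_deriv (Suc n) G (ins (Suc n) z0 ?t0) \<noteq> 0"
    unfolding pG using speed_pos[of "climb n f ?t0 (proj n z0)"] level_hit[OF dom[OF z0]] dom[OF z0] by simp
  from implicit_function[OF openin_Rn_UNIV GC le_refl z0R ins_in_Rn[OF z0R le_refl] A B]
  obtain Y e g where Yeg: "openin (Euclidean_space (Suc n)) Y \<and> z0 \<in> Y \<and> e > 0 \<and> (\<forall>k. Ck_on k (Suc n) Y g) \<and>
      (\<forall>y\<in>Y. \<bar>g y - ?t0\<bar> < e \<and> (\<forall>t. \<bar>t - ?t0\<bar> < e \<longrightarrow> ins (Suc n) y t \<in> ?R \<and> (G (ins (Suc n) y t) = 0 \<longleftrightarrow> t = g y)))"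
    by (elim exE) (rule that)
  then have Y: "openin (Euclidean_space (Suc n)) Y" "z0 \<in> Y" "\<And>k. Ck_on k (Suc n) Y g" by simp_all
  have root: "G (ins (Suc n) y (g y)) = 0" if "y \<in> Y" for y
    using Yeg[THEN conjunct2, THEN conjunct2, THEN conjunct2, THEN conjunct2, rule_format, OF that] by simp
  define W where "W = Y \<inter> transport_domain"
  have W: "openin (Euclidean_space (Suc n)) W" unfolding W_def using Y(1) open_transport_domain by (rule openin_Int)
  have "hit (proj n z) (z n) = g z" if "z \<in> W" for z
  proof -
    have "z \<in> Y" "z \<in> transport_domain" using that by (auto simp: W_def)
    then have "G (ins (Suc n) z (g z)) = 0" by (intro root)
    then have "f (climb n f (g z) (proj n z)) = z n" by (simp add: Gins)
    then show ?thesis using dom[OF \<open>z \<in> transport_domain\<close>] by (intro hit_eqI)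
  qed
  then have "Ck_on k (Suc n) W (\<lambda>z. hit (proj n z) (z n))"
    using Ck_on_cong[OF W, of "\<lambda>z. hit (proj n z) (z n)" g k] Ck_on_subset[of k "Suc n" Y g W] Y(3) by (auto simp: W_def)
  then show "\<exists>W. openin (Euclidean_space (Suc n)) W \<and> z0 \<in> W \<and> Ck_on k (Suc n) W (\<lambda>z. hit (proj n z) (z n))"
    using W Y(2) z0 by (intro exI[of _ W]) (auto simp: W_def)
qed

lemma smooth_transport:
  assumes "j < n"
  shows "Ck_on k (Suc n) transport_domain (\<lambda>z. transport (proj n z) (z n) j)"
proof -
  define g where "g z = (\<lambda>l. if l < n then z l else if l = n then hit (proj n z) (z n) else 0)" for z :: "nat \<Rightarrow> real"
  have g: "proj n (g z) = proj n z" "g z n = hit (proj n z) (z n)" for z by (auto simp: g_def proj_def)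
  have "Ck_on k (Suc n) transport_domain (\<lambda>z. climb n f (g z n) (proj n (g z)) j)"
  proof (rule Ck_on_compose[where W = "Rn (Suc n)" and m = "Suc n" and g = g and h = "\<lambda>z. climb n f (z n) (proj n z) j"])
    show "Ck_on k (Suc n) (Rn (Suc n)) (\<lambda>z. climb n f (z n) (proj n z) j)"
      by (rule flow_smooth[OF tame_damped_gradient[OF f] assms])
    show "Ck_on k (Suc n) transport_domain (\<lambda>z. g z l)" for l
      by (cases "l < n"; cases "l = n") (simp_all add: g_def Ck_on_coord Ck_on_const smooth_hit open_transport_domain)
  qed (auto simp: g_def Rn_iff open_transport_domain)
  then show ?thesis by (simp add: g transport_def)
qed

end

section \<open>The trivial fibration\<close>

definition drop_coord :: "nat \<Rightarrow> (nat \<Rightarrow> real) \<Rightarrow> nat \<Rightarrow> real"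
  where "drop_coord i x = (\<lambda>j. if j < i then x j else x (Suc j))"

lemma drop_coord_ins: "drop_coord i (ins i y t) = y"
  by (auto simp: drop_coord_def ins_def fun_eq_iff)

lemma ins_drop_coord: "ins i (drop_coord i x) (x i) = x"
  by (auto simp: drop_coord_def ins_def fun_eq_iff)

lemma drop_coord_in_Rn: "x \<in> Rn n \<Longrightarrow> i < n \<Longrightarrow> drop_coord i x \<in> Rn (n - 1)"
  by (auto simp: drop_coord_def Rn_iff)

lemma drop_coord_nth: "drop_coord i x j = x (if j < i then j else Suc j)"
  by (simp add: drop_coord_def)

lemma continuous_on_drop_coord: "continuous_on S (drop_coord i)"
proof (rule continuous_on_coordinatewise_then_product)
  show "continuous_on S (\<lambda>x. drop_coord i x j)" for j
    unfolding drop_coord_nth by (rule continuous_on_subset[OF continuous_on_product_coordinates]) simp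
qed

lemma second_countable_top_of_set: "second_countable_space (top_of_set (S :: 'a :: second_countable_topology set))"
proof -
  obtain B :: "'a set set" where B: "countable B" "topological_basis B" using ex_countable_basis by blast
  show ?thesis
    unfolding second_countable_space_def
  proof (intro exI[of _ "(\<lambda>b. S \<inter> b) ` B"] conjI ballI allI impI)
    show "openin (top_of_set S) b" if "b \<in> (\<lambda>b. S \<inter> b) ` B" for b
      using that topological_basis_open[OF B(2)] by (auto intro: openin_open_Int)
    fix W x assume "openin (top_of_set S) W \<and> x \<in> W"
    then obtain T where T: "open T" "W = S \<inter> T" "x \<in> T" "x \<in> S" by (auto simp: openin_open)
    then obtain b where "b \<in> B" "x \<in> b" "b \<subseteq> T" using topological_basisE[OF B(2) T(1,3)] by metis
    then show "\<exists>b\<in>(\<lambda>b. S \<inter> b) ` B. x \<in> b \<and> b \<subseteq> W" using T by auto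
  qed (use B(1) in simp)
qed

context regular_levels begin

abbreviation band :: "(nat \<Rightarrow> real) set"
  where "band \<equiv> {x \<in> Rn n. f x \<in> {a<..<b}}"

definition level :: "real \<Rightarrow> (nat \<Rightarrow> real) set"
  where "level c = {x \<in> Rn n. f x = c}"

lemma smooth_transport_compose:
  assumes S: "openin (Euclidean_space N) S"
    and q: "\<And>z. z \<in> S \<Longrightarrow> q z \<in> band" "\<And>l. l < n \<Longrightarrow> Ck_on k N S (\<lambda>z. q z l)"
    and v: "\<And>z. z \<in> S \<Longrightarrow> v z \<in> {a<..<b}" "Ck_on k N S v" and j: "j < n"
  shows "Ck_on k N S (\<lambda>z. transport (q z) (v z) j)"
proof -
  define g where "g z = (\<lambda>l. if l < n then q z l else if l = n then v z else 0)" for z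
  have pg: "proj n (g z) = q z" if "z \<in> S" for z
    using q(1)[OF that] by (auto simp: g_def proj_def Rn_iff fun_eq_iff)
  have "Ck_on k N S (\<lambda>z. transport (proj n (g z)) (g z n) j)"
  proof (rule Ck_on_compose[where W = transport_domain and m = "Suc n" and g = g and h = "\<lambda>z. transport (proj n z) (z n) j"])
    show "g ` S \<subseteq> transport_domain" using pg q(1) v(1) by (auto simp: transport_domain_def) (auto simp: g_def Rn_iff)
    show "Ck_on k N S (\<lambda>z. g z l)" for l
      by (cases "l < n"; cases "l = n") (simp_all add: g_def q v Ck_on_const S)
  qed (use S open_transport_domain smooth_transport[OF j] in auto)
  then show ?thesis
    using Ck_on_cong[OF S, of "\<lambda>z. transport (proj n (g z)) (g z n) j" "\<lambda>z. transport (q z) (v z) j" k] pg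
    by (simp add: g_def)
qed

lemma open_band: "openin (Euclidean_space n) band"
proof -
  have "band = Rn n \<inter> f -` {a<..<b}" by auto
  then show ?thesis
    unfolding Euclidean_space_eq using continuous_openin_preimage_gen[of "Rn n" f "{a<..<b}"] f[of 0] by simp
qed

lemma continuous_on_transport: "continuous_on (band \<times> {a<..<b}) (\<lambda>q. transport (fst q) (snd q))"
proof (rule continuous_on_into_fun[where m = n])
  fix j assume j: "j < n"
  define g where "g q = (\<lambda>l. if l < n then fst q l else if l = n then snd q else 0)" for q :: "(nat \<Rightarrow> real) \<times> real"
  have pg: "proj n (g q) = fst q" "g q n = snd q" if "q \<in> band \<times> {a<..<b}" for q
    using that by (auto simp: g_def proj_def Rn_iff fun_eq_iff)
  have "continuous_on (band \<times> {a<..<b}) (\<lambda>q. transport (proj n (g q)) (g q n) j)"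
  proof (rule continuous_on_compose2[where f = g and g = "\<lambda>z. transport (proj n z) (z n) j"])
    show "continuous_on transport_domain (\<lambda>z. transport (proj n z) (z n) j)"
      by (rule Ck_on_continuous[OF smooth_transport[OF j, of 0]])
    show "g ` (band \<times> {a<..<b}) \<subseteq> transport_domain"
      using pg by (auto simp: transport_domain_def) (auto simp: g_def Rn_iff)
    show "continuous_on (band \<times> {a<..<b}) g"
    proof (rule continuous_on_coordinatewise_then_product)
      fix l
      have "continuous_on (band \<times> {a<..<b}) (\<lambda>q. fst q l)"
        by (rule continuous_on_compose2[OF continuous_on_product_coordinates continuous_on_fst[OF continuous_on_id]]) auto
      then show "continuous_on (band \<times> {a<..<b}) (\<lambda>q. g q l)"
        by (cases "l < n"; cases "l = n") (auto simp: g_def intro: continuous_intros)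
    qed
  qed
  then show "continuous_on (band \<times> {a<..<b}) (\<lambda>q. transport (fst q) (snd q) j)"
    by (rule continuous_on_eq) (simp add: pg)
qed auto

text \<open>A chart of a level forgets one coordinate; the charts are the pieces of the level that are graphs of
  a smooth function of the remaining coordinates.\<close>

definition level_chart :: "real \<Rightarrow> (nat \<Rightarrow> real) set \<Rightarrow> ((nat \<Rightarrow> real) \<Rightarrow> nat \<Rightarrow> real) \<Rightarrow> bool"
  where "level_chart c V \<phi> \<longleftrightarrow> openin (top_of_set (level c)) V \<and> (\<exists>i<n. \<phi> = drop_coord i) \<and> inj_on \<phi> V \<and>
    openin (Euclidean_space (n - 1)) (\<phi> ` V) \<and> (\<forall>j<n. \<forall>k. Ck_on k (n - 1) (\<phi> ` V) (\<lambda>y. inv_into V \<phi> y j))"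

definition level_manifold :: "real \<Rightarrow> (nat \<Rightarrow> real) manifold"
  where "level_manifold c = \<lparr>mtop = top_of_set (level c), mdim = n - 1, atlas = {(V, \<phi>). level_chart c V \<phi>}\<rparr>"

lemma level_chart_subset: "level_chart c V \<phi> \<Longrightarrow> V \<subseteq> level c"
  unfolding level_chart_def using openin_imp_subset by blast

lemma level_subset_Rn: "level c \<subseteq> Rn n"
  by (auto simp: level_def)

lemma level_subset_band: "a < c \<Longrightarrow> c < b \<Longrightarrow> level c \<subseteq> band"
  by (auto simp: level_def)

lemma level_chart_in_Rn:
  assumes "level_chart c V \<phi>" "x \<in> Rn n" shows "\<phi> x \<in> Rn (n - 1)"
  using assms drop_coord_in_Rn by (auto simp: level_chart_def)

lemma level_chart_nth:
  assumes "level_chart c V \<phi>" "j < n - 1" shows "\<exists>l<n. \<forall>x. \<phi> x j = x l"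
proof -
  obtain i where i: "\<phi> = drop_coord i" using assms by (auto simp: level_chart_def)
  show ?thesis using assms(2) by (intro exI[of _ "if j < i then j else Suc j"]) (auto simp: i drop_coord_nth)
qed

lemma level_chart_continuous:
  assumes "level_chart c V \<phi>" shows "continuous_on S \<phi>"
  using assms continuous_on_drop_coord by (auto simp: level_chart_def)

lemma level_chart_inv:
  assumes "level_chart c V \<phi>"
  shows "x \<in> V \<Longrightarrow> inv_into V \<phi> (\<phi> x) = x" "y \<in> \<phi> ` V \<Longrightarrow> inv_into V \<phi> y \<in> V" "y \<in> \<phi> ` V \<Longrightarrow> \<phi> (inv_into V \<phi> y) = y"
  using assms by (auto simp: level_chart_def inv_into_into f_inv_into_f)

lemma level_chart_inv_continuous:
  assumes c: "level_chart c V \<phi>" shows "continuous_on (\<phi> ` V) (inv_into V \<phi>)"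
proof (rule continuous_on_into_fun[where m = n])
  show "continuous_on (\<phi> ` V) (\<lambda>y. inv_into V \<phi> y j)" if "j < n" for j
  proof -
    have "Ck_on 0 (n - 1) (\<phi> ` V) (\<lambda>y. inv_into V \<phi> y j)" using c that unfolding level_chart_def by blast
    then show ?thesis by simp
  qed
  show "inv_into V \<phi> ` (\<phi> ` V) \<subseteq> Rn n"
    using level_chart_inv(2)[OF c] level_chart_subset[OF c] level_subset_Rn by blast
qed

lemma level_chart_open_image:
  assumes c: "level_chart c V \<phi>" and T: "openin (top_of_set (level c)) T"
  shows "openin (Euclidean_space (n - 1)) (\<phi> ` (V \<inter> T))"
proof -
  obtain T' where T': "open T'" "T = level c \<inter> T'" using T by (auto simp: openin_open)
  have "\<phi> ` (V \<inter> T) = \<phi> ` V \<inter> inv_into V \<phi> -` T'"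
    using level_chart_subset[OF c] level_chart_inv[OF c] T'(2) by (auto simp: image_iff)
  moreover have "openin (top_of_set (\<phi> ` V)) \<dots>"
    by (rule continuous_openin_preimage_gen[OF level_chart_inv_continuous[OF c] T'(1)])
  moreover have "openin (Euclidean_space (n - 1)) (\<phi> ` V)" using c by (simp add: level_chart_def)
  ultimately show ?thesis unfolding Euclidean_space_eq by (metis openin_trans)
qed

text \<open>Near \<open>p\<close> the level is the graph of the implicit function for a coordinate in which the derivative of \<open>f\<close> does not vanish.\<close>

lemma level_chart_exists:
  assumes c: "a < c" "c < b" and p: "p \<in> level c"
  shows "\<exists>V \<phi>. level_chart c V \<phi> \<and> p \<in> V"
proof -
  have pR: "p \<in> Rn n" "f p = c" using p by (auto simp: level_def)
  obtain i where i: "i < n" "partial_deriv i f p \<noteq> 0" using nonzero_partial[of p] pR c by auto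
  define m where "m = n - 1"
  have n: "n = Suc m" using i by (simp add: m_def)
  define G where "G x = f x - c" for x
  have GC: "Ck_on k (Suc m) (Rn (Suc m)) G" for k
    unfolding G_def using f[of k] n by (intro Ck_on_diff Ck_on_const) auto
  have im: "i \<le> m" using i n by simp
  have "has_partial f i (partial_deriv i f p) p" using Ck_on_has_partial[OF f i(1) pR(1)] .
  then have "has_partial G i (partial_deriv i f p) p"
    unfolding has_partial_def G_def using DERIV_diff[OF _ DERIV_const] by fastforce
  then have B: "partial_deriv i G (ins i (drop_coord i p) (p i)) \<noteq> 0"
    using i(2) by (simp add: ins_drop_coord partial_deriv_eqI)
  have A: "G (ins i (drop_coord i p) (p i)) = 0" using pR by (simp add: ins_drop_coord G_def)
  have y0: "drop_coord i p \<in> Rn m" unfolding m_def by (rule drop_coord_in_Rn[OF pR(1) i(1)])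
  have x0: "ins i (drop_coord i p) (p i) \<in> Rn (Suc m)" using pR n by (simp add: ins_drop_coord)
  from implicit_function[OF openin_Rn_UNIV GC im y0 x0 A B]
  obtain Y e g where Yeg: "openin (Euclidean_space m) Y \<and> drop_coord i p \<in> Y \<and> e > 0 \<and> (\<forall>k. Ck_on k m Y g) \<and>
    (\<forall>y\<in>Y. \<bar>g y - p i\<bar> < e \<and> (\<forall>t. \<bar>t - p i\<bar> < e \<longrightarrow> ins i y t \<in> Rn (Suc m) \<and> (G (ins i y t) = 0 \<longleftrightarrow> t = g y)))"
    by (elim exE) (rule that)
  then have Y: "openin (Euclidean_space m) Y" "drop_coord i p \<in> Y" "e > 0" "\<And>k. Ck_on k m Y g" by simp_all
  have root: "\<bar>g y - p i\<bar> < e" "\<And>t. \<bar>t - p i\<bar> < e \<Longrightarrow> G (ins i y t) = 0 \<longleftrightarrow> t = g y" if "y \<in> Y" for y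
    using Yeg[THEN conjunct2, THEN conjunct2, THEN conjunct2, THEN conjunct2, rule_format, OF that] by simp_all
  define V where "V = {x \<in> level c. drop_coord i x \<in> Y \<and> \<bar>x i - p i\<bar> < e}"
  have graph: "ins i y (g y) \<in> V" if "y \<in> Y" for y
  proof -
    have "y \<in> Rn m" using that Y(1) openin_Rn_subset by blast
    then have "ins i y (g y) \<in> Rn n" unfolding n by (rule ins_in_Rn[OF _ im])
    then show ?thesis using root[OF that] that by (auto simp: V_def level_def drop_coord_ins G_def)
  qed
  have onV: "x = ins i (drop_coord i x) (g (drop_coord i x))" if "x \<in> V" for x
  proof -
    have "G (ins i (drop_coord i x) (x i)) = 0" using that by (simp add: ins_drop_coord V_def level_def G_def)
    then have "x i = g (drop_coord i x)" using root(2)[of "drop_coord i x" "x i"] that by (simp add: V_def)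
    then show ?thesis using ins_drop_coord[of i x] by simp
  qed
  have inj: "inj_on (drop_coord i) V" by (rule inj_onI) (metis onV)
  have img: "drop_coord i ` V = Y"
  proof
    show "drop_coord i ` V \<subseteq> Y" by (auto simp: V_def)
    show "Y \<subseteq> drop_coord i ` V" using graph drop_coord_ins by (metis image_eqI subsetI)
  qed
  have inv: "inv_into V (drop_coord i) y = ins i y (g y)" if "y \<in> Y" for y
    using inv_into_f_f[OF inj graph[OF that]] by (simp add: drop_coord_ins)
  have "Ck_on k m Y (\<lambda>y. inv_into V (drop_coord i) y j)" for j k
    using Ck_on_cong[OF Y(1), of "\<lambda>y. inv_into V (drop_coord i) y j" "\<lambda>y. ins i y (g y) j" k] inv Ck_on_ins[OF Y(1) Y(4)] by simp
  moreover have "openin (top_of_set (level c)) V"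
  proof -
    obtain T where T: "open T" "Y = T \<inter> Rn m" using Y(1) by (auto simp: openin_Rn_iff)
    have "open (drop_coord i -` T)" using continuous_on_open_vimage[OF open_UNIV] continuous_on_drop_coord[of UNIV i] T(1) by auto
    moreover have "open {x. \<bar>x i - p i\<bar> < e}"
      by (intro open_Collect_less continuous_intros continuous_on_product_then_coordinatewise)
    moreover have "V = level c \<inter> (drop_coord i -` T \<inter> {x. \<bar>x i - p i\<bar> < e})"
      using drop_coord_in_Rn[of _ n i] i(1) by (auto simp: V_def T(2) level_def m_def)
    ultimately show ?thesis by (metis openin_open open_Int)
  qed
  moreover have "p \<in> V" using p Y by (simp add: V_def)
  ultimately show ?thesis
    using inj img i(1) Y(1) unfolding level_chart_def by (intro exI[of _ V] exI[of _ "drop_coord i"]) (auto simp: m_def)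
qed

text \<open>A change of charts is the inverse of one chart followed by forgetting a coordinate, so it consists of components
  of that inverse, which are smooth by the choice of the charts.\<close>

lemma smooth_level_manifold:
  assumes c: "a < c" "c < b"
  shows "smooth_manifold (level_manifold c)"
proof -
  have chart: "is_chart (top_of_set (level c)) (n - 1) V \<phi>" if V: "level_chart c V \<phi>" for V \<phi>
  proof -
    have "homeomorphic_maps (top_of_set V) (top_of_set (\<phi> ` V)) \<phi> (inv_into V \<phi>)"
      unfolding homeomorphic_maps_def
      using level_chart_continuous[OF V] level_chart_inv_continuous[OF V] level_chart_inv[OF V] by auto
    moreover have "subtopology (top_of_set (level c)) V = top_of_set V"
      using level_chart_subset[OF V] by (simp add: subtopology_subtopology Int_absorb1)
    moreover have "openin (Euclidean_space (n - 1)) (\<phi> ` V)" using V by (simp add: level_chart_def)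
    moreover from this have "subtopology (Euclidean_space (n - 1)) (\<phi> ` V) = top_of_set (\<phi> ` V)"
      using openin_Rn_subset by (simp add: Euclidean_space_eq subtopology_subtopology Int_absorb1)
    ultimately show ?thesis
      using V unfolding is_chart_def by (auto simp: level_chart_def homeomorphic_map_maps)
  qed
  have transition: "smooth_vec_on (n - 1) (n - 1) (\<phi> ` (V \<inter> W)) (\<lambda>z. \<psi> (inv_into V \<phi> z))"
    if V: "level_chart c V \<phi>" and W: "level_chart c W \<psi>" for V \<phi> W \<psi>
    unfolding smooth_vec_on_def smooth_on_def
  proof (intro conjI allI impI)
    have "openin (top_of_set (level c)) W" using W by (simp add: level_chart_def)
    then show "openin (Euclidean_space (n - 1)) (\<phi> ` (V \<inter> W))" by (rule level_chart_open_image[OF V])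
    show "(\<lambda>z. \<psi> (inv_into V \<phi> z)) ` \<phi> ` (V \<inter> W) \<subseteq> Rn (n - 1)"
      using level_chart_in_Rn[OF W] level_chart_inv(2)[OF V] level_chart_subset[OF V] level_subset_Rn by blast
    fix j k assume "j < n - 1"
    then obtain l where l: "l < n" "\<forall>x. \<psi> x j = x l" using level_chart_nth[OF W] by blast
    have "Ck_on k (n - 1) (\<phi> ` V) (\<lambda>y. inv_into V \<phi> y l)" using V l(1) by (simp add: level_chart_def)
    then show "Ck_on k (n - 1) (\<phi> ` (V \<inter> W)) (\<lambda>z. \<psi> (inv_into V \<phi> z) j)"
      unfolding l(2)[rule_format] by (rule Ck_on_subset) auto
  qed
  have cover: "(\<Union>(V, \<phi>)\<in>{(V, \<phi>). level_chart c V \<phi>}. V) = level c"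
    using level_chart_exists[OF c] level_chart_subset by fastforce
  show ?thesis
    unfolding smooth_manifold_def level_manifold_def
    using chart transition cover second_countable_top_of_set[of "level c"]
    by (auto simp: Hausdorff_space_subtopology)
qed

definition band_manifold :: "(nat \<Rightarrow> real) manifold"
  where "band_manifold = open_submanifold (Rn_manifold n) {x \<in> mspace (Rn_manifold n). f x \<in> {a<..<b}}"

definition level_product :: "real \<Rightarrow> ((nat \<Rightarrow> real) \<times> real) manifold"
  where "level_product c = prod_manifold (level_manifold c) (open_submanifold real_manifold {a<..<b})"

lemma mspace_Rn_manifold: "mspace (Rn_manifold n) = Rn n"
  by (simp add: Rn_manifold_def Rn_def)

lemma band_manifold_simps:
  "mtop band_manifold = top_of_set band" "mdim band_manifold = n"
  "atlas band_manifold = {(band, \<lambda>x. x)}"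
proof -
  have "Rn n \<inter> band = band" by auto
  then show "mtop band_manifold = top_of_set band" "atlas band_manifold = {(band, \<lambda>x. x)}"
    unfolding band_manifold_def mspace_Rn_manifold
    by (simp_all add: open_submanifold_def Rn_manifold_def Euclidean_space_eq subtopology_subtopology)
qed (simp add: band_manifold_def open_submanifold_def Rn_manifold_def)

definition product_chart :: "((nat \<Rightarrow> real) \<Rightarrow> nat \<Rightarrow> real) \<Rightarrow> (nat \<Rightarrow> real) \<times> real \<Rightarrow> nat \<Rightarrow> real"
  where "product_chart \<phi> = (\<lambda>(x, y). join (n - 1) (\<phi> x) (vec1 y))"

lemma level_product_simps:
  "mtop (level_product c) = top_of_set (level c \<times> {a<..<b})" "mdim (level_product c) = n - 1 + 1"
  "atlas (level_product c) = {(V \<times> {a<..<b}, product_chart \<phi>) |V \<phi>. level_chart c V \<phi>}"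
  by (auto simp: level_product_def prod_manifold_def level_manifold_def open_submanifold_def real_manifold_def product_chart_def)

lemma product_chart_nth:
  assumes "level_chart c V \<phi>" "x \<in> V"
  shows "product_chart \<phi> (x, y) j = (if j < n - 1 then \<phi> x j else if j = n - 1 then y else 0)"
  by (auto simp: product_chart_def join_def vec1_def)

lemma smooth_to_product:
  assumes c: "a < c" "c < b"
  shows "smooth_map band_manifold (level_product c) (\<lambda>x. (transport x c, f x))"
proof -
  let ?\<Phi> = "\<lambda>x. (transport x c, f x)"
  have bandR: "band \<subseteq> Rn n" by auto
  have tl: "transport x c \<in> level c" if "x \<in> band" for x
    using that level_transport[of x c] c by (auto simp: level_def)
  have "continuous_on band (\<lambda>x. transport (fst (x, c)) (snd (x, c)))"
    by (rule continuous_on_compose2[OF continuous_on_transport, of _ "\<lambda>x. (x, c)"]) (use c in \<open>auto intro!: continuous_intros\<close>)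
  then have ct: "continuous_on band (\<lambda>x. transport x c)" by simp
  have cf: "continuous_on band f" using continuous_on_subset[OF Ck_on_continuous[OF f[of 0]] bandR] .
  have cont: "continuous_map (mtop band_manifold) (mtop (level_product c)) ?\<Phi>"
    unfolding band_manifold_simps level_product_simps using tl ct cf by (auto intro!: continuous_on_Pair)
  have smooth: "smooth_vec_on n (n - 1 + 1) ((\<lambda>x. x) ` {x \<in> band. ?\<Phi> x \<in> V \<times> {a<..<b}})
       (\<lambda>z. product_chart \<phi> (?\<Phi> (inv_into band (\<lambda>x. x) z)))" if V: "level_chart c V \<phi>" for V \<phi>
  proof -
    define S where "S = {x \<in> band. transport x c \<in> V}"
    have S: "(\<lambda>x. x) ` {x \<in> band. ?\<Phi> x \<in> V \<times> {a<..<b}} = S" by (auto simp: S_def)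
    have Sb: "S \<subseteq> band" by (auto simp: S_def)
    have inv: "inv_into band (\<lambda>x. x) z = z" if "z \<in> band" for z
      using inv_into_f_f[of "\<lambda>x. x" band z] that by (simp add: inj_on_def)
    have openS: "openin (Euclidean_space n) S"
    proof -
      obtain T where T: "open T" "V = level c \<inter> T" using V by (auto simp: level_chart_def openin_open)
      have "S = band \<inter> (\<lambda>x. transport x c) -` T" using tl T(2) by (auto simp: S_def)
      moreover have "openin (top_of_set band) \<dots>" by (rule continuous_openin_preimage_gen[OF ct T(1)])
      ultimately show ?thesis using open_band unfolding Euclidean_space_eq by (metis openin_trans)
    qed
    have nth: "product_chart \<phi> (?\<Phi> (inv_into band (\<lambda>x. x) z)) j =
        (if j < n - 1 then \<phi> (transport z c) j else if j = n - 1 then f z else 0)" if "z \<in> S" for z j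
      using product_chart_nth[OF V, of "transport z c" "f z" j] that inv[of z] by (simp add: S_def)
    have "Ck_on k n S (\<lambda>z. product_chart \<phi> (?\<Phi> (inv_into band (\<lambda>x. x) z)) j)" if j: "j < n - 1 + 1" for j k
    proof (cases "j < n - 1")
      case True
      then obtain l where l: "l < n" "\<forall>x. \<phi> x j = x l" using level_chart_nth[OF V] by blast
      have "Ck_on k n S (\<lambda>z. transport z c l)"
        using c Sb by (intro smooth_transport_compose openS l) (auto intro: Ck_on_coord Ck_on_const openS)
      then show ?thesis
        using Ck_on_cong[OF openS, of "\<lambda>z. product_chart \<phi> (?\<Phi> (inv_into band (\<lambda>x. x) z)) j" "\<lambda>z. transport z c l" k] nth True l(2) by simp
    next
      case False
      have "Ck_on k n S f" using Ck_on_subset[OF f] Sb bandR by blast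
      then show ?thesis
        using Ck_on_cong[OF openS, of "\<lambda>z. product_chart \<phi> (?\<Phi> (inv_into band (\<lambda>x. x) z)) j" f k] nth False j by simp
    qed
    moreover have "product_chart \<phi> (?\<Phi> (inv_into band (\<lambda>x. x) z)) \<in> Rn (n - 1 + 1)" if "z \<in> S" for z
      using nth[OF that] by (simp add: Rn_iff)
    ultimately show ?thesis unfolding S smooth_vec_on_def smooth_on_def using openS by auto
  qed
  show ?thesis
    unfolding smooth_map_def using cont smooth by (auto simp: band_manifold_simps level_product_simps)
qed

lemma smooth_from_product:
  assumes c: "a < c" "c < b"
  shows "smooth_map (level_product c) band_manifold (\<lambda>q. transport (fst q) (snd q))"
proof -
  let ?\<Psi> = "\<lambda>q. transport (fst q) (snd q)"
  have into: "?\<Psi> q \<in> band" if "q \<in> level c \<times> {a<..<b}" for q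
    using that level_transport[of "fst q" "snd q"] c by (auto simp: level_def)
  have "continuous_on (level c \<times> {a<..<b}) ?\<Psi>"
    by (rule continuous_on_subset[OF continuous_on_transport]) (use level_subset_band[OF c] in auto)
  then have cont: "continuous_map (mtop (level_product c)) (mtop band_manifold) ?\<Psi>"
    unfolding band_manifold_simps level_product_simps using into by auto
  have smooth: "smooth_vec_on (n - 1 + 1) n (product_chart \<phi> ` {q \<in> V \<times> {a<..<b}. ?\<Psi> q \<in> band})
       (\<lambda>z. ?\<Psi> (inv_into (V \<times> {a<..<b}) (product_chart \<phi>) z))" if V: "level_chart c V \<phi>" for V \<phi>
  proof -
    let ?m = "n - 1"
    have VL: "V \<subseteq> level c" by (rule level_chart_subset[OF V])
    define S where "S = {z \<in> Rn (?m + 1). proj ?m z \<in> \<phi> ` V \<and> z ?m \<in> {a<..<b}}"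
    have \<phi>R: "\<phi> x \<in> Rn ?m" if "x \<in> V" for x using level_chart_in_Rn[OF V] that VL level_subset_Rn by blast
    have pc: "proj ?m (product_chart \<phi> (x, y)) = \<phi> x" "product_chart \<phi> (x, y) ?m = y"
      "product_chart \<phi> (x, y) \<in> Rn (?m + 1)" if "x \<in> V" for x y
      using product_chart_nth[OF V that] \<phi>R[OF that] by (auto simp: proj_def Rn_iff fun_eq_iff)
    have surj: "product_chart \<phi> (inv_into V \<phi> (proj ?m z), z ?m) = z" if "z \<in> S" for z
    proof (rule Rn_eqI[of _ "?m + 1"])
      have iV: "inv_into V \<phi> (proj ?m z) \<in> V" "\<phi> (inv_into V \<phi> (proj ?m z)) = proj ?m z"
        using that level_chart_inv[OF V] by (auto simp: S_def)
      show "product_chart \<phi> (inv_into V \<phi> (proj ?m z), z ?m) \<in> Rn (?m + 1)" by (rule pc(3)[OF iV(1)])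
      show "z \<in> Rn (?m + 1)" using that by (simp add: S_def)
      show "product_chart \<phi> (inv_into V \<phi> (proj ?m z), z ?m) i = z i" if "i < ?m + 1" for i
        using that iV product_chart_nth[OF V iV(1)] by (auto simp: proj_def less_Suc_eq)
    qed
    have S: "product_chart \<phi> ` {q \<in> V \<times> {a<..<b}. ?\<Psi> q \<in> band} = S"
    proof (intro subset_antisym subsetI)
      fix z assume "z \<in> product_chart \<phi> ` {q \<in> V \<times> {a<..<b}. ?\<Psi> q \<in> band}"
      then obtain x y where "x \<in> V" "y \<in> {a<..<b}" "z = product_chart \<phi> (x, y)" by auto
      then show "z \<in> S" using pc by (auto simp: S_def)
    next
      fix z assume z: "z \<in> S"
      have "inv_into V \<phi> (proj ?m z) \<in> V" using z level_chart_inv(2)[OF V] by (auto simp: S_def)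
      then have "(inv_into V \<phi> (proj ?m z), z ?m) \<in> {q \<in> V \<times> {a<..<b}. ?\<Psi> q \<in> band}"
        using z into[of "(inv_into V \<phi> (proj ?m z), z ?m)"] VL by (auto simp: S_def)
      then show "z \<in> product_chart \<phi> ` {q \<in> V \<times> {a<..<b}. ?\<Psi> q \<in> band}" 
        by (rule rev_image_eqI) (rule surj[OF z, symmetric])
    qed
    have inj: "inj_on (product_chart \<phi>) (V \<times> {a<..<b})"
    proof (rule inj_onI, clarify)
      fix x y x' y' assume "x \<in> V" "x' \<in> V" "product_chart \<phi> (x, y) = product_chart \<phi> (x', y')"
      then have "\<phi> x = \<phi> x'" "y = y'" using pc by metis+
      then show "x = x' \<and> y = y'" using V \<open>x \<in> V\<close> \<open>x' \<in> V\<close> by (auto simp: level_chart_def dest: inj_onD)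
    qed
    have inv: "inv_into (V \<times> {a<..<b}) (product_chart \<phi>) z = (inv_into V \<phi> (proj ?m z), z ?m)" if "z \<in> S" for z
    proof -
      have "(inv_into V \<phi> (proj ?m z), z ?m) \<in> V \<times> {a<..<b}" using that level_chart_inv(2)[OF V] by (auto simp: S_def)
      then show ?thesis using inv_into_f_f[OF inj] surj[OF that] by metis
    qed
    have openS: "openin (Euclidean_space (?m + 1)) S"
    proof -
      obtain T where T: "open T" "\<phi> ` V = T \<inter> Rn ?m" using V by (auto simp: level_chart_def openin_Rn_iff)
      have "continuous_on (Rn (?m + 1)) (proj ?m)"
        using Ck_on_continuous[OF Ck_on_proj[OF openin_Rn_UNIV, of 0]] by (intro continuous_on_into_fun[where m = ?m]) auto
      from continuous_openin_preimage_gen[OF this T(1)]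
      have 1: "openin (top_of_set (Rn (?m + 1))) (Rn (?m + 1) \<inter> proj ?m -` T)" .
      have "continuous_on (Rn (?m + 1)) (\<lambda>z. z ?m)" by (rule continuous_on_subset[OF continuous_on_product_coordinates]) simp
      from continuous_openin_preimage_gen[OF this, of "{a<..<b}"]
      have 2: "openin (top_of_set (Rn (?m + 1))) (Rn (?m + 1) \<inter> (\<lambda>z. z ?m) -` {a<..<b})" by simp
      have "S = (Rn (?m + 1) \<inter> proj ?m -` T) \<inter> (Rn (?m + 1) \<inter> (\<lambda>z. z ?m) -` {a<..<b})"
        using T(2) by (auto simp: S_def)
      then show ?thesis unfolding Euclidean_space_eq using openin_Int[OF 1 2] by simp
    qed
    have "Ck_on k (?m + 1) S (\<lambda>z. ?\<Psi> (inv_into (V \<times> {a<..<b}) (product_chart \<phi>) z) j)" if j: "j < n" for j k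
    proof -
      have "Ck_on k (?m + 1) S (\<lambda>z. transport (inv_into V \<phi> (proj ?m z)) (z ?m) j)"
      proof (rule smooth_transport_compose[OF openS _ _ _ _ j])
        show "inv_into V \<phi> (proj ?m z) \<in> band" if "z \<in> S" for z
          using that level_chart_inv(2)[OF V] VL level_subset_band[OF c] by (auto simp: S_def)
        show "Ck_on k (?m + 1) S (\<lambda>z. inv_into V \<phi> (proj ?m z) l)" if "l < n" for l
        proof (rule Ck_on_compose[where W = "\<phi> ` V" and m = ?m and g = "proj ?m" and h = "\<lambda>y. inv_into V \<phi> y l"])
          show "Ck_on k ?m (\<phi> ` V) (\<lambda>y. inv_into V \<phi> y l)" using V that by (simp add: level_chart_def)
        qed (use V openS Ck_on_proj[OF openS] in \<open>auto simp: level_chart_def S_def\<close>)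
      qed (use openS in \<open>auto simp: S_def intro: Ck_on_coord\<close>)
      then show ?thesis
        using Ck_on_cong[OF openS, of "\<lambda>z. ?\<Psi> (inv_into (V \<times> {a<..<b}) (product_chart \<phi>) z) j"
            "\<lambda>z. transport (inv_into V \<phi> (proj ?m z)) (z ?m) j" k] inv by simp
    qed
    then show ?thesis unfolding S smooth_vec_on_def smooth_on_def using openS by auto
  qed
  show ?thesis
    unfolding smooth_map_def using cont smooth by (auto simp: band_manifold_simps level_product_simps)
qed

text \<open>The point \<open>x\<close> is sent to the point of the level \<open>c\<close> on its trajectory and to its own level; the inverse transports a point
  of the level \<open>c\<close> to the given level.\<close>

theorem typical_value_in_band:
  assumes c: "a < c" "c < b"
  shows "typical_value (Rn_manifold n) real_manifold f c"
proof -
  let ?\<Phi> = "\<lambda>x. (transport x c, f x)" and ?\<Psi> = "\<lambda>q. transport (fst q) (snd q)"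
  have "?\<Psi> (?\<Phi> x) = x" if "x \<in> mspace band_manifold" for x
    using that c transport_transport[of x c "f x"] transport_self[of x] by (auto simp: band_manifold_simps)
  moreover have "?\<Phi> (?\<Psi> q) = q" if "q \<in> mspace (level_product c)" for q
  proof -
    obtain p u where pu: "q = (p, u)" by (cases q)
    then have q: "p \<in> Rn n" "f p = c" "a < u" "u < b" using that by (auto simp: level_product_simps level_def)
    show ?thesis unfolding pu using q c transport_transport[of p u c] transport_self[of p] level_transport[of p u] by simp
  qed
  ultimately have "diffeomorphism band_manifold (level_product c) ?\<Phi>"
    unfolding diffeomorphism_def using smooth_to_product[OF c] smooth_from_product[OF c]
    by (intro conjI exI[of _ ?\<Psi>]) auto
  then show ?thesis
    unfolding typical_value_def band_manifold_def level_product_def using c smooth_level_manifold[OF c]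
    by (intro exI[of _ "{a<..<b}"] conjI exI[of _ "level_manifold c"] exI[of _ ?\<Phi>]) (auto simp: real_manifold_def)
qed

end

section \<open>Definable predicates and functions\<close>

definition depends_below :: "nat \<Rightarrow> ((nat \<Rightarrow> real) \<Rightarrow> 'a) \<Rightarrow> bool"
  where "depends_below N P \<longleftrightarrow> (\<forall>x y. (\<forall>i<N. x i = y i) \<longrightarrow> P x = P y)"

lemma depends_belowD: "depends_below N P \<Longrightarrow> (\<And>i. i < N \<Longrightarrow> x i = y i) \<Longrightarrow> P x = P y"
  by (auto simp: depends_below_def)

lemma depends_below_mono: "depends_below N P \<Longrightarrow> N \<le> M \<Longrightarrow> depends_below M P"
  by (auto simp: depends_below_def)

lemma joined_prod_right:
  assumes "depends_below N P"
  shows "joined_prod N {x \<in> Rn N. P x} (Rn 1) = {x \<in> Rn (N + 1). P x}"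
proof (intro subset_antisym subsetI)
  fix z assume "z \<in> joined_prod N {x \<in> Rn N. P x} (Rn 1)"
  then obtain x y where xy: "x \<in> Rn N" "P x" "y \<in> Rn 1" "z = join N x y" by (auto simp: joined_prod_def)
  have "P z = P x" using assms by (rule depends_belowD) (simp add: xy join_def)
  then show "z \<in> {x \<in> Rn (N + 1). P x}" using xy join_in_Rn[of y 1 N x] by simp
next
  fix z assume z: "z \<in> {x \<in> Rn (N + 1). P x}"
  have "P (proj N z) = P z" using assms by (rule depends_belowD) (simp add: proj_def)
  moreover have "z = join N (proj N z) (\<lambda>i. z (N + i))" by (auto simp: join_def proj_def)
  moreover have "(\<lambda>i. z (N + i)) \<in> Rn 1" using z by (auto simp: Rn_iff)
  ultimately show "z \<in> joined_prod N {x \<in> Rn N. P x} (Rn 1)"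
    using z unfolding joined_prod_def by (intro CollectI exI[of _ "proj N z"] exI[of _ "\<lambda>i. z (N + i)"]) auto
qed

lemma joined_prod_left: "joined_prod 1 (Rn 1) {x \<in> Rn N. P x} = {x \<in> Rn (N + 1). P (\<lambda>i. x (Suc i))}"
proof (intro subset_antisym subsetI)
  fix z assume "z \<in> joined_prod 1 (Rn 1) {x \<in> Rn N. P x}"
  then obtain x y where xy: "x \<in> Rn 1" "P y" "y \<in> Rn N" "z = join 1 x y" by (auto simp: joined_prod_def)
  have "(\<lambda>i. z (Suc i)) = y" by (simp add: xy join_def)
  then show "z \<in> {x \<in> Rn (N + 1). P (\<lambda>i. x (Suc i))}" using xy join_in_Rn[of y N 1 x] by (simp add: add.commute)
next
  fix z assume z: "z \<in> {x \<in> Rn (N + 1). P (\<lambda>i. x (Suc i))}"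
  have "z = join 1 (proj 1 z) (\<lambda>i. z (Suc i))" by (auto simp: join_def proj_def fun_eq_iff)
  moreover have "(\<lambda>i. z (Suc i)) \<in> Rn N" using z by (auto simp: Rn_iff)
  ultimately show "z \<in> joined_prod 1 (Rn 1) {x \<in> Rn N. P x}"
    using z unfolding joined_prod_def by (intro CollectI exI[of _ "proj 1 z"] exI[of _ "\<lambda>i. z (Suc i)"]) auto
qed

context o_minimal_structure begin

lemma D_compl: "A \<in> D n \<Longrightarrow> Rn n - A \<in> D n"
  and D_Un: "A \<in> D n \<Longrightarrow> B \<in> D n \<Longrightarrow> A \<union> B \<in> D n"
  and D_subset: "A \<in> D n \<Longrightarrow> A \<subseteq> Rn n"
  and D_empty: "{} \<in> D n"
  using D1[of n] unfolding algebra_iff_Un by auto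

lemma D_Int: "A \<in> D n \<Longrightarrow> B \<in> D n \<Longrightarrow> A \<inter> B \<in> D n"
proof -
  assume AB: "A \<in> D n" "B \<in> D n"
  have "A \<inter> B = Rn n - ((Rn n - A) \<union> (Rn n - B))" using D_subset AB by blast
  then show ?thesis using AB D_compl D_Un by metis
qed

lemma D_Rn: "Rn n \<in> D n"
  using D_compl[OF D_empty] by simp

text \<open>Predicates are functions of an infinite sequence \<open>e\<close>, the environment, of which only finitely many entries matter.
  This makes definable predicates of different arities closed under the logical operations without bookkeeping.\<close>

definition definable_pred :: "((nat \<Rightarrow> real) \<Rightarrow> bool) \<Rightarrow> bool"
  where "definable_pred P \<longleftrightarrow> (\<exists>N. depends_below N P \<and> {x \<in> Rn N. P x} \<in> D N)"

text \<open>Definability of the graph, with the value in entry \<open>0\<close> and the arguments shifted by one.\<close>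

definition definable_term :: "((nat \<Rightarrow> real) \<Rightarrow> real) \<Rightarrow> bool"
  where "definable_term g \<longleftrightarrow> definable_pred (\<lambda>e. e 0 = g (\<lambda>i. e (Suc i)))"

lemma D_lift:
  assumes "depends_below N P" "{x \<in> Rn N. P x} \<in> D N" "N \<le> M"
  shows "{x \<in> Rn M. P x} \<in> D M"
  using assms(3)
proof (induction M rule: dec_induct)
  case (step M)
  then show ?case using D2_right[OF step.IH] joined_prod_right[OF depends_below_mono[OF assms(1) step.hyps(1)]] by simp
qed (rule assms(2))

lemma D_lower:
  assumes "depends_below M P" "{x \<in> Rn (M + k). P x} \<in> D (M + k)"
  shows "{x \<in> Rn M. P x} \<in> D M"
  using assms(2)
proof (induction k)
  case (Suc k)
  have P: "P (proj (M + k) z) = P z" for z using assms(1) by (rule depends_belowD) (simp add: proj_def)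
  have "proj (M + k) ` {x \<in> Rn (M + Suc k). P x} = {x \<in> Rn (M + k). P x}"
  proof (intro subset_antisym subsetI)
    fix z assume "z \<in> {x \<in> Rn (M + k). P x}"
    then have "proj (M + k) z = z" "z \<in> {x \<in> Rn (M + Suc k). P x}" by (auto simp: proj_Rn Rn_iff)
    then show "z \<in> proj (M + k) ` {x \<in> Rn (M + Suc k). P x}" by (metis imageI)
  qed (auto simp: P)
  then show ?case using Suc.IH D3[of "{x \<in> Rn (M + Suc k). P x}" "M + k"] Suc.prems by simp
qed simp

lemma pred_D:
  assumes "definable_pred P" "depends_below M P"
  shows "{x \<in> Rn M. P x} \<in> D M"
proof -
  obtain N where N: "depends_below N P" "{x \<in> Rn N. P x} \<in> D N" using assms(1) by (auto simp: definable_pred_def)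
  show ?thesis
  proof (cases "N \<le> M")
    case False
    then have "M + (N - M) = N" by simp
    then show ?thesis using D_lower[OF assms(2), of "N - M"] N(2) by simp
  qed (rule D_lift[OF N])
qed

lemma definable_predI: "depends_below N P \<Longrightarrow> {x \<in> Rn N. P x} \<in> D N \<Longrightarrow> definable_pred P"
  by (auto simp: definable_pred_def)

lemma pred_depends: "definable_pred P \<Longrightarrow> \<exists>N. depends_below N P"
  by (auto simp: definable_pred_def)

lemma pred_True: "definable_pred (\<lambda>e. True)"
  using D_Rn[of 0] by (intro definable_predI[of 0]) (auto simp: depends_below_def)

lemma pred_not: "definable_pred P \<Longrightarrow> definable_pred (\<lambda>e. \<not> P e)"
proof -
  assume "definable_pred P"
  then obtain N where N: "depends_below N P" "{x \<in> Rn N. P x} \<in> D N" by (auto simp: definable_pred_def)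
  have "{x \<in> Rn N. \<not> P x} = Rn N - {x \<in> Rn N. P x}" by auto
  then show ?thesis using N D_compl by (intro definable_predI[of N]) (auto simp: depends_below_def)
qed

lemma pred_conj: "definable_pred P \<Longrightarrow> definable_pred Q \<Longrightarrow> definable_pred (\<lambda>e. P e \<and> Q e)"
proof -
  assume PQ: "definable_pred P" "definable_pred Q"
  then obtain N M where NM: "depends_below N P" "depends_below M Q" using pred_depends by blast
  define L where "L = max N M"
  have L: "depends_below L P" "depends_below L Q" unfolding L_def by (rule depends_below_mono[OF NM(1)], simp, rule depends_below_mono[OF NM(2)], simp)
  have "{x \<in> Rn L. P x \<and> Q x} = {x \<in> Rn L. P x} \<inter> {x \<in> Rn L. Q x}" by auto
  then have "{x \<in> Rn L. P x \<and> Q x} \<in> D L" using D_Int[OF pred_D[OF PQ(1) L(1)] pred_D[OF PQ(2) L(2)]] by (simp only:)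
  moreover have "depends_below L (\<lambda>e. P e \<and> Q e)" using L unfolding depends_below_def by blast
  ultimately show ?thesis by (intro definable_predI)
qed

lemma pred_disj: "definable_pred P \<Longrightarrow> definable_pred Q \<Longrightarrow> definable_pred (\<lambda>e. P e \<or> Q e)"
  using pred_not[OF pred_conj[OF pred_not pred_not, of P Q]] by simp

lemma pred_imp: "definable_pred P \<Longrightarrow> definable_pred Q \<Longrightarrow> definable_pred (\<lambda>e. P e \<longrightarrow> Q e)"
  unfolding imp_conv_disj by (intro pred_disj pred_not)

lemma pred_ball_lessThan: "(\<And>i. i < (k::nat) \<Longrightarrow> definable_pred (P i)) \<Longrightarrow> definable_pred (\<lambda>e. \<forall>i<k. P i e)"
proof (induction k)
  case (Suc k)
  then have "definable_pred (\<lambda>e. (\<forall>i<k. P i e) \<and> P k e)" by (intro pred_conj) auto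
  moreover have "(\<lambda>e. (\<forall>i<k. P i e) \<and> P k e) = (\<lambda>e. \<forall>i<Suc k. P i e)" by (auto simp: less_Suc_eq)
  ultimately show ?case by simp
qed (simp add: pred_True)

definition uexp :: "nat \<Rightarrow> nat \<Rightarrow> nat"
  where "uexp i = (\<lambda>l. if l = i then 1 else 0)"

lemma uexp_eq_iff [simp]: "uexp i = uexp j \<longleftrightarrow> i = j"
  by (auto simp: uexp_def fun_eq_iff split: if_splits)

lemma prod_uexp: "i < N \<Longrightarrow> (\<Prod>l<N. x l ^ uexp i l) = (x i :: real)"
  by (simp add: uexp_def if_distrib[of "\<lambda>k. _ ^ k"] cong: if_cong)

lemma pred_coord_eq: "definable_pred (\<lambda>x. x i = x j)"
proof (cases "i = j")
  case False
  define N where "N = Suc (max i j)"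
  have N: "i < N" "j < N" by (auto simp: N_def)
  have "poly_value N {uexp i, uexp j} (\<lambda>\<alpha>. if \<alpha> = uexp i then 1 else -1) x = x i - x j" for x
    using False N by (simp add: poly_value_def prod_uexp)
  then have "{x \<in> Rn N. x i = x j} = {x \<in> Rn N. poly_value N {uexp i, uexp j} (\<lambda>\<alpha>. if \<alpha> = uexp i then 1 else -1) x = 0}"
    by auto
  then show ?thesis using D4[of "{uexp i, uexp j}" N] N by (intro definable_predI[of N]) (auto simp: depends_below_def)
qed (simp add: pred_True)

lemma pred_coord_const: "definable_pred (\<lambda>x. x 0 = c)"
proof -
  have ne: "uexp 0 \<noteq> (\<lambda>l. 0)" by (auto simp: uexp_def fun_eq_iff)
  have "poly_value 1 {uexp 0, \<lambda>l. 0} (\<lambda>\<alpha>. if \<alpha> = uexp 0 then 1 else - c) x = x 0 - c" for x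
    using ne by (auto simp: poly_value_def prod_uexp) (simp add: uexp_def)
  then have "{x \<in> Rn 1. x 0 = c} = {x \<in> Rn 1. poly_value 1 {uexp 0, \<lambda>l. 0} (\<lambda>\<alpha>. if \<alpha> = uexp 0 then 1 else - c) x = 0}" by auto
  then show ?thesis using D4[of "{uexp 0, \<lambda>l. 0}" 1] by (intro definable_predI[of 1]) (auto simp: depends_below_def)
qed

lemma pred_coord_add: "definable_pred (\<lambda>x. x 0 = x (Suc 0) + x 2)"
proof -
  let ?E = "{uexp 0, uexp 1, uexp 2}"
  have "poly_value 3 ?E (\<lambda>\<alpha>. if \<alpha> = uexp 0 then 1 else -1) x = x 0 - x 1 - x 2" for x
    by (simp add: poly_value_def prod_uexp)
  then have "{x \<in> Rn 3. x 0 = x (Suc 0) + x 2} = {x \<in> Rn 3. poly_value 3 ?E (\<lambda>\<alpha>. if \<alpha> = uexp 0 then 1 else -1) x = 0}" by auto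
  then show ?thesis using D4[of ?E 3] by (intro definable_predI[of 3]) (auto simp: depends_below_def)
qed

lemma pred_coord_mult: "definable_pred (\<lambda>x. x 0 = x (Suc 0) * x 2)"
proof -
  define \<beta> where "\<beta> = (\<lambda>l. uexp 1 l + uexp 2 l)"
  have ne: "uexp 0 \<noteq> \<beta>" by (auto simp: \<beta>_def uexp_def fun_eq_iff dest: spec[of _ 0])
  have "(\<Prod>l<3. x l ^ \<beta> l) = x 1 * (x 2 :: real)" for x
    by (simp add: \<beta>_def power_add prod.distrib prod_uexp)
  then have "poly_value 3 {uexp 0, \<beta>} (\<lambda>\<alpha>. if \<alpha> = uexp 0 then 1 else -1) x = x 0 - x 1 * x 2" for x
    using ne by (simp add: poly_value_def prod_uexp)
  then have "{x \<in> Rn 3. x 0 = x (Suc 0) * x 2} = {x \<in> Rn 3. poly_value 3 {uexp 0, \<beta>} (\<lambda>\<alpha>. if \<alpha> = uexp 0 then 1 else -1) x = 0}" by auto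
  then show ?thesis using D4[of "{uexp 0, \<beta>}" 3] by (intro definable_predI[of 3]) (auto simp: depends_below_def)
qed

lemma D_shift:
  assumes "{x \<in> Rn N. P x} \<in> D N"
  shows "{x \<in> Rn (k + N). P (\<lambda>i. x (k + i))} \<in> D (k + N)"
proof (induction k)
  case (Suc k)
  then show ?case using D2_left[OF Suc.IH] joined_prod_left[of "k + N" "\<lambda>x. P (\<lambda>i. x (k + i))"] by simp
qed (use assms in simp)

lemma D_proj: "A \<in> D (M + k) \<Longrightarrow> proj M ` A \<in> D M"
proof (induction k arbitrary: A)
  case 0
  then show ?case using D_subset[OF 0] proj_Rn by (metis add_0_right image_cong image_ident subsetD)
next
  case (Suc k)
  have "proj (M + k) ` A \<in> D (M + k)" using D3[of A "M + k"] Suc.prems by simp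
  from Suc.IH[OF this] have "proj M ` (proj (M + k) ` A) \<in> D M" .
  moreover have "proj M (proj (M + k) x) = proj M x" for x by (auto simp: proj_def)
  ultimately show ?case by (simp add: image_image)
qed

text \<open>The set of all \<open>(x, y)\<close> with \<open>P y\<close> and \<open>y i = x (\<sigma> i)\<close> for the entries \<open>i\<close> that matter is definable, and the required set is
  its projection to \<open>x\<close>.\<close>

lemma pred_rename:
  assumes "definable_pred P"
  shows "definable_pred (\<lambda>x. P (\<lambda>i. x (\<sigma> i)))"
proof -
  obtain N where N: "depends_below N P" "{x \<in> Rn N. P x} \<in> D N" using assms by (auto simp: definable_pred_def)
  define M where "M = Suc (Max (insert 0 (\<sigma> ` {..<N})))"
  have \<sigma>: "\<sigma> i < M" if "i < N" for i unfolding M_def using that by (intro le_imp_less_Suc Max_ge) auto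
  have dep: "depends_below M (\<lambda>x. P (\<lambda>i. x (\<sigma> i)))"
    using N(1) \<sigma> by (auto simp: depends_below_def)
  define B where "B = {z \<in> Rn (M + N). P (\<lambda>i. z (M + i))}"
  define C where "C = {z \<in> Rn (M + N). \<forall>i<N. z (M + i) = z (\<sigma> i)}"
  have B: "B \<in> D (M + N)" unfolding B_def by (rule D_shift[OF N(2)])
  have "depends_below (M + N) (\<lambda>z. \<forall>i<N. z (M + i) = z (\<sigma> i))"
    using \<sigma> by (fastforce simp: depends_below_def)
  then have C: "C \<in> D (M + N)" unfolding C_def by (intro pred_D pred_ball_lessThan pred_coord_eq)
  have "proj M ` (B \<inter> C) = {x \<in> Rn M. P (\<lambda>i. x (\<sigma> i))}"
  proof (intro subset_antisym subsetI)
    fix x assume "x \<in> proj M ` (B \<inter> C)"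
    then obtain z where z: "z \<in> B" "z \<in> C" "x = proj M z" by auto
    have "P (\<lambda>i. x (\<sigma> i)) = P (\<lambda>i. z (M + i))"
      by (rule depends_belowD[OF N(1)]) (use z \<sigma> in \<open>auto simp: C_def proj_def\<close>)
    then show "x \<in> {x \<in> Rn M. P (\<lambda>i. x (\<sigma> i))}" using z by (auto simp: B_def)
  next
    fix x assume x: "x \<in> {x \<in> Rn M. P (\<lambda>i. x (\<sigma> i))}"
    define z where "z = (\<lambda>i. if i < M then x i else if i < M + N then x (\<sigma> (i - M)) else 0)"
    have zi: "z (M + i) = x (\<sigma> i)" "z (\<sigma> i) = x (\<sigma> i)" if "i < N" for i using that \<sigma>[OF that] by (auto simp: z_def)
    have "P (\<lambda>i. z (M + i)) = P (\<lambda>i. x (\<sigma> i))" by (rule depends_belowD[OF N(1)]) (simp add: zi)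
    then have "z \<in> B \<inter> C" using x zi by (auto simp: B_def C_def) (auto simp: z_def Rn_iff)
    moreover have "proj M z = x" using x by (auto simp: z_def proj_def Rn_iff fun_eq_iff)
    ultimately show "x \<in> proj M ` (B \<inter> C)" by blast
  qed
  then show ?thesis using D_proj[OF D_Int[OF B C]] dep by (intro definable_predI[of M]) simp_all
qed

text \<open>The bound variable is entry \<open>0\<close> of the environment in the premise. It is moved to the last relevant entry,
  because the projection axiom concerns the last coordinate.\<close>

lemma pred_ex:
  assumes "definable_pred (\<lambda>e. P (e 0) (\<lambda>i. e (Suc i)))"
  shows "definable_pred (\<lambda>e. \<exists>t. P t e)"
proof -
  obtain N0 where "depends_below N0 (\<lambda>e. P (e 0) (\<lambda>i. e (Suc i)))" using pred_depends[OF assms] by blast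
  then have dep: "depends_below (Suc N0) (\<lambda>e. P (e 0) (\<lambda>i. e (Suc i)))" by (rule depends_below_mono) simp
  define N where "N = N0"
  have P: "P t x = P t y" if "\<And>i. i < N \<Longrightarrow> x i = y i" for t x y
  proof -
    have "case_nat t x i = case_nat t y i" if "i < Suc N0" for i
      using that \<open>\<And>i. i < N \<Longrightarrow> x i = y i\<close> by (cases i) (auto simp: N_def)
    from depends_belowD[OF dep, of "case_nat t x" "case_nat t y", OF this] show ?thesis by simp
  qed
  have "definable_pred (\<lambda>e. P (e (case 0 of 0 \<Rightarrow> N | Suc k \<Rightarrow> k)) (\<lambda>i. e (case Suc i of 0 \<Rightarrow> N | Suc k \<Rightarrow> k)))"
    by (rule pred_rename[OF assms, of "\<lambda>i. case i of 0 \<Rightarrow> N | Suc k \<Rightarrow> k"])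
  then have "definable_pred (\<lambda>e. P (e N) e)" by simp
  moreover have "depends_below (Suc N) (\<lambda>e. P (e N) e)"
    unfolding depends_below_def
  proof (intro allI impI)
    fix x y :: "nat \<Rightarrow> real" assume "\<forall>i<Suc N. x i = y i"
    then show "P (x N) x = P (y N) y" using P[of x y "x N"] by simp
  qed
  ultimately have "{x \<in> Rn (Suc N). P (x N) x} \<in> D (Suc N)" by (rule pred_D)
  then have "proj N ` {x \<in> Rn (Suc N). P (x N) x} \<in> D N" using D3[of _ N] by simp
  also have "proj N ` {x \<in> Rn (Suc N). P (x N) x} = {x \<in> Rn N. \<exists>t. P t x}"
  proof (intro subset_antisym subsetI)
    fix y assume "y \<in> proj N ` {x \<in> Rn (Suc N). P (x N) x}"
    then obtain x where x: "P (x N) x" "y = proj N x" by auto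
    have "P (x N) y" using P[of x y "x N"] x by (simp add: proj_def)
    then show "y \<in> {x \<in> Rn N. \<exists>t. P t x}" using x by auto
  next
    fix y assume "y \<in> {x \<in> Rn N. \<exists>t. P t x}"
    then obtain t where y: "y \<in> Rn N" "P t y" by auto
    have "P t (y(N := t))" using P[of y "y(N := t)" t] y by simp
    then have mem: "y(N := t) \<in> {x \<in> Rn (Suc N). P (x N) x}" using y by (auto simp: Rn_iff)
    have "y = proj N (y(N := t))" using y by (auto simp: proj_def Rn_iff fun_eq_iff)
    then show "y \<in> proj N ` {x \<in> Rn (Suc N). P (x N) x}" by (rule image_eqI[OF _ mem])
  qed
  finally have "{x \<in> Rn N. \<exists>t. P t x} \<in> D N" .
  moreover have "depends_below N (\<lambda>e. \<exists>t. P t e)"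
    unfolding depends_below_def
  proof (intro allI impI)
    fix x y :: "nat \<Rightarrow> real" assume "\<forall>i<N. x i = y i"
    then have "P t x = P t y" for t by (intro P) simp
    then show "(\<exists>t. P t x) = (\<exists>t. P t y)" by simp
  qed
  ultimately show ?thesis by (intro definable_predI)
qed

lemma pred_all:
  assumes "definable_pred (\<lambda>e. P (e 0) (\<lambda>i. e (Suc i)))"
  shows "definable_pred (\<lambda>e. \<forall>t. P t e)"
  using pred_not[OF pred_ex[of "\<lambda>t e. \<not> P t e", OF pred_not[OF assms]]] by simp

lemma pred_plug:
  assumes P: "definable_pred (\<lambda>e. P (e 0) (\<lambda>i. e (Suc i)))" and g: "definable_term g"
  shows "definable_pred (\<lambda>e. P (g e) e)"
proof -
  have "definable_pred (\<lambda>e. \<exists>t. t = g e \<and> P t e)" by (rule pred_ex, rule pred_conj, rule g[unfolded definable_term_def], rule P)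
  then show ?thesis by simp
qed

lemma term_rename:
  assumes "definable_term g" shows "definable_term (\<lambda>e. g (\<lambda>i. e (\<sigma> i)))"
  using pred_rename[OF assms[unfolded definable_term_def], of "case_nat 0 (\<lambda>i. Suc (\<sigma> i))"] by (simp add: definable_term_def)

text \<open>Invariant for substituting one entry at a time: the first \<open>k\<close> entries of \<open>Q\<close> are replaced by terms, and the
  others are the environment.\<close>

lemma pred_subst_finite:
  assumes X: "\<And>i. definable_term (\<lambda>e. X e i)"
  shows "definable_pred Q \<Longrightarrow> definable_pred (\<lambda>e. Q (\<lambda>i. if i < k then X e i else e (i - k)))"
proof (induction k arbitrary: Q)
  case (Suc k)
  define P where "P t z = Q (\<lambda>i. if i < k then z i else if i = k then t else z (i - 1))" for t z
  have "definable_pred (\<lambda>e. Q (\<lambda>i. e (if i < k then Suc i else if i = k then 0 else i)))" by (rule pred_rename[OF Suc.prems])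
  also have "(\<lambda>e. Q (\<lambda>i. e (if i < k then Suc i else if i = k then 0 else i))) = (\<lambda>e. P (e 0) (\<lambda>i. e (Suc i)))"
    unfolding P_def by (intro ext arg_cong[where f = Q]) auto
  finally have "definable_pred (\<lambda>z. P (X (\<lambda>j. z (k + j)) k) z)"
    by (rule pred_plug) (rule term_rename[OF X])
  from Suc.IH[OF this] have "definable_pred (\<lambda>e. P (X (\<lambda>j. if k + j < k then X e (k + j) else e (k + j - k)) k) (\<lambda>i. if i < k then X e i else e (i - k)))" .
  also have "(\<lambda>e. P (X (\<lambda>j. if k + j < k then X e (k + j) else e (k + j - k)) k) (\<lambda>i. if i < k then X e i else e (i - k))) =
     (\<lambda>e. Q (\<lambda>i. if i < Suc k then X e i else e (i - Suc k)))"
    unfolding P_def by (intro ext arg_cong[where f = Q]) (auto simp: less_Suc_eq)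
  finally show ?case .
qed simp

lemma pred_subst:
  assumes P: "definable_pred P" and X: "\<And>i. definable_term (\<lambda>e. X e i)"
  shows "definable_pred (\<lambda>e. P (X e))"
proof -
  obtain N where N: "depends_below N P" using pred_depends[OF P] by blast
  have "(\<lambda>e. P (\<lambda>i. if i < N then X e i else e (i - N))) = (\<lambda>e. P (X e))"
    by (intro ext depends_belowD[OF N]) simp
  then show ?thesis using pred_subst_finite[of X P N, OF X P] by simp
qed

lemma term_var: "definable_term (\<lambda>e. e k)"
  unfolding definable_term_def by (rule pred_coord_eq)

lemma term_subst:
  assumes g: "definable_term g" and X: "\<And>i. definable_term (\<lambda>e. X e i)"
  shows "definable_term (\<lambda>e. g (X e))"
proof -
  have "definable_pred (\<lambda>e. (case_nat (e 0) (X (\<lambda>i. e (Suc i)))) 0 = g (\<lambda>i. (case_nat (e 0) (X (\<lambda>i. e (Suc i)))) (Suc i)))"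
  proof (rule pred_subst[OF g[unfolded definable_term_def]])
    show "definable_term (\<lambda>e. case_nat (e 0) (X (\<lambda>i. e (Suc i))) i)" for i
      by (cases i) (simp_all add: term_var term_rename[OF X, of Suc])
  qed
  then show ?thesis by (simp add: definable_term_def)
qed

lemma term_const: "definable_term (\<lambda>e. c)"
  unfolding definable_term_def by (rule pred_coord_const)

lemma term_binary:
  assumes "definable_pred (\<lambda>x. x 0 = opp (x (Suc 0)) (x 2))" "definable_term g" "definable_term h"
  shows "definable_term (\<lambda>e. opp (g e) (h e))"
proof -
  define X where "X e i = (if i = 0 then e 0 else if i = Suc 0 then g (\<lambda>i. e (Suc i)) else h (\<lambda>i. e (Suc i)))" for e and i :: nat
  have "definable_term (\<lambda>e. X e i)" for i
    unfolding X_def by (cases "i = 0"; cases "i = Suc 0") (simp_all add: term_var term_rename[OF assms(2), of Suc] term_rename[OF assms(3), of Suc])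
  from pred_subst[OF assms(1), of X, OF this] show ?thesis by (simp add: definable_term_def X_def)
qed

lemma term_add: "definable_term g \<Longrightarrow> definable_term h \<Longrightarrow> definable_term (\<lambda>e. g e + h e)"
  by (rule term_binary[OF pred_coord_add])

lemma term_mult: "definable_term g \<Longrightarrow> definable_term h \<Longrightarrow> definable_term (\<lambda>e. g e * h e)"
  by (rule term_binary[OF pred_coord_mult])

lemma term_diff: "definable_term g \<Longrightarrow> definable_term h \<Longrightarrow> definable_term (\<lambda>e. g e - h e)"
  using term_add[of g "\<lambda>e. -1 * h e"] term_mult[OF term_const[of "-1"], of h] by simp

lemma term_sum: "(\<And>i. i < (k::nat) \<Longrightarrow> definable_term (g i)) \<Longrightarrow> definable_term (\<lambda>e. \<Sum>i<k. g i e)"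
  by (induction k) (auto intro: term_const term_add)

lemma pred_rel:
  assumes R: "definable_pred (\<lambda>e. R (e 0) (e (Suc 0)))" and g: "definable_term g" and h: "definable_term h"
  shows "definable_pred (\<lambda>e. R (g e) (h e))"
proof -
  define X where "X e i = (if i = 0 then g e else h e)" for e and i :: nat
  have "definable_term (\<lambda>e. X e i)" for i unfolding X_def using g h by (cases "i = 0") simp_all
  from pred_subst[OF R, of X, OF this] show ?thesis by (simp add: X_def)
qed

lemma pred_eq: "definable_term g \<Longrightarrow> definable_term h \<Longrightarrow> definable_pred (\<lambda>e. g e = h e)"
  by (rule pred_rel[where R = "(=)"], rule pred_coord_eq)

lemma pred_less: "definable_term g \<Longrightarrow> definable_term h \<Longrightarrow> definable_pred (\<lambda>e. g e < h e)"
proof (rule pred_rel[where R = "(<)"])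
  have "definable_pred (\<lambda>e. \<exists>t. \<not> t = 0 \<and> e (Suc 0) = e 0 + t * t)"
    by (rule pred_ex) (intro pred_conj pred_not pred_eq term_add term_mult term_var term_const)
  also have "(\<lambda>e. \<exists>t. \<not> t = 0 \<and> e (Suc 0) = e 0 + t * t) = (\<lambda>e. e 0 < (e (Suc 0) :: real))"
  proof (intro ext iffI)
    fix e :: "nat \<Rightarrow> real" assume "e 0 < e (Suc 0)"
    then show "\<exists>t. \<not> t = 0 \<and> e (Suc 0) = e 0 + t * t" by (intro exI[of _ "sqrt (e (Suc 0) - e 0)"]) auto
  next
    fix e :: "nat \<Rightarrow> real" assume "\<exists>t. \<not> t = 0 \<and> e (Suc 0) = e 0 + t * t"
    then obtain t where "t \<noteq> 0" "e (Suc 0) = e 0 + t * t" by blast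
    moreover have "t * t > 0" using \<open>t \<noteq> 0\<close> by (metis not_real_square_gt_zero)
    ultimately show "e 0 < e (Suc 0)" by linarith
  qed
  finally show "definable_pred (\<lambda>e. e 0 < e (Suc 0))" .
qed

lemma pred_le: "definable_term g \<Longrightarrow> definable_term h \<Longrightarrow> definable_pred (\<lambda>e. g e \<le> h e)"
  using pred_not[OF pred_less[of h g]] by (simp add: not_less)

lemma term_abs:
  assumes "definable_term g" shows "definable_term (\<lambda>e. \<bar>g e\<bar>)"
proof -
  have g': "definable_term (\<lambda>e. g (\<lambda>i. e (Suc i)))" by (rule term_rename[OF assms])
  have "definable_pred (\<lambda>e. (0 \<le> g (\<lambda>i. e (Suc i)) \<and> e 0 = g (\<lambda>i. e (Suc i))) \<or> (g (\<lambda>i. e (Suc i)) < 0 \<and> e 0 = 0 - g (\<lambda>i. e (Suc i))))"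
    by (intro pred_disj pred_conj pred_eq pred_less pred_le term_diff g' term_var term_const)
  also have "(\<lambda>e. (0 \<le> g (\<lambda>i. e (Suc i)) \<and> e 0 = g (\<lambda>i. e (Suc i))) \<or> (g (\<lambda>i. e (Suc i)) < 0 \<and> e 0 = 0 - g (\<lambda>i. e (Suc i))))
     = (\<lambda>e. e 0 = \<bar>g (\<lambda>i. e (Suc i))\<bar>)" by (auto simp: fun_eq_iff)
  finally show ?thesis by (simp add: definable_term_def)
qed

lemma pred_bex_Rn:
  "definable_pred (\<lambda>e. Q (proj n e) (\<lambda>i. e (n + i))) \<Longrightarrow> definable_pred (\<lambda>e. \<exists>x\<in>Rn n. Q x e)"
proof (induction n arbitrary: Q)
  case 0
  have "proj 0 e = (\<lambda>i. 0)" for e by (simp add: proj_def)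
  moreover have "(\<exists>x\<in>Rn 0. Q x e) = Q (\<lambda>i. 0) e" for e
  proof -
    have "Rn 0 = {\<lambda>i. 0}" by (auto simp: Rn_iff)
    then show ?thesis by simp
  qed
  ultimately show ?case using 0 by simp
next
  case (Suc n)
  have upd: "(proj n e)(n := e n) = proj (Suc n) e" for e by (auto simp: proj_def fun_eq_iff less_Suc_eq)
  have "definable_pred (\<lambda>e. \<exists>x\<in>Rn n. Q (x(n := e 0)) (\<lambda>i. e (Suc i)))"
  proof (rule Suc.IH)
    show "definable_pred (\<lambda>e. Q ((proj n e)(n := e (n + 0))) (\<lambda>i. e (n + Suc i)))"
      using Suc.prems by (simp add: upd)
  qed
  then have "definable_pred (\<lambda>e. \<exists>t. \<exists>x\<in>Rn n. Q (x(n := t)) e)" by (rule pred_ex)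
  also have "(\<lambda>e. \<exists>t. \<exists>x\<in>Rn n. Q (x(n := t)) e) = (\<lambda>e. \<exists>x\<in>Rn (Suc n). Q x e)"
  proof (intro ext iffI)
    fix e assume "\<exists>t. \<exists>x\<in>Rn n. Q (x(n := t)) e"
    then obtain t x where "x \<in> Rn n" "Q (x(n := t)) e" by blast
    moreover have "x(n := t) \<in> Rn (Suc n)" using \<open>x \<in> Rn n\<close> by (auto simp: Rn_iff)
    ultimately show "\<exists>x\<in>Rn (Suc n). Q x e" by blast
  next
    fix e assume "\<exists>x\<in>Rn (Suc n). Q x e"
    then obtain x where x: "x \<in> Rn (Suc n)" "Q x e" by blast
    have "(proj n x)(n := x n) = x" using upd[of x] proj_Rn[OF x(1)] by simp
    then show "\<exists>t. \<exists>x\<in>Rn n. Q (x(n := t)) e" using x by (intro exI[of _ "x n"] bexI[of _ "proj n x"]) auto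
  qed
  finally show ?case .
qed

lemma pred_ball_Rn:
  "definable_pred (\<lambda>e. Q (proj n e) (\<lambda>i. e (n + i))) \<Longrightarrow> definable_pred (\<lambda>e. \<forall>x\<in>Rn n. Q x e)"
  using pred_not[OF pred_bex_Rn[of "\<lambda>x e. \<not> Q x e" n]] pred_not by simp

lemma term_definable_fun:
  assumes "definable_fun D n f"
  shows "definable_term (\<lambda>e. f (proj n e))"
proof -
  have "{join n x (vec1 (f x)) |x. x \<in> Rn n} = {z \<in> Rn (n + 1). z n = f (proj n z)}"
  proof (intro subset_antisym subsetI)
    fix z assume "z \<in> {join n x (vec1 (f x)) |x. x \<in> Rn n}"
    then obtain x where x: "x \<in> Rn n" "z = join n x (vec1 (f x))" by blast
    have "proj n z = x" "z n = f x" using x by (simp add: proj_Rn, simp add: join_def vec1_def)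
    moreover have "z \<in> Rn (n + 1)" unfolding x(2) by (rule join_in_Rn) (auto simp: vec1_def Rn_iff)
    ultimately show "z \<in> {z \<in> Rn (n + 1). z n = f (proj n z)}" by simp
  next
    fix z assume z: "z \<in> {z \<in> Rn (n + 1). z n = f (proj n z)}"
    have "z i = join n (proj n z) (vec1 (f (proj n z))) i" for i
      using z by (cases "i < n"; cases "i = n") (auto simp: join_def proj_def vec1_def Rn_iff)
    then have "z = join n (proj n z) (vec1 (f (proj n z)))" by (rule ext)
    then show "z \<in> {join n x (vec1 (f x)) |x. x \<in> Rn n}" using proj_in_Rn by blast
  qed
  then have "{z \<in> Rn (n + 1). z n = f (proj n z)} \<in> D (n + 1)" using assms by (simp add: definable_fun_def)
  moreover have "depends_below (n + 1) (\<lambda>z. z n = f (proj n z))"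
    unfolding depends_below_def
  proof (intro allI impI)
    fix x y :: "nat \<Rightarrow> real" assume "\<forall>i<n + 1. x i = y i"
    then have "proj n x = proj n y" "x n = y n" by (auto simp: proj_def fun_eq_iff)
    then show "(x n = f (proj n x)) = (y n = f (proj n y))" by simp
  qed
  ultimately have "definable_pred (\<lambda>z. z n = f (proj n z))" by (intro definable_predI)
  from pred_rename[OF this, of "\<lambda>i. if i < n then Suc i else 0"]
  have "definable_pred (\<lambda>e. e 0 = f (proj n (\<lambda>i. e (if i < n then Suc i else 0))))" by simp
  moreover have "proj n (\<lambda>i. e (if i < n then Suc i else 0)) = proj n (\<lambda>i. e (Suc i))" for e
    by (auto simp: proj_def)
  ultimately show ?thesis by (simp add: definable_term_def)
qed

subsection \<open>Definable sets of real numbers\<close>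

lemma definable_reals:
  assumes "definable_pred (\<lambda>e. Q (e 0))"
  obtains I :: "real set set" where "finite I" "\<And>S. S \<in> I \<Longrightarrow> is_interval S" "{t. Q t} = \<Union>I"
proof -
  have "{x \<in> Rn 1. Q (x 0)} \<in> D 1" using assms by (rule pred_D) (auto simp: depends_below_def)
  from D5[OF this] obtain I :: "real set set" where I: "finite I" "\<forall>S\<in>I. is_interval S" "(\<lambda>x. x 0) ` {x \<in> Rn 1. Q (x 0)} = \<Union>I" by blast
  have "(\<lambda>x. x 0) ` {x \<in> Rn 1. Q (x 0)} = {t. Q t}"
  proof (intro subset_antisym subsetI)
    fix t assume "t \<in> {t. Q t}"
    then have "vec1 t \<in> {x \<in> Rn 1. Q (x 0)}" "t = vec1 t 0" by (auto simp: vec1_def Rn_iff)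
    then show "t \<in> (\<lambda>x. x 0) ` {x \<in> Rn 1. Q (x 0)}" by blast
  qed auto
  then show ?thesis using that[of I] I by auto
qed

lemma infinite_contains_interval:
  assumes "definable_pred (\<lambda>e. Q (e 0))" and inf: "infinite {t :: real. Q t}"
  shows "\<exists>a b. a < b \<and> (\<forall>t. a < t \<longrightarrow> t < b \<longrightarrow> Q t)"
proof -
  obtain I where I: "finite I" "\<And>S. S \<in> I \<Longrightarrow> is_interval S" "{t. Q t} = \<Union>I" using definable_reals[OF assms(1)] by blast
  then obtain S where S: "S \<in> I" "infinite S" using inf finite_Union[of I] by auto
  obtain a where a: "a \<in> S" using S(2) by (metis ex_in_conv finite.emptyI)
  obtain b where b: "b \<in> S" "b \<noteq> a" using S(2) a by (metis finite.emptyI finite_insert insertI1 singleton_iff subsetI finite_subset)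
  have "t \<in> S" if "min a b < t" "t < max a b" for t
    using I(2)[OF S(1)] a b(1) that unfolding is_interval_1 by (metis less_imp_le max_def min_def)
  then have "Q t" if "min a b < t" "t < max a b" for t using that I(3) S(1) by blast
  then show ?thesis using b(2) by (intro exI[of _ "min a b"] exI[of _ "max a b"]) auto
qed

text \<open>Among finitely many intervals that cover an unbounded set one is unbounded.\<close>

lemma unbounded_contains_ray:
  assumes "definable_pred (\<lambda>e. Q (e 0))" and unb: "\<And>R :: real. \<exists>r\<ge>R. Q r"
  shows "\<exists>R. \<forall>r\<ge>R. Q r"
proof -
  obtain I where I: "finite I" "\<And>S. S \<in> I \<Longrightarrow> is_interval S" "{t. Q t} = \<Union>I" using definable_reals[OF assms(1)] by blast
  have "\<exists>S\<in>I. \<not> bdd_above S"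
  proof (rule ccontr)
    assume "\<not> ?thesis"
    then have "bdd_above (\<Union>I)" using I(1) bdd_above_UN[of I "\<lambda>S. S"] by simp
    then obtain M where "\<And>t. Q t \<Longrightarrow> t \<le> M" using I(3) unfolding bdd_above_def by blast
    then show False using unb[of "M + 1"] by fastforce
  qed
  then obtain S where S: "S \<in> I" "\<not> bdd_above S" by (elim bexE) (rule that)
  then obtain s where s: "s \<in> S" by (metis bdd_above_empty ex_in_conv)
  have "Q r" if "r \<ge> s" for r
  proof -
    obtain u where "u \<in> S" "r \<le> u" using S(2) unfolding bdd_above_def by (meson linear)
    then have "r \<in> S" using I(2)[OF S(1)] s that unfolding is_interval_1 by blast
    then show ?thesis using I(3) S(1) by blast
  qed
  then show ?thesis by blast
qed

end

section \<open>Finiteness of the asymptotic critical values\<close>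

text \<open>The total length of the curve in the l1 norm is \<open>V c2 - V c1 \<le> 2 * r\<close>, where \<open>V\<close> is the sum of the coordinates with signs that make them
  increasing. Near each point the value of \<open>f\<close>, which is the parameter \<open>c\<close>, changes by at most \<open>\<theta>\<close> times the length; so
  \<open>\<theta> * V c - c\<close> is locally, hence globally, nondecreasing.\<close>

lemma curve_estimate:
  fixes x :: "real \<Rightarrow> nat \<Rightarrow> real"
  assumes f: "Ck_on (Suc 0) n (Rn n) f" and c12: "c1 \<le> c2"
    and x: "\<And>c. c1 \<le> c \<Longrightarrow> c \<le> c2 \<Longrightarrow> x c \<in> Rn n \<and> f (x c) = c \<and> l1_norm n (x c) \<le> r \<and> grad_l1 n f (x c) < \<theta>"
    and \<sigma>: "\<And>i. i < n \<Longrightarrow> \<bar>\<sigma> i :: real\<bar> = 1"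
    and mono: "\<And>i s t. i < n \<Longrightarrow> c1 \<le> s \<Longrightarrow> s \<le> t \<Longrightarrow> t \<le> c2 \<Longrightarrow> \<sigma> i * x s i \<le> \<sigma> i * x t i"
    and cont: "\<And>i c. i < n \<Longrightarrow> c1 \<le> c \<Longrightarrow> c \<le> c2 \<Longrightarrow> isCont (\<lambda>c. x c i) c"
  shows "c2 - c1 \<le> 2 * r * \<theta>"
proof -
  define V where "V c = (\<Sum>i<n. \<sigma> i * x c i)" for c
  define h where "h c = \<theta> * V c - c" for c
  have var: "l1_norm n (\<lambda>i. x t i - x s i) = V t - V s" if "c1 \<le> s" "s \<le> t" "t \<le> c2" for s t
    unfolding V_def l1_norm_def sum_subtractf[symmetric]
  proof (rule sum.cong)
    fix i assume "i \<in> {..<n}"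
    then have "\<sigma> i * x s i \<le> \<sigma> i * x t i" "\<bar>\<sigma> i\<bar> = 1" using mono[OF _ that] \<sigma> by auto
    then show "\<bar>x t i - x s i\<bar> = \<sigma> i * x t i - \<sigma> i * x s i" by (auto simp: abs_if split: if_splits)
  qed simp
  have loc: "\<exists>d>0. \<forall>s. c1 \<le> s \<and> s \<le> c2 \<and> \<bar>s - c\<bar> < d \<longrightarrow> \<bar>s - c\<bar> \<le> \<theta> * l1_norm n (\<lambda>i. x s i - x c i)"
    if c: "c1 \<le> c" "c \<le> c2" for c
  proof -
    have xc: "x c \<in> Rn n" "f (x c) = c" using x[OF c] by auto
    define e where "e = \<theta> - grad_l1 n f (x c)"
    have e: "e > 0" using x[OF c] by (simp add: e_def)
    from total_differentiability[OF openin_Rn_UNIV f xc(1) e] obtain d where d: "d > 0"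
      "\<And>y. y \<in> Rn n \<Longrightarrow> (\<forall>j<n. \<bar>y j - x c j\<bar> < d) \<Longrightarrow>
        \<bar>f y - f (x c) - (\<Sum>j<n. partial_deriv j f (x c) * (y j - x c j))\<bar> \<le> e * (\<Sum>j<n. \<bar>y j - x c j\<bar>)" by blast
    have "\<forall>\<^sub>F s in nhds c. \<forall>i\<in>{..<n}. \<bar>x s i - x c i\<bar> < d"
    proof (subst eventually_ball_finite_distrib, simp, safe)
      fix i assume "i < n"
      then have "((\<lambda>s. x s i) \<longlongrightarrow> x c i) (nhds c)"
        using cont[OF _ c, of i] tendsto_at_iff_tendsto_nhds[of "\<lambda>s. x s i" c] by (simp add: isCont_def)
      from tendstoD[OF this d(1)] show "\<forall>\<^sub>F s in nhds c. \<bar>x s i - x c i\<bar> < d" by (simp add: dist_real_def)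
    qed
    then obtain d' where d': "d' > 0" "\<And>s i. \<bar>s - c\<bar> < d' \<Longrightarrow> i < n \<Longrightarrow> \<bar>x s i - x c i\<bar> < d"
      unfolding eventually_nhds_metric dist_real_def by blast
    show ?thesis
    proof (intro exI[of _ d'] conjI allI impI d'(1))
      fix s assume s: "c1 \<le> s \<and> s \<le> c2 \<and> \<bar>s - c\<bar> < d'"
      have xs: "x s \<in> Rn n" "f (x s) = s" using x[of s] s by auto
      let ?D = "\<Sum>j<n. partial_deriv j f (x c) * (x s j - x c j)"
      have "\<bar>?D\<bar> \<le> (\<Sum>j<n. grad_l1 n f (x c) * \<bar>x s j - x c j\<bar>)"
      proof (rule order_trans[OF sum_abs sum_mono])
        fix j assume "j \<in> {..<n}"
        then show "\<bar>partial_deriv j f (x c) * (x s j - x c j)\<bar> \<le> grad_l1 n f (x c) * \<bar>x s j - x c j\<bar>"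
          unfolding abs_mult by (intro mult_right_mono abs_partial_le_grad_l1) auto
      qed
      then have "\<bar>?D\<bar> \<le> grad_l1 n f (x c) * l1_norm n (\<lambda>i. x s i - x c i)" by (simp add: l1_norm_def sum_distrib_left)
      moreover have "\<bar>f (x s) - f (x c) - ?D\<bar> \<le> e * l1_norm n (\<lambda>i. x s i - x c i)"
        unfolding l1_norm_def using s d'(2) by (intro d(2) xs) auto
      ultimately have "\<bar>f (x s) - f (x c)\<bar> \<le> grad_l1 n f (x c) * l1_norm n (\<lambda>i. x s i - x c i) + e * l1_norm n (\<lambda>i. x s i - x c i)"
        by linarith
      then show "\<bar>s - c\<bar> \<le> \<theta> * l1_norm n (\<lambda>i. x s i - x c i)" by (simp add: xs xc e_def left_diff_distrib)
    qed
  qed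
  have sym: "l1_norm n (\<lambda>i. x s i - x c i) = l1_norm n (\<lambda>i. x c i - x s i)" for s c
    unfolding l1_norm_def by (intro sum.cong refl abs_minus_commute)
  have "c1 \<le> c1 \<and> c2 \<le> c2 \<longrightarrow> h c1 \<le> h c2"
  proof (induction rule: Bolzano[OF c12, where P = "\<lambda>s t. c1 \<le> s \<and> t \<le> c2 \<longrightarrow> h s \<le> h t"])
    case (1 a b c)
    then show ?case by auto
  next
    case (2 c)
    then obtain d where d: "d > 0" "\<And>s. c1 \<le> s \<Longrightarrow> s \<le> c2 \<Longrightarrow> \<bar>s - c\<bar> < d \<Longrightarrow> \<bar>s - c\<bar> \<le> \<theta> * l1_norm n (\<lambda>i. x s i - x c i)"
      using loc[of c] by blast
    show ?case
    proof (intro exI[of _ d] conjI allI impI d(1))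
      fix s t assume st: "s \<le> c \<and> c \<le> t \<and> t - s < d" "c1 \<le> s \<and> t \<le> c2"
      have "c - s \<le> \<theta> * (V c - V s)" using d(2)[of s] st var[of s c] sym[of s c] by simp
      moreover have "t - c \<le> \<theta> * (V t - V c)" using d(2)[of t] st var[of c t] by simp
      ultimately show "h s \<le> h t" by (simp add: h_def right_diff_distrib)
    qed
  qed
  then have "c2 - c1 \<le> \<theta> * (V c2 - V c1)" by (simp add: h_def right_diff_distrib)
  also have "\<dots> \<le> \<theta> * (r + r)"
  proof (rule mult_left_mono)
    have "V c2 - V c1 = l1_norm n (\<lambda>i. x c2 i - x c1 i)" using var[of c1 c2] c12 by simp
    also have "\<dots> \<le> l1_norm n (x c2) + l1_norm n (x c1)"
      unfolding l1_norm_def sum.distrib[symmetric] by (rule sum_mono) (simp add: abs_triangle_ineq4)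
    also have "\<dots> \<le> r + r" using x[of c1] x[of c2] c12 by (intro add_mono) auto
    finally show "V c2 - V c1 \<le> r + r" .
    show "0 \<le> \<theta>" using x[of c1] c12 order_trans[OF grad_l1_nonneg less_imp_le] by blast
  qed
  finally show ?thesis by (simp add: mult_ac)
qed

context o_minimal_structure begin

subsection \<open>Generic behaviour of definable families\<close>

text \<open>Countably many finite sets do not cover an interval, so one of the sets is infinite.\<close>

lemma countable_cover:
  fixes Q :: "'i :: countable \<Rightarrow> real \<Rightarrow> bool"
  assumes ab: "a < b" and Q: "\<And>k. definable_pred (\<lambda>e. Q k (e 0))" and cover: "\<And>c. a < c \<Longrightarrow> c < b \<Longrightarrow> \<exists>k. Q k c"
  shows "\<exists>k a' b'. a' < b' \<and> (\<forall>c. a' < c \<longrightarrow> c < b' \<longrightarrow> a < c \<and> c < b \<and> Q k c)"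
proof -
  have "\<exists>k. infinite {c. a < c \<and> c < b \<and> Q k c}"
  proof (rule ccontr)
    assume "\<not> ?thesis"
    then have "countable (\<Union>k. {c. a < c \<and> c < b \<and> Q k c})" by (intro countable_UN) (auto intro: countable_finite)
    moreover have "{a<..<b} \<subseteq> (\<Union>k. {c. a < c \<and> c < b \<and> Q k c})" using cover by auto
    ultimately show False using uncountable_open_interval[of a b] ab countable_subset by blast
  qed
  then obtain k where k: "infinite {c. a < c \<and> c < b \<and> Q k c}" by blast
  have "definable_pred (\<lambda>e. a < e 0 \<and> e 0 < b \<and> Q k (e 0))" by (intro pred_conj pred_less term_var term_const Q)
  from infinite_contains_interval[OF this k] show ?thesis by blast
qed

lemma pred_fix_first:
  assumes "definable_pred (\<lambda>e. P (e 0) (e (Suc 0)))"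
  shows "definable_pred (\<lambda>e. P c (e 0))"
proof -
  have "definable_term (\<lambda>e. (case_nat c e) i)" for i by (cases i) (simp_all add: term_const term_var)
  from pred_subst[OF assms, of "case_nat c", OF this] show ?thesis by simp
qed

lemma pred_swap:
  assumes "definable_pred (\<lambda>e. P (e 0) (e (Suc 0)))"
  shows "definable_pred (\<lambda>e. P (e (Suc 0)) (e 0))"
  using pred_rename[OF assms, of "case_nat (Suc 0) (\<lambda>_. 0)"] by simp

text \<open>For each \<open>c\<close> the \<open>r\<close> with \<open>P c r\<close> contain a ray; cover the interval according to the integer where the ray may
  be taken to start.\<close>

lemma uniform_ray:
  assumes ab: "a < b" and P: "definable_pred (\<lambda>e. P (e 0) (e (Suc 0)))"
    and unb: "\<And>c R. a < c \<Longrightarrow> c < b \<Longrightarrow> \<exists>r\<ge>R. P c r"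
  shows "\<exists>a' b' R. a' < b' \<and> (\<forall>c. a' < c \<longrightarrow> c < b' \<longrightarrow> a < c \<and> c < b \<and> (\<forall>r\<ge>R. P c r))"
proof -
  have "\<exists>k a' b'. a' < b' \<and> (\<forall>c. a' < c \<longrightarrow> c < b' \<longrightarrow> a < c \<and> c < b \<and> (\<forall>r. real k \<le> r \<longrightarrow> P c r))"
  proof (rule countable_cover[OF ab])
    fix k :: nat
    show "definable_pred (\<lambda>e. \<forall>r. real k \<le> r \<longrightarrow> P (e 0) r)"
      by (rule pred_all, rule pred_imp, intro pred_le term_const term_var, rule pred_swap[OF P])
  next
    fix c assume "a < c" "c < b"
    then obtain R where "\<forall>r\<ge>R. P c r" using unbounded_contains_ray[OF pred_fix_first[OF P]] unb by blast
    moreover obtain k where "R \<le> real k" using real_arch_simple by blast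
    ultimately show "\<exists>k. \<forall>r. real k \<le> r \<longrightarrow> P c r" by (intro exI[of _ k]) auto
  qed
  then show ?thesis by blast
qed

text \<open>The inversion \<open>r \<mapsto> c + 1 / r\<close> turns a right neighbourhood of \<open>c\<close> into a ray.\<close>

lemma right_germ:
  assumes Q: "definable_pred (\<lambda>e. Q (e 0))"
  shows "(\<exists>d>0. \<forall>t. c < t \<and> t < c + d \<longrightarrow> Q t) \<or> (\<exists>d>0. \<forall>t. c < t \<and> t < c + d \<longrightarrow> \<not> Q t)"
proof (cases "\<forall>R. \<exists>r\<ge>R. Q (c + inverse r)")
  case True
  have "definable_pred (\<lambda>e. \<exists>t. t * e 0 = 1 \<and> Q (c + t))"
  proof (rule pred_ex, rule pred_conj)
    show "definable_pred (\<lambda>e. e 0 * e (Suc 0) = 1)" by (intro pred_eq term_mult term_var term_const)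
    have "definable_term (\<lambda>e. c + e 0)" by (intro term_add term_var term_const)
    then show "definable_pred (\<lambda>e. Q (c + e 0))" using pred_subst[OF Q, of "\<lambda>e i. c + e 0"] by simp
  qed
  moreover have "\<exists>r\<ge>R. \<exists>t. t * r = 1 \<and> Q (c + t)" for R
  proof -
    obtain r where "r \<ge> max R 1" "Q (c + inverse r)" using True by blast
    then show ?thesis by (intro exI[of _ r] conjI exI[of _ "inverse r"]) auto
  qed
  ultimately obtain R where R: "\<And>r. r \<ge> R \<Longrightarrow> \<exists>t. t * r = 1 \<and> Q (c + t)"
    using unbounded_contains_ray[of "\<lambda>r. \<exists>t. t * r = 1 \<and> Q (c + t)"] by blast
  define d where "d = inverse (max R 1)"
  have "Q t" if t: "c < t" "t < c + d" for t
  proof -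
    have tc: "0 < t - c" "t - c < inverse (max R 1)" using t by (auto simp: d_def)
    then have "max R 1 < inverse (t - c)" by (metis inverse_inverse_eq less_imp_inverse_less)
    then obtain u where "u * inverse (t - c) = 1" "Q (c + u)" using R[of "inverse (t - c)"] by auto
    then have "u = t - c" using tc by (simp add: field_simps)
    then show ?thesis using \<open>Q (c + u)\<close> by simp
  qed
  moreover have "d > 0" by (simp add: d_def)
  ultimately show ?thesis by blast
next
  case False
  then obtain R where R: "\<And>r. r \<ge> R \<Longrightarrow> \<not> Q (c + inverse r)" by blast
  define d where "d = inverse (max R 1)"
  have "\<not> Q t" if t: "c < t" "t < c + d" for t
  proof -
    have tc: "0 < t - c" "t - c < inverse (max R 1)" using t by (auto simp: d_def)
    then have "max R 1 < inverse (t - c)" by (metis inverse_inverse_eq less_imp_inverse_less)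
    then show ?thesis using R[of "inverse (t - c)"] by simp
  qed
  moreover have "d > 0" by (simp add: d_def)
  ultimately show ?thesis by blast
qed

text \<open>Spelled out with quantifiers over real numbers only, so that its definability in \<open>c\<close> and in parameters of \<open>g\<close> can be read off.\<close>

definition tame_at :: "real \<Rightarrow> (real \<Rightarrow> real) \<Rightarrow> real \<Rightarrow> bool"
  where "tame_at \<sigma> g c \<longleftrightarrow> (\<exists>d. 0 < d \<and> (\<forall>s t. \<bar>s - c\<bar> < d \<and> \<bar>t - c\<bar> < d \<and> s \<le> t \<longrightarrow> \<sigma> * g s \<le> \<sigma> * g t)) \<and>
    (\<forall>e. 0 < e \<longrightarrow> (\<exists>d. 0 < d \<and> (\<forall>s. \<bar>s - c\<bar> < d \<longrightarrow> \<bar>g s - g c\<bar> < e)))"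

lemma tame_at_isCont: "tame_at \<sigma> g c \<Longrightarrow> isCont g c"
  unfolding tame_at_def continuous_at_eps_delta dist_real_def by blast

lemma term_fix_second:
  assumes "definable_term (\<lambda>e. h (e 0) (e (Suc 0)))" shows "definable_term (\<lambda>e. h (e 0) c)"
proof -
  have "definable_term (\<lambda>e. (case i of 0 \<Rightarrow> e 0 | Suc _ \<Rightarrow> c))" for i :: nat by (cases i) (simp_all add: term_const term_var)
  from term_subst[OF assms, of "\<lambda>e i. case i of 0 \<Rightarrow> e 0 | Suc _ \<Rightarrow> c", OF this] show ?thesis by simp
qed

text \<open>Immediately to the right of a point, the values of \<open>g\<close> are all greater than, all equal to or all less than its value at the point. On
  some interval the same case holds for all points, to the right within a common distance \<open>1 / (k + 1)\<close>; on an interval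
  shorter than that, \<open>g\<close> is monotone, and therefore continuous at all but countably many points.\<close>

lemma tame_point_exists:
  assumes g: "definable_term (\<lambda>e. g (e 0))" and ab: "a < b"
  shows "\<exists>c. a < c \<and> c < b \<and> (tame_at 1 g c \<or> tame_at (-1) g c)"
proof -
  have gk: "definable_term (\<lambda>e. g (e k))" for k using term_rename[OF g, of "\<lambda>_. k"] by simp
  \<comment> \<open>The index \<open>j\<close> selects the case, and \<open>1 / (k + 1)\<close> is the distance up to which it holds.\<close>
  define Q where "Q = (\<lambda>(j :: nat, k :: nat) c. \<forall>t. c < t \<and> t < c + inverse (real k + 1) \<longrightarrow>
    (if j = 0 then g c < g t else if j = 1 then g c = g t else g t < g c))"
  have "\<exists>q a' b'. a' < b' \<and> (\<forall>c. a' < c \<longrightarrow> c < b' \<longrightarrow> a < c \<and> c < b \<and> Q q c)"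
  proof (rule countable_cover[OF ab])
    fix q :: "nat \<times> nat"
    obtain j k where q: "q = (j, k)" by (cases q)
    have "definable_pred (\<lambda>e. if j = 0 then g (e (Suc 0)) < g (e 0) else if j = 1 then g (e (Suc 0)) = g (e 0) else g (e 0) < g (e (Suc 0)))"
      using pred_less[OF gk gk] pred_eq[OF gk gk] by (cases "j = 0"; cases "j = 1") simp_all
    then show "definable_pred (\<lambda>e. Q q (e 0))"
      unfolding Q_def q prod.case
      by (intro pred_all pred_imp pred_conj pred_less term_var term_add term_const)
  next
    fix c assume "a < c" "c < b"
    have gt: "\<exists>k. Q (j, k) c" if H: "d > 0" "\<forall>t. c < t \<and> t < c + d \<longrightarrow>
       (if j = 0 then g c < g t else if j = 1 then g c = g t else g t < g c)" for d j
    proof -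
      obtain k where "inverse (real (Suc k)) < d" using reals_Archimedean[OF H(1)] by blast
      then show ?thesis using H(2) by (intro exI[of _ k]) (auto simp: Q_def add.commute)
    qed
    consider d where "d > 0" "\<forall>t. c < t \<and> t < c + d \<longrightarrow> g c < g t" | d where "d > 0" "\<forall>t. c < t \<and> t < c + d \<longrightarrow> \<not> g c < g t"
      using right_germ[of "\<lambda>t. g c < g t" c, OF pred_less[OF term_const g]] by blast
    then show "\<exists>q. Q q c"
    proof cases
      case 1
      then show ?thesis using gt[of d 0] by auto
    next
      case 2
      consider d' where "d' > 0" "\<forall>t. c < t \<and> t < c + d' \<longrightarrow> g t < g c" | d' where "d' > 0" "\<forall>t. c < t \<and> t < c + d' \<longrightarrow> \<not> g t < g c"
        using right_germ[of "\<lambda>t. g t < g c" c, OF pred_less[OF g term_const]] by blast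
      then show ?thesis
      proof cases
        case 1
        then show ?thesis using gt[of d' 2] by auto
      next
        case 2
        then have "\<forall>t. c < t \<and> t < c + min d d' \<longrightarrow> g c = g t" using \<open>\<forall>t. c < t \<and> t < c + d \<longrightarrow> \<not> g c < g t\<close> by force
        then show ?thesis using gt[of "min d d'" 1] \<open>d > 0\<close> \<open>d' > 0\<close> by auto
      qed
    qed
  qed
  then obtain j k a' b' where ab': "a' < b'" "\<And>c. a' < c \<Longrightarrow> c < b' \<Longrightarrow> a < c \<and> c < b \<and> Q (j, k) c" by auto
  define b'' where "b'' = min b' (a' + inverse (real k + 1))"
  have b'': "a' < b''" using ab'(1) by (simp add: b''_def)
  define \<sigma> :: real where "\<sigma> = (if j = 0 \<or> j = 1 then 1 else -1)"
  have mono: "\<sigma> * g s \<le> \<sigma> * g t" if "a' < s" "s \<le> t" "t < b''" for s t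
  proof (cases "s = t")
    case False
    then have "s < t" "t < s + inverse (real k + 1)" "s < b'" using that by (auto simp: b''_def)
    moreover have "Q (j, k) s" using ab'(2)[of s] that calculation by simp
    ultimately have "if j = 0 then g s < g t else if j = 1 then g s = g t else g t < g s" by (auto simp: Q_def)
    then show ?thesis by (auto simp: \<sigma>_def split: if_splits)
  qed simp
  have "mono_on {a'<..<b''} (\<lambda>t. \<sigma> * g t)" by (rule mono_onI) (use mono in auto)
  then have "countable {t \<in> {a'<..<b''}. \<not> isCont (\<lambda>t. \<sigma> * g t) t}" by (intro mono_on_ctble_discont_open) auto
  moreover have "uncountable {a'<..<b''}" using b'' uncountable_open_interval by blast
  ultimately have "\<not> {a'<..<b''} \<subseteq> {t \<in> {a'<..<b''}. \<not> isCont (\<lambda>t. \<sigma> * g t) t}" using countable_subset by blast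
  then obtain c where c: "a' < c" "c < b''" "isCont (\<lambda>t. \<sigma> * g t) c" by auto
  have "isCont (\<lambda>t. \<sigma> * (\<sigma> * g t)) c" by (intro continuous_intros c(3))
  moreover have "\<sigma> * (\<sigma> * y) = y" for y by (simp add: \<sigma>_def)
  ultimately have cg: "isCont g c" by simp
  have "tame_at \<sigma> g c"
    unfolding tame_at_def
  proof (intro conjI)
    show "\<exists>d>0. \<forall>s t. \<bar>s - c\<bar> < d \<and> \<bar>t - c\<bar> < d \<and> s \<le> t \<longrightarrow> \<sigma> * g s \<le> \<sigma> * g t"
      using c mono by (intro exI[of _ "min (c - a') (b'' - c)"]) auto
    show "\<forall>e>0. \<exists>d>0. \<forall>s. \<bar>s - c\<bar> < d \<longrightarrow> \<bar>g s - g c\<bar> < e"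
      using cg unfolding continuous_at_eps_delta dist_real_def by blast
  qed
  moreover have "a < c \<and> c < b" using ab'(2)[of c] c by (simp add: b''_def)
  ultimately show ?thesis by (auto simp: \<sigma>_def split: if_splits)
qed

lemma pred_tame_at:
  assumes "definable_term (\<lambda>e. h (e 0) (e (Suc 0)))"
  shows "definable_pred (\<lambda>e. tame_at \<sigma> (\<lambda>c. h c (e (Suc 0))) (e 0))"
proof -
  have h: "definable_term (\<lambda>e. h (e j) (e k))" for j k using term_rename[OF assms, of "case_nat j (\<lambda>_. k)"] by simp
  show ?thesis
    unfolding tame_at_def
    by (intro pred_conj pred_all pred_ex pred_imp pred_less pred_le term_abs term_diff term_mult h term_var term_const)
qed

lemma locally_monotone_imp_monotone:
  assumes "\<And>c. a < c \<Longrightarrow> c < b \<Longrightarrow> tame_at \<sigma> g c" "a < s" "s \<le> t" "t < b"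
  shows "\<sigma> * g s \<le> \<sigma> * g t"
proof -
  have "s \<le> s \<and> t \<le> t \<longrightarrow> \<sigma> * g s \<le> \<sigma> * g t"
  proof (induction rule: Bolzano[OF assms(3), where P = "\<lambda>u v. s \<le> u \<and> v \<le> t \<longrightarrow> \<sigma> * g u \<le> \<sigma> * g v"])
    case (1 a b c) then show ?case by auto
  next
    case (2 c)
    then have "tame_at \<sigma> g c" using assms by auto
    then obtain d where d: "d > 0" "\<And>s t. \<bar>s - c\<bar> < d \<Longrightarrow> \<bar>t - c\<bar> < d \<Longrightarrow> s \<le> t \<Longrightarrow> \<sigma> * g s \<le> \<sigma> * g t"
      unfolding tame_at_def by blast
    show ?case by (intro exI[of _ d] conjI allI impI d) auto
  qed
  then show ?thesis by simp
qed

text \<open>For each \<open>c\<close>, one of three cases holds for arbitrarily large \<open>r\<close>: tame increasing, tame decreasing, or not tame at \<open>c\<close>. On some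
  interval it is the same case, and then for all large \<open>r\<close> and all \<open>c\<close>. The third is excluded by the existence of tame points for a
  single \<open>r\<close>.\<close>

lemma family_eventually_monotone:
  assumes ab: "a < b" and h: "definable_term (\<lambda>e. h (e 0) (e (Suc 0)))"
  shows "\<exists>a' b' R \<sigma>. a' < b' \<and> \<bar>\<sigma>\<bar> = 1 \<and> (\<forall>c. a' < c \<longrightarrow> c < b' \<longrightarrow> a < c \<and> c < b) \<and>
    (\<forall>r\<ge>R. (\<forall>s t. a' < s \<longrightarrow> s \<le> t \<longrightarrow> t < b' \<longrightarrow> \<sigma> * h s r \<le> \<sigma> * h t r) \<and>
            (\<forall>c. a' < c \<longrightarrow> c < b' \<longrightarrow> isCont (\<lambda>c. h c r) c))"
proof -
  \<comment> \<open>The cases increasing, decreasing and neither are numbered 0, 1 and 2.\<close>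
  define P where "P j c r = (if j = (0::nat) then tame_at 1 (\<lambda>c. h c r) c else if j = 1 then tame_at (-1) (\<lambda>c. h c r) c
      else \<not> tame_at 1 (\<lambda>c. h c r) c \<and> \<not> tame_at (-1) (\<lambda>c. h c r) c)" for j c r
  have Pd: "definable_pred (\<lambda>e. P j (e 0) (e (Suc 0)))" for j
    unfolding P_def using pred_tame_at[OF h] by (cases "j = 0"; cases "j = 1") (simp_all add: pred_conj pred_not)
  have "\<exists>j a' b'. a' < b' \<and> (\<forall>c. a' < c \<longrightarrow> c < b' \<longrightarrow> a < c \<and> c < b \<and> (\<forall>R. \<exists>r. R \<le> r \<and> P j c r))"
  proof (rule countable_cover[OF ab])
    show "definable_pred (\<lambda>e. \<forall>R. \<exists>r. R \<le> r \<and> P j (e 0) r)" for j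
    proof (rule pred_all, rule pred_ex, rule pred_conj)
      show "definable_pred (\<lambda>e. e (Suc 0) \<le> e 0)" by (intro pred_le term_var)
      show "definable_pred (\<lambda>e. P j (e (Suc (Suc 0))) (e 0))"
        using pred_rename[OF Pd[of j], of "case_nat (Suc (Suc 0)) (\<lambda>_. 0)"] by simp
    qed
    fix c
    show "\<exists>j. \<forall>R. \<exists>r. R \<le> r \<and> P j c r"
    proof (rule ccontr)
      assume "\<not> ?thesis"
      then obtain R where R: "\<And>j r. R j \<le> r \<Longrightarrow> \<not> P j c r" by metis
      define r where "r = max (R 0) (max (R 1) (R 2))"
      have "\<not> P 0 c r" "\<not> P 1 c r" "\<not> P 2 c r" by (rule R, simp add: r_def)+
      then show False by (auto simp: P_def)
    qed
  qed
  then obtain j a1 b1 where 1: "a1 < b1" "\<And>c. a1 < c \<Longrightarrow> c < b1 \<Longrightarrow> a < c \<and> c < b"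
      "\<And>c R. a1 < c \<Longrightarrow> c < b1 \<Longrightarrow> \<exists>r\<ge>R. P j c r" by blast
  obtain a2 b2 R where 2: "a2 < b2" "\<And>c. a2 < c \<Longrightarrow> c < b2 \<Longrightarrow> a1 < c \<and> c < b1"
      "\<And>c r. a2 < c \<Longrightarrow> c < b2 \<Longrightarrow> R \<le> r \<Longrightarrow> P j c r"
    using uniform_ray[OF 1(1) Pd[of j] 1(3)] by blast
  have j: "j = 0 \<or> j = 1"
  proof (rule ccontr)
    assume "\<not> ?thesis"
    then have "\<not> tame_at 1 (\<lambda>c. h c R) c \<and> \<not> tame_at (-1) (\<lambda>c. h c R) c" if "a2 < c" "c < b2" for c
      using 2(3)[OF that order_refl] by (auto simp: P_def)
    then show False using tame_point_exists[OF term_fix_second[OF h, of R] 2(1)] by blast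
  qed
  define \<sigma> :: real where "\<sigma> = (if j = 0 then 1 else -1)"
  have t: "tame_at \<sigma> (\<lambda>c. h c r) c" if "a2 < c" "c < b2" "R \<le> r" for c r
    using 2(3)[OF that] j by (auto simp: P_def \<sigma>_def split: if_splits)
  have mono: "\<sigma> * h s r \<le> \<sigma> * h t r" if "R \<le> r" "a2 < s" "s \<le> t" "t < b2" for r s t
    using t that(1) by (intro locally_monotone_imp_monotone[of a2 b2 \<sigma> "\<lambda>c. h c r"] that(2-4))
  have cont: "isCont (\<lambda>c. h c r) c" if "R \<le> r" "a2 < c" "c < b2" for r c
    using tame_at_isCont[OF t[OF that(2,3,1)]] .
  show ?thesis
    using 2(1,2) 1(2) mono cont by (intro exI[of _ a2] exI[of _ b2] exI[of _ R] exI[of _ \<sigma>]) (auto simp: \<sigma>_def)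
qed

lemma families_eventually_monotone:
  assumes ab: "a < b" and h: "\<And>i. i < (k::nat) \<Longrightarrow> definable_term (\<lambda>e. h i (e 0) (e (Suc 0)))"
  shows "\<exists>a' b' R \<sigma>. a' < b' \<and> (\<forall>c. a' < c \<longrightarrow> c < b' \<longrightarrow> a < c \<and> c < b) \<and> (\<forall>i<k. \<bar>\<sigma> i :: real\<bar> = 1 \<and>
    (\<forall>r\<ge>R. (\<forall>s t. a' < s \<longrightarrow> s \<le> t \<longrightarrow> t < b' \<longrightarrow> \<sigma> i * h i s r \<le> \<sigma> i * h i t r) \<and>
            (\<forall>c. a' < c \<longrightarrow> c < b' \<longrightarrow> isCont (\<lambda>c. h i c r) c)))"
  using h
proof (induction k)
  case 0
  then show ?case using ab by auto
next
  case (Suc k)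
  have "\<exists>a1 b1 R1 \<sigma>. a1 < b1 \<and> (\<forall>c. a1 < c \<longrightarrow> c < b1 \<longrightarrow> a < c \<and> c < b) \<and> (\<forall>i<k. \<bar>\<sigma> i :: real\<bar> = 1 \<and>
    (\<forall>r\<ge>R1. (\<forall>s t. a1 < s \<longrightarrow> s \<le> t \<longrightarrow> t < b1 \<longrightarrow> \<sigma> i * h i s r \<le> \<sigma> i * h i t r) \<and>
            (\<forall>c. a1 < c \<longrightarrow> c < b1 \<longrightarrow> isCont (\<lambda>c. h i c r) c)))"
    by (rule Suc.IH, rule Suc.prems, simp)
  then obtain a1 b1 R1 \<sigma> where A: "a1 < b1 \<and> (\<forall>c. a1 < c \<longrightarrow> c < b1 \<longrightarrow> a < c \<and> c < b) \<and> (\<forall>i<k. \<bar>\<sigma> i :: real\<bar> = 1 \<and>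
    (\<forall>r\<ge>R1. (\<forall>s t. a1 < s \<longrightarrow> s \<le> t \<longrightarrow> t < b1 \<longrightarrow> \<sigma> i * h i s r \<le> \<sigma> i * h i t r) \<and>
            (\<forall>c. a1 < c \<longrightarrow> c < b1 \<longrightarrow> isCont (\<lambda>c. h i c r) c)))"
    by (elim exE) (rule that)
  have 1: "a1 < b1" "\<And>c. a1 < c \<Longrightarrow> c < b1 \<Longrightarrow> a < c \<and> c < b"
    "\<And>i. i < k \<Longrightarrow> \<bar>\<sigma> i :: real\<bar> = 1"
    "\<And>i r s t. i < k \<Longrightarrow> R1 \<le> r \<Longrightarrow> a1 < s \<Longrightarrow> s \<le> t \<Longrightarrow> t < b1 \<Longrightarrow> \<sigma> i * h i s r \<le> \<sigma> i * h i t r"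
    "\<And>i r c. i < k \<Longrightarrow> R1 \<le> r \<Longrightarrow> a1 < c \<Longrightarrow> c < b1 \<Longrightarrow> isCont (\<lambda>c. h i c r) c"
    using A by blast+
  obtain a2 b2 R2 \<tau> where 2: "a2 < b2" "\<bar>\<tau>\<bar> = 1" "\<And>c. a2 < c \<Longrightarrow> c < b2 \<Longrightarrow> a1 < c \<and> c < b1"
    "\<And>r s t. R2 \<le> r \<Longrightarrow> a2 < s \<Longrightarrow> s \<le> t \<Longrightarrow> t < b2 \<Longrightarrow> \<tau> * h k s r \<le> \<tau> * h k t r"
    "\<And>r c. R2 \<le> r \<Longrightarrow> a2 < c \<Longrightarrow> c < b2 \<Longrightarrow> isCont (\<lambda>c. h k c r) c"
    using family_eventually_monotone[OF 1(1) Suc.prems[OF lessI]] by blast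
  have sub: "a1 < c" "c < b1" "a < c" "c < b" if "a2 < c" "c < b2" for c using 2(3)[OF that] 1(2) by auto
  have "\<bar>(\<sigma>(k := \<tau>)) i\<bar> = 1 \<and>
    (\<forall>r\<ge>max R1 R2. (\<forall>s t. a2 < s \<longrightarrow> s \<le> t \<longrightarrow> t < b2 \<longrightarrow> (\<sigma>(k := \<tau>)) i * h i s r \<le> (\<sigma>(k := \<tau>)) i * h i t r) \<and>
            (\<forall>c. a2 < c \<longrightarrow> c < b2 \<longrightarrow> isCont (\<lambda>c. h i c r) c))" if "i < Suc k" for i
  proof (cases "i = k")
    case True
    then show ?thesis using 2 by simp
  next
    case False
    then have i: "i < k" using that by simp
    show ?thesis
    proof (intro conjI allI impI)
      show "\<bar>(\<sigma>(k := \<tau>)) i\<bar> = 1" using False 1(3)[OF i] by simp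
      fix r assume r: "max R1 R2 \<le> r"
      show "(\<sigma>(k := \<tau>)) i * h i s r \<le> (\<sigma>(k := \<tau>)) i * h i t r" if "a2 < s" "s \<le> t" "t < b2" for s t
        using False 1(4)[OF i, of r s t] r sub[of s] sub[of t] that by simp
      show "isCont (\<lambda>c. h i c r) c" if "a2 < c" "c < b2" for c
        using 1(5)[OF i, of r c] r sub[OF that] by simp
    qed
  qed
  then show ?case using 2(1) sub(3,4) by (intro exI[of _ a2] exI[of _ b2] exI[of _ "max R1 R2"] exI[of _ "\<sigma>(k := \<tau>)"]) simp
qed

end

subsection \<open>Points of a level with smallest gradient\<close>

lemma argmin_compact:
  fixes g :: "'a :: topological_space \<Rightarrow> real"
  assumes "compact T" "T \<noteq> {}" "continuous_on T g"
  shows "compact {x \<in> T. \<forall>y\<in>T. g x \<le> g y}" "{x \<in> T. \<forall>y\<in>T. g x \<le> g y} \<noteq> {}"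
proof -
  obtain x0 where x0: "x0 \<in> T" "\<And>y. y \<in> T \<Longrightarrow> g x0 \<le> g y"
    using continuous_attains_inf[OF assms(1-3)] by blast
  have eq: "{x \<in> T. \<forall>y\<in>T. g x \<le> g y} = T \<inter> g -` {..g x0}" using x0 by (auto intro: order_trans)
  have "closedin (top_of_set T) (T \<inter> g -` {..g x0})" by (intro continuous_closedin_preimage assms(3)) simp
  then show "compact {x \<in> T. \<forall>y\<in>T. g x \<le> g y}" unfolding eq using assms(1) closedin_compact by blast
  show "{x \<in> T. \<forall>y\<in>T. g x \<le> g y} \<noteq> {}" using x0 by blast
qed

text \<open>Among the points of the level \<open>c\<close> in the ball of radius \<open>r\<close> with smallest gradient, the lexicographically
  least is found by minimising the coordinates one after the other; this makes the choice definable.\<close>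

primrec flattest :: "nat \<Rightarrow> ((nat \<Rightarrow> real) \<Rightarrow> real) \<Rightarrow> nat \<Rightarrow> real \<Rightarrow> real \<Rightarrow> (nat \<Rightarrow> real) \<Rightarrow> bool" where
  "flattest n f 0 c r x \<longleftrightarrow> x \<in> Rn n \<and> l1_norm n x \<le> r \<and> f x = c \<and>
     (\<forall>y\<in>Rn n. l1_norm n y \<le> r \<and> f y = c \<longrightarrow> grad_l1 n f x \<le> grad_l1 n f y)"
| "flattest n f (Suc k) c r x \<longleftrightarrow> flattest n f k c r x \<and> (\<forall>y\<in>Rn n. flattest n f k c r y \<longrightarrow> x k \<le> y k)"

lemma flattest_mono: "flattest n f k c r x \<Longrightarrow> l \<le> k \<Longrightarrow> flattest n f l c r x"
  by (induction k) (auto simp: le_Suc_eq)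

lemma flattest_Rn: "flattest n f k c r x \<Longrightarrow> x \<in> Rn n"
  using flattest_mono[of n f k c r x 0] by simp

lemma flattest_unique:
  assumes "flattest n f n c r x" "flattest n f n c r y"
  shows "x = y"
proof (rule Rn_eqI[OF flattest_Rn[OF assms(1)] flattest_Rn[OF assms(2)]])
  fix i assume "i < n"
  then have "flattest n f (Suc i) c r x" "flattest n f (Suc i) c r y" using assms flattest_mono by (metis Suc_leI)+
  then show "x i = y i" using flattest_Rn by (auto intro!: antisym)
qed

text \<open>The sets of points that survive each minimisation are compact and nonempty.\<close>

lemma flattest_exists:
  assumes f: "\<And>k. Ck_on k n (Rn n) f" and ne: "x0 \<in> Rn n" "l1_norm n x0 \<le> r" "f x0 = c"
  shows "\<exists>x. flattest n f k c r x"
proof -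
  have "compact {x. flattest n f k c r x} \<and> {x. flattest n f k c r x} \<noteq> {}"
  proof (induction k)
    case 0
    let ?T = "{x \<in> l1_ball n r. f x = c}"
    have sub: "l1_ball n r \<subseteq> Rn n" by (auto simp: l1_ball_def)
    have cf: "continuous_on (l1_ball n r) f" using continuous_on_subset[OF Ck_on_continuous[OF f[of 0]] sub] .
    have "continuous_on (Rn n) (partial_deriv i f)" if "i < n" for i
      using Ck_on_continuous[OF Ck_on_partial[OF f[of "Suc 0"] that]] .
    then have "continuous_on (Rn n) (grad_l1 n f)" unfolding grad_l1_def by (intro continuous_intros) auto
    then have cg: "continuous_on ?T (grad_l1 n f)" by (rule continuous_on_subset) (use sub in auto)
    have "?T = l1_ball n r \<inter> f -` {c}" by auto
    moreover have "closedin (top_of_set (l1_ball n r)) (l1_ball n r \<inter> f -` {c})" by (intro continuous_closedin_preimage cf) simp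
    ultimately have T: "compact ?T" using compact_l1_ball closedin_compact by metis
    have ne': "?T \<noteq> {}" using ne by (auto simp: l1_ball_def)
    have eq: "{x. flattest n f 0 c r x} = {x \<in> ?T. \<forall>y\<in>?T. grad_l1 n f x \<le> grad_l1 n f y}"
      by (auto simp: l1_ball_def)
    show ?case unfolding eq by (rule conjI[OF argmin_compact[OF T ne' cg]])
  next
    case (Suc k)
    let ?T = "{x. flattest n f k c r x}"
    have ck: "continuous_on ?T (\<lambda>x. x k)" by (rule continuous_on_subset[OF continuous_on_product_coordinates]) simp
    have eq: "{x. flattest n f (Suc k) c r x} = {x \<in> ?T. \<forall>y\<in>?T. x k \<le> y k}"
      using flattest_Rn by auto
    show ?case unfolding eq by (rule conjI[OF argmin_compact[OF Suc.IH[THEN conjunct1] Suc.IH[THEN conjunct2] ck]])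
  qed
  then show ?thesis by blast
qed

definition flattest_point :: "nat \<Rightarrow> ((nat \<Rightarrow> real) \<Rightarrow> real) \<Rightarrow> real \<Rightarrow> real \<Rightarrow> nat \<Rightarrow> real"
  where "flattest_point n f c r i = (if \<exists>x\<in>Rn n. flattest n f n c r x then (THE x. flattest n f n c r x) i else 0)"

lemma flattest_point_eq: "flattest n f n c r x \<Longrightarrow> flattest_point n f c r = x"
proof -
  assume x: "flattest n f n c r x"
  then have "(THE x. flattest n f n c r x) = x" using flattest_unique by blast
  then show ?thesis using x flattest_Rn[OF x] by (auto simp: flattest_point_def fun_eq_iff)
qed

lemma flattest_point_in_Rn: "flattest_point n f c r \<in> Rn n"
proof (cases "\<exists>x\<in>Rn n. flattest n f n c r x")
  case True
  then show ?thesis using flattest_point_eq by metis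
qed (auto simp: flattest_point_def Rn_iff)

lemma flattest_point_props:
  assumes f: "\<And>k. Ck_on k n (Rn n) f" and x: "x \<in> Rn n" "l1_norm n x \<le> r" "f x = c"
  shows "l1_norm n (flattest_point n f c r) \<le> r" "f (flattest_point n f c r) = c"
    "grad_l1 n f (flattest_point n f c r) \<le> grad_l1 n f x"
proof -
  obtain y where y: "flattest n f n c r y" using flattest_exists[OF f x] by blast
  then have "flattest n f 0 c r y" by (rule flattest_mono) simp
  then show "l1_norm n (flattest_point n f c r) \<le> r" "f (flattest_point n f c r) = c"
    "grad_l1 n f (flattest_point n f c r) \<le> grad_l1 n f x"
    unfolding flattest_point_eq[OF y] using x by auto
qed

text \<open>The right-hand side avoids division, and quantifies over real numbers only.\<close>

lemma partial_deriv_eq_iff: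
  assumes "has_partial f i D x"
  shows "d = partial_deriv i f x \<longleftrightarrow> (\<forall>r. 0 < r \<longrightarrow> (\<exists>s. 0 < s \<and> (\<forall>h. 0 < \<bar>h\<bar> \<and> \<bar>h\<bar> < s \<longrightarrow>
      \<bar>f (x(i := x i + h)) - f x - d * h\<bar> \<le> r * \<bar>h\<bar>)))"
proof -
  have quot: "\<bar>(f (x(i := x i + h)) - f (x(i := x i))) / h - d\<bar> = \<bar>f (x(i := x i + h)) - f x - d * h\<bar> / \<bar>h\<bar>" if "h \<noteq> 0" for h
  proof -
    have "(f (x(i := x i + h)) - f (x(i := x i))) / h - d = (f (x(i := x i + h)) - f x - d * h) / h"
      using that by (simp add: field_simps)
    then show ?thesis by simp
  qed
  have "d = partial_deriv i f x \<longleftrightarrow> has_partial f i d x"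
    using assms partial_deriv_eqI by metis
  also have "\<dots> \<longleftrightarrow> (\<forall>r>0. \<exists>s>0. \<forall>h. h \<noteq> 0 \<and> \<bar>h\<bar> < s \<longrightarrow> \<bar>(f (x(i := x i + h)) - f (x(i := x i))) / h - d\<bar> < r)"
    unfolding has_partial_def DERIV_def LIM_eq by simp
  also have "\<dots> \<longleftrightarrow> (\<forall>r. 0 < r \<longrightarrow> (\<exists>s. 0 < s \<and> (\<forall>h. 0 < \<bar>h\<bar> \<and> \<bar>h\<bar> < s \<longrightarrow>
      \<bar>f (x(i := x i + h)) - f x - d * h\<bar> \<le> r * \<bar>h\<bar>)))" (is "?L \<longleftrightarrow> ?R")
  proof
    assume L: ?L
    show ?R
    proof (intro allI impI)
      fix r :: real assume "0 < r"
      then obtain s where s: "s > 0" "\<And>h. h \<noteq> 0 \<Longrightarrow> \<bar>h\<bar> < s \<Longrightarrow> \<bar>(f (x(i := x i + h)) - f (x(i := x i))) / h - d\<bar> < r"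
        using L by blast
      have "\<bar>f (x(i := x i + h)) - f x - d * h\<bar> \<le> r * \<bar>h\<bar>" if "0 < \<bar>h\<bar>" "\<bar>h\<bar> < s" for h
        using s(2)[of h] that quot[of h] by (simp add: pos_divide_less_eq)
      then show "\<exists>s. 0 < s \<and> (\<forall>h. 0 < \<bar>h\<bar> \<and> \<bar>h\<bar> < s \<longrightarrow> \<bar>f (x(i := x i + h)) - f x - d * h\<bar> \<le> r * \<bar>h\<bar>)"
        using s(1) by blast
    qed
  next
    assume R: ?R
    show ?L
    proof (intro allI impI)
      fix r :: real assume r: "0 < r"
      then obtain s where s: "s > 0" "\<And>h. 0 < \<bar>h\<bar> \<Longrightarrow> \<bar>h\<bar> < s \<Longrightarrow> \<bar>f (x(i := x i + h)) - f x - d * h\<bar> \<le> r / 2 * \<bar>h\<bar>"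
        using R[rule_format, OF half_gt_zero[OF r]] by blast
      have "\<bar>(f (x(i := x i + h)) - f (x(i := x i))) / h - d\<bar> < r" if "h \<noteq> 0" "\<bar>h\<bar> < s" for h
      proof -
        have "\<bar>f (x(i := x i + h)) - f x - d * h\<bar> \<le> r / 2 * \<bar>h\<bar>" using s(2) that by simp
        also have "\<dots> < r * \<bar>h\<bar>" using r that by simp
        finally show ?thesis unfolding quot[OF that(1)] using that by (simp add: pos_divide_less_eq)
      qed
      then show "\<exists>s>0. \<forall>h. h \<noteq> 0 \<and> \<bar>h\<bar> < s \<longrightarrow> \<bar>(f (x(i := x i + h)) - f (x(i := x i))) / h - d\<bar> < r"
        using s(1) by blast
    qed
  qed
  finally show ?thesis .
qed

locale definable_smooth = o_minimal_structure D for D +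
  fixes n :: nat and f :: "(nat \<Rightarrow> real) \<Rightarrow> real"
  assumes smooth: "\<And>k. Ck_on k n (Rn n) f" and definable: "definable_fun D n f"
begin

lemma term_if_const: "definable_term g \<Longrightarrow> definable_term h \<Longrightarrow> definable_term (\<lambda>e. if c then g e else h e)"
  by (cases c) simp_all

lemma term_proj: "definable_term (\<lambda>e. X e k) \<Longrightarrow> definable_term (\<lambda>e. proj n (X e) k)"
  unfolding proj_def by (intro term_if_const term_const)

lemma term_f: "(\<And>j. definable_term (\<lambda>e. X e j)) \<Longrightarrow> definable_term (\<lambda>e. f (proj n (X e)))"
  using term_subst[OF term_definable_fun[OF definable], of X] by simp

lemma term_partial: "i < n \<Longrightarrow> definable_term (\<lambda>e. partial_deriv i f (proj n e))"
proof -
  assume i: "i < n"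
  have upd: "(proj n x)(i := proj n x i + h) = proj n (\<lambda>j. if j = i then x i + h else x j)" for x :: "nat \<Rightarrow> real" and h
    using i by (auto simp: proj_def fun_eq_iff)
  have eq: "d = partial_deriv i f (proj n x) \<longleftrightarrow> (\<forall>r. 0 < r \<longrightarrow> (\<exists>s. 0 < s \<and> (\<forall>h. 0 < \<bar>h\<bar> \<and> \<bar>h\<bar> < s \<longrightarrow>
      \<bar>f (proj n (\<lambda>j. if j = i then x i + h else x j)) - f (proj n x) - d * h\<bar> \<le> r * \<bar>h\<bar>)))" for d x
    using partial_deriv_eq_iff[OF Ck_on_has_partial[OF smooth i proj_in_Rn], of d x] unfolding upd .
  show ?thesis
    unfolding definable_term_def eq
    by (intro pred_all pred_ex pred_imp pred_conj pred_less pred_le term_abs term_diff term_mult term_f term_if_const term_add term_var term_const)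
qed

abbreviation G :: "(nat \<Rightarrow> real) \<Rightarrow> real" where "G \<equiv> grad_l1 n f"

lemma term_G: "(\<And>j. definable_term (\<lambda>e. X e j)) \<Longrightarrow> definable_term (\<lambda>e. G (proj n (X e)))"
proof -
  assume X: "\<And>j. definable_term (\<lambda>e. X e j)"
  have "definable_term (\<lambda>e. G (proj n e))" unfolding grad_l1_def by (intro term_sum term_abs term_partial)
  from term_subst[OF this X] show ?thesis by simp
qed

lemma term_l1_norm: "(\<And>j. definable_term (\<lambda>e. X e j)) \<Longrightarrow> definable_term (\<lambda>e. l1_norm n (proj n (X e)))"
  unfolding l1_norm_proj unfolding l1_norm_def by (intro term_sum term_abs)

lemma pred_flattest: "definable_pred (\<lambda>e. flattest n f k (e 0) (e (Suc 0)) (proj n (\<lambda>i. e (2 + i))))"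
proof (induction k)
  case 0
  show ?case
    unfolding flattest.simps
    by (intro pred_conj pred_ball_Rn pred_imp pred_eq pred_le term_f term_G term_l1_norm term_var) (simp add: pred_True)
next
  case (Suc k)
  have "definable_pred (\<lambda>e. flattest n f k (e (n + 0)) (e (n + Suc 0)) (proj n e))"
    using pred_rename[OF Suc.IH, of "\<lambda>i. if i = 0 then n + 0 else if i = Suc 0 then n + Suc 0 else i - 2"] by simp
  then show ?case
    unfolding flattest.simps
    by (intro pred_conj Suc.IH pred_ball_Rn pred_imp pred_le term_proj term_var)
qed

lemma term_flattest_point: "definable_term (\<lambda>e. flattest_point n f (e 0) (e (Suc 0)) i)"
proof -
  have eq: "v = flattest_point n f c r i \<longleftrightarrow> (\<exists>x\<in>Rn n. flattest n f n c r x \<and> v = x i) \<or>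
      (\<not> (\<exists>x\<in>Rn n. flattest n f n c r x) \<and> v = 0)" for v c r
  proof (cases "\<exists>x\<in>Rn n. flattest n f n c r x")
    case True
    then obtain x where x: "x \<in> Rn n" "flattest n f n c r x" by blast
    have "y = x" if "flattest n f n c r y" for y using flattest_unique[OF that x(2)] .
    then show ?thesis unfolding flattest_point_eq[OF x(2)] using x by blast
  next
    case False
    then show ?thesis by (auto simp: flattest_point_def)
  qed
  have F: "definable_pred (\<lambda>e. flattest n f n (e (n + Suc 0)) (e (n + Suc (Suc 0))) (proj n e))"
    using pred_rename[OF pred_flattest[of n], of "\<lambda>i. if i = 0 then n + Suc 0 else if i = Suc 0 then n + Suc (Suc 0) else i - 2"] by simp
  show ?thesis
    unfolding definable_term_def eq
    by (intro pred_disj pred_conj pred_not pred_bex_Rn F pred_eq term_proj term_var term_const)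
qed

definition flatness :: "real \<Rightarrow> real \<Rightarrow> real"
  where "flatness c r = r * G (flattest_point n f c r)"

lemma term_flatness: "definable_term (\<lambda>e. flatness (e 0) (e (Suc 0)))"
proof -
  have "definable_term (\<lambda>e. e (Suc 0) * G (proj n (flattest_point n f (e 0) (e (Suc 0)))))"
    by (intro term_mult term_G term_flattest_point term_var)
  then show ?thesis by (simp add: flatness_def proj_Rn flattest_point_in_Rn)
qed

subsection \<open>The main estimate\<close>

text \<open>If \<open>c\<close> is not a critical value, then \<open>G\<close> is bounded below on the part of the level in the ball of radius \<open>R\<close>, so a point with
  sufficiently small \<open>(1 + \<bar>x\<bar>) * G x\<close> lies outside that ball, and \<open>r = 1 + \<bar>x\<bar>\<close> will do.\<close>

lemma flatness_small:
  assumes H: "\<And>\<eta>. \<eta> > 0 \<Longrightarrow> \<exists>x\<in>Rn n. f x = c \<and> (1 + l1_norm n x) * G x < \<eta>" and e: "e > 0"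
  shows "\<exists>r\<ge>R. flatness c r < e"
proof (cases "\<exists>x\<in>Rn n. f x = c \<and> G x = 0")
  case True
  then obtain x where x: "x \<in> Rn n" "f x = c" "G x = 0" by blast
  define r where "r = max R (l1_norm n x)"
  have "G (flattest_point n f c r) \<le> 0"
    using flattest_point_props(3)[OF smooth x(1) _ x(2), of r] x(3) by (simp add: r_def)
  then have "G (flattest_point n f c r) = 0" using grad_l1_nonneg[of n f "flattest_point n f c r"] by linarith
  then show ?thesis using e by (intro exI[of _ r]) (simp add: flatness_def, simp add: r_def)
next
  case False
  have "\<exists>\<delta>>0. \<forall>x\<in>Rn n. l1_norm n x \<le> R \<and> f x = c \<longrightarrow> \<delta> \<le> G x"
  proof (cases "\<exists>x\<in>Rn n. l1_norm n x \<le> R \<and> f x = c")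
    case True
    then obtain x where x: "x \<in> Rn n" "l1_norm n x \<le> R" "f x = c" by blast
    let ?p = "flattest_point n f c R"
    have "G ?p \<noteq> 0" using False flattest_point_props(2)[OF smooth x] flattest_point_in_Rn by blast
    then have "G ?p > 0" using grad_l1_nonneg[of n f ?p] by linarith
    then show ?thesis using flattest_point_props(3)[OF smooth] by blast
  qed (auto intro: exI[of _ 1])
  then obtain \<delta> where d: "\<delta> > 0" "\<And>x. x\<in>Rn n \<Longrightarrow> l1_norm n x \<le> R \<Longrightarrow> f x = c \<Longrightarrow> \<delta> \<le> G x" by blast
  obtain x where x: "x \<in> Rn n" "f x = c" "(1 + l1_norm n x) * G x < min e \<delta>" using H[of "min e \<delta>"] e d(1) by auto
  have "G x \<le> (1 + l1_norm n x) * G x" using mult_right_mono[of 1 "1 + l1_norm n x" "G x"] by simp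
  then have "\<not> l1_norm n x \<le> R" using d(2)[OF x(1) _ x(2)] x(3) by fastforce
  moreover have "flatness c (1 + l1_norm n x) \<le> (1 + l1_norm n x) * G x"
    unfolding flatness_def using flattest_point_props(3)[OF smooth x(1) _ x(2), of "1 + l1_norm n x"]
    by (intro mult_left_mono) (auto simp: add_nonneg_nonneg)
  ultimately show ?thesis using x(3) by (intro exI[of _ "1 + l1_norm n x"]) auto
qed

definition asymptotic_critical :: "real \<Rightarrow> bool"
  where "asymptotic_critical c \<longleftrightarrow> (\<forall>e. 0 < e \<longrightarrow> (\<exists>x\<in>Rn n. \<bar>f x - c\<bar> < e \<and> (1 + l1_norm n x) * G x < e))"

lemma pred_small_on_level: "definable_pred (\<lambda>e. \<exists>x\<in>Rn n. f x = e j \<and> (1 + l1_norm n x) * G x < e k)"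
proof -
  have "definable_pred (\<lambda>e. \<exists>x\<in>Rn n. f (proj n x) = e j \<and> (1 + l1_norm n (proj n x)) * G (proj n x) < e k)"
    by (rule pred_bex_Rn) (unfold proj_Rn[OF proj_in_Rn], intro pred_conj pred_eq pred_less term_mult term_add term_const term_f term_G term_l1_norm term_var)
  moreover have "(\<exists>x\<in>Rn n. f (proj n x) = c \<and> (1 + l1_norm n (proj n x)) * G (proj n x) < \<eta>) \<longleftrightarrow>
      (\<exists>x\<in>Rn n. f x = c \<and> (1 + l1_norm n x) * G x < \<eta>)" for c \<eta>
    by (intro bex_cong refl) (simp add: proj_Rn)
  ultimately show ?thesis by simp
qed

text \<open>The coordinates \<open>i < n\<close> of the flattest point and, with index \<open>n\<close>, its flatness are made monotone simultaneously.\<close>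

lemma no_interval:
  assumes ab: "a < b"
    and H: "\<And>c \<eta>. a < c \<Longrightarrow> c < b \<Longrightarrow> \<eta> > 0 \<Longrightarrow> \<exists>x\<in>Rn n. f x = c \<and> (1 + l1_norm n x) * G x < \<eta>"
  shows False
proof -
  have P: "definable_pred (\<lambda>e. \<exists>x\<in>Rn n. l1_norm n x \<le> e (Suc 0) \<and> f x = e 0)"
  proof -
    have "definable_pred (\<lambda>e. \<exists>x\<in>Rn n. l1_norm n (proj n x) \<le> e (Suc 0) \<and> f (proj n x) = e 0)"
      by (rule pred_bex_Rn) (unfold proj_Rn[OF proj_in_Rn], intro pred_conj pred_eq pred_le term_f term_l1_norm term_var)
    moreover have "(\<exists>x\<in>Rn n. l1_norm n (proj n x) \<le> r \<and> f (proj n x) = c) \<longleftrightarrow> (\<exists>x\<in>Rn n. l1_norm n x \<le> r \<and> f x = c)" for c r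
      by (intro bex_cong refl) (simp add: proj_Rn)
    ultimately show ?thesis by simp
  qed
  have "\<exists>r\<ge>R. \<exists>x\<in>Rn n. l1_norm n x \<le> r \<and> f x = c" if cab: "a < c" "c < b" for c R
  proof -
    obtain x where "x \<in> Rn n" "f x = c" using H[OF cab, of 1] by auto
    then show ?thesis by (intro exI[of _ "max R (l1_norm n x)"] conjI bexI[of _ x]) auto
  qed
  from uniform_ray[where P = "\<lambda>c r. \<exists>x\<in>Rn n. l1_norm n x \<le> r \<and> f x = c", OF ab P this]
  obtain a1 b1 R1 where 1: "a1 < b1" "\<And>c. a1 < c \<Longrightarrow> c < b1 \<Longrightarrow> a < c \<and> c < b"
    "\<And>c r. a1 < c \<Longrightarrow> c < b1 \<Longrightarrow> R1 \<le> r \<Longrightarrow> \<exists>x\<in>Rn n. l1_norm n x \<le> r \<and> f x = c" by blast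
  define h where "h i c r = (if i < n then flattest_point n f c r i else flatness c r)" for i c r
  have "definable_term (\<lambda>e. h i (e 0) (e (Suc 0)))" for i
    unfolding h_def by (intro term_if_const term_flattest_point term_flatness)
  from families_eventually_monotone[where h = h and k = "Suc n", OF 1(1) this]
  obtain a2 b2 R2 \<sigma> where A: "a2 < b2 \<and> (\<forall>c. a2 < c \<longrightarrow> c < b2 \<longrightarrow> a1 < c \<and> c < b1) \<and> (\<forall>i<Suc n. \<bar>\<sigma> i :: real\<bar> = 1 \<and>
    (\<forall>r\<ge>R2. (\<forall>s t. a2 < s \<longrightarrow> s \<le> t \<longrightarrow> t < b2 \<longrightarrow> \<sigma> i * h i s r \<le> \<sigma> i * h i t r) \<and>
            (\<forall>c. a2 < c \<longrightarrow> c < b2 \<longrightarrow> isCont (\<lambda>c. h i c r) c)))"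
    by (elim exE) (rule that)
  have 2: "a2 < b2" "\<And>c. a2 < c \<Longrightarrow> c < b2 \<Longrightarrow> a1 < c \<and> c < b1" "\<And>i. i < Suc n \<Longrightarrow> \<bar>\<sigma> i\<bar> = 1"
    "\<And>i r s t. i < Suc n \<Longrightarrow> R2 \<le> r \<Longrightarrow> a2 < s \<Longrightarrow> s \<le> t \<Longrightarrow> t < b2 \<Longrightarrow> \<sigma> i * h i s r \<le> \<sigma> i * h i t r"
    "\<And>i r c. i < Suc n \<Longrightarrow> R2 \<le> r \<Longrightarrow> a2 < c \<Longrightarrow> c < b2 \<Longrightarrow> isCont (\<lambda>c. h i c r) c"
    using A by blast+
  define c1 where "c1 = a2 + (b2 - a2) / 3"
  define c2 where "c2 = a2 + 2 * (b2 - a2) / 3"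
  have c: "a2 < c1" "c1 < c2" "c2 < b2" using 2(1) by (auto simp: c1_def c2_def field_simps)
  define e where "e = (c2 - c1) / 4"
  have e: "e > 0" using c by (simp add: e_def)
  have ray: "\<exists>R. \<forall>r\<ge>R. flatness c r < e" if "a2 < c" "c < b2" for c
  proof (rule unbounded_contains_ray)
    show "definable_pred (\<lambda>e'. flatness c (e' 0) < e)"
      by (rule pred_fix_first[of "\<lambda>c r. flatness c r < e"]) (intro pred_less term_flatness term_const)
    show "\<exists>r\<ge>R. flatness c r < e" for R
      using 2(2)[OF that] 1(2)[of c] by (intro flatness_small H e) auto
  qed
  obtain Ra Rb where Rab: "\<And>r. r \<ge> Ra \<Longrightarrow> flatness c1 r < e" "\<And>r. r \<ge> Rb \<Longrightarrow> flatness c2 r < e"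
    using ray[of c1] ray[of c2] c by auto
  define r where "r = max (max Ra Rb) (max (max R1 R2) 1)"
  have r: "r \<ge> Ra" "r \<ge> Rb" "r \<ge> R1" "r \<ge> R2" "r \<ge> 1" by (auto simp: r_def)
  have flat: "flatness t r < e" if "c1 \<le> t" "t \<le> c2" for t
  proof -
    have "\<sigma> n * flatness c1 r \<le> \<sigma> n * flatness t r" "\<sigma> n * flatness t r \<le> \<sigma> n * flatness c2 r"
      using 2(4)[of n r c1 t] 2(4)[of n r t c2] c that r by (simp_all add: h_def)
    moreover have "\<sigma> n = 1 \<or> \<sigma> n = -1" using 2(3)[of n] by auto
    ultimately show ?thesis using Rab(1)[OF r(1)] Rab(2)[OF r(2)] by auto
  qed
  have "c2 - c1 \<le> 2 * r * (e / r)"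
  proof (rule curve_estimate[OF smooth, where x = "\<lambda>t. flattest_point n f t r" and \<sigma> = \<sigma>])
    fix t assume t: "c1 \<le> t" "t \<le> c2"
    then have t': "a2 < t" "t < b2" using c by auto
    obtain x where x: "x \<in> Rn n" "l1_norm n x \<le> r" "f x = t" using 1(3)[of t r] 2(2)[OF t'] r by auto
    have "G (flattest_point n f t r) < e / r"
      using flat[OF t] r by (simp add: flatness_def pos_less_divide_eq mult.commute)
    then show "flattest_point n f t r \<in> Rn n \<and> f (flattest_point n f t r) = t \<and> l1_norm n (flattest_point n f t r) \<le> r \<and>
        G (flattest_point n f t r) < e / r"
      using flattest_point_props(1,2)[OF smooth x] flattest_point_in_Rn by simp
    show "isCont (\<lambda>c. flattest_point n f c r i) t" if "i < n" for i
      using 2(5)[of i r t] that r t' by (simp add: h_def)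
  next
    fix i s t assume *: "i < n" "c1 \<le> s" "s \<le> t" "t \<le> c2"
    then show "\<sigma> i * flattest_point n f s r i \<le> \<sigma> i * flattest_point n f t r i"
      using 2(4)[of i r s t] c r by (simp add: h_def)
  qed (use c 2(3) in auto)
  also have "\<dots> = 2 * e" using r by simp
  finally show False using e by (simp add: e_def)
qed

text \<open>Let \<open>S \<eta>\<close> be the set of values of \<open>f\<close> at points with \<open>(1 + \<bar>x\<bar>) * G x < \<eta>\<close>. In an interval of asymptotically critical values it is
  dense and definable, so its complement there is finite. Hence the intersection of all \<open>S \<eta>\<close> omits only countably many points
  of the interval; being definable, it contains an interval.\<close>

lemma finite_asymptotic_critical: "finite {c. asymptotic_critical c}"
proof (rule ccontr)
  assume inf: "infinite {c. asymptotic_critical c}"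
  have "definable_pred (\<lambda>e. asymptotic_critical (e 0))"
  proof -
    have "definable_pred (\<lambda>e. \<forall>\<eta>. 0 < \<eta> \<longrightarrow> (\<exists>x\<in>Rn n. \<bar>f (proj n x) - e 0\<bar> < \<eta> \<and> (1 + l1_norm n (proj n x)) * G (proj n x) < \<eta>))"
      by (rule pred_all, rule pred_imp, intro pred_less term_const term_var, rule pred_bex_Rn)
         (unfold proj_Rn[OF proj_in_Rn], intro pred_conj pred_less term_abs term_diff term_mult term_add term_const term_f term_G term_l1_norm term_var)
    moreover have "(\<exists>x\<in>Rn n. \<bar>f (proj n x) - c\<bar> < \<eta> \<and> (1 + l1_norm n (proj n x)) * G (proj n x) < \<eta>) \<longleftrightarrow>
        (\<exists>x\<in>Rn n. \<bar>f x - c\<bar> < \<eta> \<and> (1 + l1_norm n x) * G x < \<eta>)" for c \<eta>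
      by (intro bex_cong refl) (simp add: proj_Rn)
    ultimately show ?thesis by (simp add: asymptotic_critical_def)
  qed
  from infinite_contains_interval[OF this inf]
  obtain a b where ab: "a < b" "\<And>c. a < c \<Longrightarrow> c < b \<Longrightarrow> asymptotic_critical c" by blast
  define S where "S \<eta> c \<longleftrightarrow> (\<exists>x\<in>Rn n. f x = c \<and> (1 + l1_norm n x) * G x < \<eta>)" for \<eta> c
  have Sd: "definable_pred (\<lambda>e. S (e k) (e j))" for j k unfolding S_def by (rule pred_small_on_level)
  have Sm: "S \<eta>' c" if "S \<eta> c" "\<eta> \<le> \<eta>'" for \<eta> \<eta>' c using that unfolding S_def by force
  have fin: "finite {c. a < c \<and> c < b \<and> \<not> S \<eta> c}" if \<eta>: "\<eta> > 0" for \<eta>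
  proof (rule ccontr)
    assume inf: "infinite {c. a < c \<and> c < b \<and> \<not> S \<eta> c}"
    have "definable_pred (\<lambda>e. S \<eta> (e 0))" by (rule pred_fix_first[of S]) (rule Sd)
    then have "definable_pred (\<lambda>e. a < e 0 \<and> e 0 < b \<and> \<not> S \<eta> (e 0))" by (intro pred_conj pred_less term_var term_const pred_not)
    from infinite_contains_interval[OF this inf]
    obtain u v where uv: "u < v" "\<And>c. u < c \<Longrightarrow> c < v \<Longrightarrow> a < c \<and> c < b \<and> \<not> S \<eta> c" by blast
    define c where "c = (u + v) / 2"
    have c: "u < c" "c < v" using uv(1) by (auto simp: c_def)
    define e where "e = min \<eta> (min (c - u) (v - c))"
    have e: "e > 0" using \<eta> c by (simp add: e_def)
    obtain x where x: "x \<in> Rn n" "\<bar>f x - c\<bar> < e" "(1 + l1_norm n x) * G x < e"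
      using ab(2)[of c] uv(2)[OF c] e unfolding asymptotic_critical_def by blast
    then have "S \<eta> (f x)" by (auto simp: S_def e_def)
    moreover have "u < f x" "f x < v" using x(2) by (auto simp: e_def)
    ultimately show False using uv(2) by blast
  qed
  have inf': "infinite {c. a < c \<and> c < b \<and> (\<forall>\<eta>. 0 < \<eta> \<longrightarrow> S \<eta> c)}"
  proof
    assume "finite {c. a < c \<and> c < b \<and> (\<forall>\<eta>. 0 < \<eta> \<longrightarrow> S \<eta> c)}"
    then have "countable ({c. a < c \<and> c < b \<and> (\<forall>\<eta>. 0 < \<eta> \<longrightarrow> S \<eta> c)} \<union> (\<Union>k::nat. {c. a < c \<and> c < b \<and> \<not> S (inverse (real (Suc k))) c}))"
      using fin by (intro countable_Un countable_UN) (auto intro: countable_finite)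
    moreover have "{a<..<b} \<subseteq> {c. a < c \<and> c < b \<and> (\<forall>\<eta>. 0 < \<eta> \<longrightarrow> S \<eta> c)} \<union> (\<Union>k::nat. {c. a < c \<and> c < b \<and> \<not> S (inverse (real (Suc k))) c})"
    proof
      fix c assume c: "c \<in> {a<..<b}"
      have "\<forall>\<eta>. 0 < \<eta> \<longrightarrow> S \<eta> c" if all: "\<And>k. S (inverse (real (Suc k))) c"
      proof (intro allI impI)
        fix \<eta> :: real assume "0 < \<eta>"
        then obtain k where "inverse (real (Suc k)) < \<eta>" using reals_Archimedean by blast
        then show "S \<eta> c" using Sm[OF all[of k]] by simp
      qed
      then show "c \<in> {c. a < c \<and> c < b \<and> (\<forall>\<eta>. 0 < \<eta> \<longrightarrow> S \<eta> c)} \<union> (\<Union>k::nat. {c. a < c \<and> c < b \<and> \<not> S (inverse (real (Suc k))) c})"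
        using c by auto
    qed
    ultimately show False using uncountable_open_interval[of a b] ab(1) countable_subset by blast
  qed
  have "definable_pred (\<lambda>e. a < e 0 \<and> e 0 < b \<and> (\<forall>\<eta>. 0 < \<eta> \<longrightarrow> S \<eta> (e 0)))"
    by (intro pred_conj pred_all pred_imp pred_less term_var term_const Sd)
  from infinite_contains_interval[OF this inf'] obtain a' b' where
    "a' < b'" "\<And>c. a' < c \<Longrightarrow> c < b' \<Longrightarrow> \<forall>\<eta>. 0 < \<eta> \<longrightarrow> S \<eta> c" by blast
  then show False using no_interval[of a' b'] unfolding S_def by blast
qed

end

theorem mainTheorem3:
  fixes D :: "nat \<Rightarrow> (nat \<Rightarrow> real) set set"
    and n :: nat
    and f :: "(nat \<Rightarrow> real) \<Rightarrow> real"
  assumes "o_minimal_structure D"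
    and "smooth_on n (Rn n) f"
    and "definable_fun D n f"
  shows "finite (bifurcation_set (Rn_manifold n) real_manifold f)"
proof -
  have smooth: "Ck_on k n (Rn n) f" for k using assms(2) by (simp add: smooth_on_def)
  interpret definable_smooth D n f
    using assms(1,3) smooth by (intro definable_smooth.intro definable_smooth_axioms.intro)
  have "bifurcation_set (Rn_manifold n) real_manifold f \<subseteq> {c. asymptotic_critical c}"
  proof
    fix c assume c: "c \<in> bifurcation_set (Rn_manifold n) real_manifold f"
    show "c \<in> {c. asymptotic_critical c}"
    proof (rule ccontr)
      assume "c \<notin> {c. asymptotic_critical c}"
      then obtain e where e0: "0 < e" "\<forall>x\<in>Rn n. \<not> (\<bar>f x - c\<bar> < e \<and> (1 + l1_norm n x) * G x < e)"
        by (auto simp: asymptotic_critical_def)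
      then have e: "0 < e" "\<And>x. x \<in> Rn n \<Longrightarrow> \<bar>f x - c\<bar> < e \<Longrightarrow> e \<le> (1 + l1_norm n x) * G x"
        by (auto simp: not_less)
      interpret regular_levels n f "c - e" "c + e" e
        using smooth e by unfold_locales (auto simp: abs_less_iff)
      have "typical_value (Rn_manifold n) real_manifold f c" using e(1) by (intro typical_value_in_band) auto
      then show False using c by (simp add: bifurcation_set_def)
    qed
  qed
  then show ?thesis using finite_asymptotic_critical finite_subset by blast
qed

end
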